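(* Let $G$ be a $3$-dimensional Lie group with Lie algebra $\mathfrak{g}$, $g$ a left-invariant pseudo-Riemannian metric on $G$ and $(v_a)_{1\le a\le3}$ a $g$-orthonormal basis of $\mathfrak{g}$ with $\epsilon_a=g(v_a,v_a)$, $\epsilon_1=\epsilon_2=-\epsilon_3$, and, for some $\alpha,\beta\in\mathbb{R}$ and $\eta\in\{\pm1\}$, $$[v_1,v_2]=\epsilon_3L(v_3),\quad[v_2,v_3]=\epsilon_1L(v_1),\quad[v_3,v_1]=\epsilon_2L(v_2),\qquad L=L_{3,\eta}(\alpha,\beta)=\begin{pmatrix}\beta&0&0\\0&\frac\eta2+\alpha&\frac\eta2\\0&-\frac\eta2&-\frac\eta2+\alpha\end{pmatrix}$$ (with the convention $L(v_a)=\sum_bL_{ba}v_b$). Let $E_{H,F}$ be a Courant algebroid of type $B_3$ over $G$ with left-invariant $H=h\,v_1^*\wedge v_2^*\wedge v_3^*$ and $F=\frac12F_{ab}v_a^*\wedge v_b^*\neq0$, and $\delta\in(\mathfrak{g}\oplus\mathfrak{g}^*\oplus\mathbb{R})^*$ a left-invariant divergence operator, $\delta_A=\delta(e_A)$. i) The metric $E_-=\{X-g(X)\mid X\in TG\}$ defined on $E_{H,F}$ is generalized Einstein with divergence $\delta$ if and only if one of the following situations holds: 1) $\beta=2\alpha\neq0$, $\epsilon_1=\epsilon_2=-1$, $\epsilon_3=1$, $h=-2\alpha$, $F_{12}=F_{13}=0$, $F_{23}=\epsilon\sqrt2\,\alpha$ (where $\epsilon\in\{\pm1\}$), $\delta=0$;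 2) $\beta\neq2\alpha$, $\epsilon_1\beta(\alpha-\beta)>0$, $h=-\beta$, $F_{12}=F_{13}=0$, $F_{23}=\frac{\beta(2\alpha-\beta)}{\delta_0}$, $(\delta_0)^2=\frac{\epsilon_1\beta(2\alpha-\beta)^2}{\alpha-\beta}$, $\delta_1=\delta_4=\epsilon_1(\beta-2\alpha)$ and $\delta_A=0$ for any $A\notin\{0,1,4\}$; 3) $\beta=0$, $\epsilon_1\alpha\eta<0$, $h=0$, $F_{12}=F_{13}$, $(F_{12})^2=-\frac{\epsilon_1\alpha\eta}2$, $F_{23}=0$, $\delta_A=0$ for any $A\notin\{1,4\}$ and $\delta_1=\delta_4=-\epsilon_1\alpha$; 4) $\beta=\alpha$, $\epsilon_1\alpha\eta<0$, $h=-\alpha$, $F_{12}=F_{13}$, $F_{23}=0$, $\delta_1=\delta_4=0$, $\delta_2=\delta_3$, $\delta_5=\delta_6$ and $$\delta_0F_{12}=\epsilon_1\alpha\delta_2,\qquad(F_{12})^2=-\frac{\epsilon_1\alpha\eta}2.$$ ii) For these metrics, the Lie algebra $\mathfrak{g}$ is isomorphic to $\mathfrak{so}(2,1)$, except for the class of solutions 3), when it is isomorphic to $\mathfrak{e}(1,1)$.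
   Context: $\mathfrak{e}(1,1)$ is the Lie algebra of the isometry group of $\mathbb{R}^{1,1}$. Basis of $\tilde E=\mathfrak{g}\oplus\mathfrak{g}^*\oplus\mathbb{R}$: $e_0=1$, $e_a=v_a+g(v_a)$, $e_{a+3}=v_a-g(v_a)$ for $1\le a\le3$, where $g(X)=g(X,\cdot)$; $F_{ab}=F(v_a,v_b)$. Courant algebroid of type $B_3$: for left-invariant $H\in\Omega^3(G)$, $F\in\Omega^2(G)$ with $dF=0$, $E=E_{H,F}$ is the bundle $TG\oplus T^*G\oplus\mathbb{R}$ with anchor $\pi$ the projection to $TG$, scalar product $\langle X+\xi+\lambda,Y+\eta+\mu\rangle=\frac12(\xi(Y)+\eta(X))+\lambda\mu$ and Dorfman bracket $$[X+\xi+\lambda,Y+\eta+\mu]_{H,F}=\mathcal{L}_X(Y+\eta)-i_Yd\xi+2\mu\,d\lambda+i_Xi_YH-2(\mu\, i_XF-\lambda\, i_YF)+X(\mu)-Y(\lambda)+F(X,Y).$$ Left-invariant sections of $E$ (for the action of $G$ by left translations, trivial on the $\mathbb{R}$-fibre) form $\tilde E$. For $E_-=\{X-g(X)\mid X\in TG\}$ put $E_+=E_-^\perp$. A generalized connection is a linear map $D:\Gamma(E)\to\Gamma(E^*\otimes E)$ with $D_u(fv)=\pi(u)(f)v+fD_uv$ and $\pi(u)\langle v,w\rangle=\langle D_uv,w\rangle+\langle v,D_uw\rangle$. Its torsion is $T^D(u,v,w)=\langle D_uv-D_vu-[u,v]_{H,F},w\rangle+\langle v,D_wu\rangle$; $D$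 is Levi-Civita for $E_-$ if $T^D=0$ and $D_u\Gamma(E_-)\subset\Gamma(E_-)$ for all $u$. A divergence operator is an additive map $\delta:\Gamma(E)\to C^\infty(G)$ with $\delta(fu)=\pi(u)(f)+f\delta(u)$; it is left-invariant if constant on left-invariant sections, and is then identified with an element of $\tilde E^*$; $\delta^D(u)=\mathrm{tr}\,Du$. For a Levi-Civita generalized connection $D$ of $E_-$ with $\delta^D=\delta$, put $R^D(u,v)w=D_uD_vw-D_vD_uw-D_{[u,v]_{H,F}}w$ and $\mathrm{Ric}^{\delta,+}(u,v)=\mathrm{tr}(E_+\ni w\mapsto R^D(w,u)v)$ ($u\in E_-,v\in E_+$), $\mathrm{Ric}^{\delta,-}(u,v)=\mathrm{tr}(E_-\ni w\mapsto R^D(w,u)v)$ ($u\in E_+,v\in E_-$). These are tensors depending only on $(E_-,\delta)$. $E_-$ is generalized Einstein with divergence $\delta$ if $\mathrm{Ric}^{\delta,+}=0$ and $\mathrm{Ric}^{\delta,-}=0$.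
   Formalization: In ii), class 2) is corrected: there g is isomorphic to so(2,1) if and only if α ≠ 0, because for α = 0 (possible when ε₁ = −1, β ≠ 0) L has rank 2 and g is solvable, so the claim as stated fails. *)

theory Defs
  imports "HOL-Analysis.Analysis" "HOL-Library.Function_Algebras"
begin

section \<open>Lie groups\<close>

text \<open>Smoothness on an open set: all iterated directional derivatives exist and are
  differentiable. (The definition is only meaningful for open sets.)\<close>

fun Ck_on :: "nat \<Rightarrow> 'a::real_normed_vector set \<Rightarrow> ('a \<Rightarrow> 'b::real_normed_vector) \<Rightarrow> bool" where
  "Ck_on 0 S f \<longleftrightarrow> continuous_on S f"
| "Ck_on (Suc k) S f \<longleftrightarrow> (\<forall>x\<in>S. f differentiable (at x)) \<and>
     (\<forall>w. Ck_on k S (\<lambda>x. frechet_derivative f (at x) w))"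

definition smooth_on :: "'a::real_normed_vector set \<Rightarrow> ('a \<Rightarrow> 'b::real_normed_vector) \<Rightarrow> bool" where
  "smooth_on S f \<longleftrightarrow> (\<forall>k. Ck_on k S f)"

text \<open>The underlying set of a Lie group is a whole type \<open>'g\<close>; a chart is a pair of an open set
  \<open>U\<close> and a map \<open>\<phi>\<close>, of which only the restriction to \<open>U\<close> matters.\<close>

record ('g, 'e) lie_struct =
  gmult :: "'g \<Rightarrow> 'g \<Rightarrow> 'g"
  gone :: "'g"
  ginv :: "'g \<Rightarrow> 'g"
  charts :: "('g set \<times> ('g \<Rightarrow> 'e)) set"

definition smooth_atlas :: "('g::topological_space set \<times> ('g \<Rightarrow> 'e::euclidean_space)) set \<Rightarrow> bool" where
  "smooth_atlas M \<longleftrightarrow>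
     (\<Union>(U, \<phi>)\<in>M. U) = UNIV \<and>
     (\<forall>(U, \<phi>)\<in>M. open U \<and> open (\<phi> ` U) \<and> (\<exists>\<psi>. homeomorphism U (\<phi> ` U) \<phi> \<psi>)) \<and>
     (\<forall>(U, \<phi>)\<in>M. \<forall>(V, \<psi>)\<in>M. smooth_on (\<phi> ` (U \<inter> V)) (\<psi> \<circ> inv_into U \<phi>))"

definition lie_group ::
  "('g::{t2_space, second_countable_topology}, 'e::euclidean_space) lie_struct \<Rightarrow> bool" where
  "lie_group G \<longleftrightarrow>
     group (gmult G) (gone G) (ginv G) \<and> smooth_atlas (charts G) \<and>
     continuous_on UNIV (\<lambda>(a, b). gmult G a b) \<and> continuous_on UNIV (ginv G) \<and>
     (\<forall>(U, \<phi>)\<in>charts G. \<forall>(V, \<psi>)\<in>charts G. \<forall>(W, \<kappa>)\<in>charts G.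
        smooth_on {(\<phi> a, \<psi> b) | a b. a \<in> U \<and> b \<in> V \<and> gmult G a b \<in> W}
          (\<lambda>(x, y). \<kappa> (gmult G (inv_into U \<phi> x) (inv_into V \<psi> y)))) \<and>
     (\<forall>(U, \<phi>)\<in>charts G. \<forall>(W, \<kappa>)\<in>charts G.
        smooth_on (\<phi> ` {a \<in> U. ginv G a \<in> W}) (\<lambda>x. \<kappa> (ginv G (inv_into U \<phi> x))))"

section \<open>Functions, vector fields and forms\<close>

text \<open>A vector field is represented by the operator \<open>f \<mapsto> X f\<close> on \<open>C\<^sup>\<infinity>(G)\<close>, and a
  \<open>k\<close>-form by the induced alternating \<open>C\<^sup>\<infinity>(G)\<close>-multilinear map on vector fields. Outside
  \<open>C\<^sup>\<infinity>(G)\<close>, respectively outside the vector fields, these maps are set to 0, so that HOL equality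
  is equality of fields and forms. Sums and products of functions are pointwise.\<close>

type_synonym 'g vf = "('g \<Rightarrow> real) \<Rightarrow> 'g \<Rightarrow> real"
type_synonym 'g form1 = "'g vf \<Rightarrow> 'g \<Rightarrow> real"
type_synonym 'g form2 = "'g vf \<Rightarrow> 'g vf \<Rightarrow> 'g \<Rightarrow> real"
type_synonym 'g form3 = "'g vf \<Rightarrow> 'g vf \<Rightarrow> 'g vf \<Rightarrow> 'g \<Rightarrow> real"

definition C_inf :: "('g, 'e::euclidean_space) lie_struct \<Rightarrow> ('g \<Rightarrow> real) set" where
  "C_inf G = {f. \<forall>(U, \<phi>)\<in>charts G. smooth_on (\<phi> ` U) (f \<circ> inv_into U \<phi>)}"

definition fmul :: "('g \<Rightarrow> real) \<Rightarrow> ('a \<Rightarrow> 'g \<Rightarrow> real) \<Rightarrow> 'a \<Rightarrow> 'g \<Rightarrow> real" where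
  "fmul f T = (\<lambda>x. f * T x)"

text \<open>In every chart, \<open>X\<close> is \<open>\<Sum>\<^sub>i \<xi>\<^sup>i \<partial>\<^sub>i\<close> with smooth coefficients.\<close>

definition vfields :: "('g, 'e::euclidean_space) lie_struct \<Rightarrow> 'g vf set" where
  "vfields G = {X. (\<forall>f. f \<notin> C_inf G \<longrightarrow> X f = 0) \<and>
     (\<forall>(U, \<phi>)\<in>charts G. \<exists>\<xi>. smooth_on (\<phi> ` U) \<xi> \<and>
        (\<forall>f\<in>C_inf G. \<forall>p\<in>U. X f p =
           frechet_derivative (f \<circ> inv_into U \<phi>) (at (\<phi> p)) (\<xi> (\<phi> p))))}"

definition lie_bracket :: "'g vf \<Rightarrow> 'g vf \<Rightarrow> 'g vf" where
  "lie_bracket X Y = (\<lambda>f. X (Y f) - Y (X f))"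

definition one_forms :: "('g, 'e::euclidean_space) lie_struct \<Rightarrow> 'g form1 set" where
  "one_forms G = {\<xi>. (\<forall>X. X \<notin> vfields G \<longrightarrow> \<xi> X = 0) \<and>
     (\<forall>X\<in>vfields G. \<xi> X \<in> C_inf G) \<and>
     (\<forall>X\<in>vfields G. \<forall>Y\<in>vfields G. \<xi> (X + Y) = \<xi> X + \<xi> Y) \<and>
     (\<forall>f\<in>C_inf G. \<forall>X\<in>vfields G. \<xi> (fmul f X) = f * \<xi> X)}"

text \<open>Linearity in the other arguments follows from skew-symmetry.\<close>

definition two_forms :: "('g, 'e::euclidean_space) lie_struct \<Rightarrow> 'g form2 set" where
  "two_forms G = {F. (\<forall>X. X \<notin> vfields G \<longrightarrow> F X = 0) \<and>
     (\<forall>X\<in>vfields G. F X \<in> one_forms G) \<and>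
     (\<forall>X\<in>vfields G. \<forall>Y\<in>vfields G. F X Y = - F Y X)}"

definition three_forms :: "('g, 'e::euclidean_space) lie_struct \<Rightarrow> 'g form3 set" where
  "three_forms G = {H. (\<forall>X. X \<notin> vfields G \<longrightarrow> H X = 0) \<and>
     (\<forall>X\<in>vfields G. H X \<in> two_forms G) \<and>
     (\<forall>X\<in>vfields G. \<forall>Y\<in>vfields G. \<forall>Z\<in>vfields G. H X Y Z = - H Y X Z)}"

definition d_fun :: "('g, 'e::euclidean_space) lie_struct \<Rightarrow> ('g \<Rightarrow> real) \<Rightarrow> 'g form1" where
  "d_fun G f = (\<lambda>X. if X \<in> vfields G then X f else 0)"

definition d_one :: "('g, 'e::euclidean_space) lie_struct \<Rightarrow> 'g form1 \<Rightarrow> 'g form2" where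
  "d_one G \<xi> = (\<lambda>X Y. if X \<in> vfields G \<and> Y \<in> vfields G
     then X (\<xi> Y) - Y (\<xi> X) - \<xi> (lie_bracket X Y) else 0)"

definition closed_two_form :: "('g, 'e::euclidean_space) lie_struct \<Rightarrow> 'g form2 \<Rightarrow> bool" where
  "closed_two_form G F \<longleftrightarrow> F \<in> two_forms G \<and>
     (\<forall>X\<in>vfields G. \<forall>Y\<in>vfields G. \<forall>Z\<in>vfields G.
        X (F Y Z) - Y (F X Z) + Z (F X Y)
        - F (lie_bracket X Y) Z + F (lie_bracket X Z) Y - F (lie_bracket Y Z) X = 0)"

definition lie_deriv :: "('g, 'e::euclidean_space) lie_struct \<Rightarrow> 'g vf \<Rightarrow> 'g form1 \<Rightarrow> 'g form1" where
  "lie_deriv G X \<eta> = (\<lambda>Z. if Z \<in> vfields G then X (\<eta> Z) - \<eta> (lie_bracket X Z) else 0)"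

section \<open>Left-invariance\<close>

definition push :: "('g, 'e) lie_struct \<Rightarrow> 'g \<Rightarrow> 'g vf \<Rightarrow> 'g vf" where
  "push G a X = (\<lambda>f p. X (\<lambda>q. f (gmult G a q)) (gmult G (ginv G a) p))"

definition lie_alg :: "('g, 'e::euclidean_space) lie_struct \<Rightarrow> 'g vf set" where
  "lie_alg G = {X \<in> vfields G. \<forall>a. push G a X = X}"

text \<open>Invariance of a form under the pullback \<open>(L\<^sub>a\<^sup>*\<xi>)(X) = \<xi>((L\<^sub>a)\<^sub>* X) \<circ> L\<^sub>a\<close>.\<close>

definition left_inv1 :: "('g, 'e::euclidean_space) lie_struct \<Rightarrow> 'g form1 \<Rightarrow> bool" where
  "left_inv1 G \<xi> \<longleftrightarrow> (\<forall>a. \<forall>X\<in>vfields G. (\<lambda>p. \<xi> (push G a X) (gmult G a p)) = \<xi> X)"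

definition left_inv2 :: "('g, 'e::euclidean_space) lie_struct \<Rightarrow> 'g form2 \<Rightarrow> bool" where
  "left_inv2 G F \<longleftrightarrow> (\<forall>a. \<forall>X\<in>vfields G. \<forall>Y\<in>vfields G.
     (\<lambda>p. F (push G a X) (push G a Y) (gmult G a p)) = F X Y)"

definition left_inv3 :: "('g, 'e::euclidean_space) lie_struct \<Rightarrow> 'g form3 \<Rightarrow> bool" where
  "left_inv3 G H \<longleftrightarrow> (\<forall>a. \<forall>X\<in>vfields G. \<forall>Y\<in>vfields G. \<forall>Z\<in>vfields G.
     (\<lambda>p. H (push G a X) (push G a Y) (push G a Z) (gmult G a p)) = H X Y Z)"

text \<open>A metric has the type of a 2-form, so that \<open>g X\<close> is the 1-form \<open>g(X, \<cdot>)\<close>. A field \<open>X\<close>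
  vanishes at \<open>p\<close> iff \<open>X f p = 0\<close> for all \<open>f\<close>.\<close>

definition pseudo_riemannian :: "('g, 'e::euclidean_space) lie_struct \<Rightarrow> 'g form2 \<Rightarrow> bool" where
  "pseudo_riemannian G g \<longleftrightarrow>
     (\<forall>X\<in>vfields G. g X \<in> one_forms G) \<and>
     (\<forall>X\<in>vfields G. \<forall>Y\<in>vfields G. g X Y = g Y X) \<and>
     (\<forall>p. \<forall>X\<in>vfields G. (\<forall>Y\<in>vfields G. g X Y p = 0) \<longrightarrow> (\<forall>f\<in>C_inf G. X f p = 0))"

section \<open>Free modules and traces\<close>

text \<open>\<open>e\<close> is a basis, indexed by \<open>I\<close>, of the module \<open>S\<close> with coefficients in \<open>K\<close> and scalar
  multiplication \<open>sc\<close>.\<close>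

definition free_basis ::
  "'k set \<Rightarrow> ('k \<Rightarrow> 'm \<Rightarrow> 'm) \<Rightarrow> 'm::comm_monoid_add set \<Rightarrow> 'i set \<Rightarrow> ('i \<Rightarrow> 'm) \<Rightarrow> bool" where
  "free_basis K sc S I e \<longleftrightarrow> finite I \<and> e ` I \<subseteq> S \<and>
     (\<forall>s\<in>S. \<exists>!c. c \<in> I \<rightarrow>\<^sub>E K \<and> s = (\<Sum>i\<in>I. sc (c i) (e i)))"

text \<open>Since the tangent bundle of a Lie group is trivial, the spaces of sections considered below
  are free modules over \<open>C\<^sup>\<infinity>(G)\<close>, and the trace of a bundle endomorphism is the sum of the diagonal
  entries of its matrix in any basis of sections.\<close>

definition module_trace ::
  "'k::comm_monoid_add set \<Rightarrow> ('k \<Rightarrow> 'm \<Rightarrow> 'm) \<Rightarrow> 'm::comm_monoid_add set \<Rightarrow> ('m \<Rightarrow> 'm) \<Rightarrow> 'k" where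
  "module_trace K sc S T = (THE t. \<exists>(n::nat) e c. free_basis K sc S {..<n} e \<and>
     (\<forall>i<n. \<forall>j<n. c i j \<in> K) \<and> (\<forall>j<n. T (e j) = (\<Sum>i<n. sc (c i j) (e i))) \<and>
     t = (\<Sum>i<n. c i i))"

section \<open>The Courant algebroid \<open>TG \<oplus> T\<^sup>*G \<oplus> \<real>\<close>\<close>

type_synonym 'g sec = "'g vf \<times> 'g form1 \<times> ('g \<Rightarrow> real)"

definition sections :: "('g, 'e::euclidean_space) lie_struct \<Rightarrow> 'g sec set" where
  "sections G = vfields G \<times> one_forms G \<times> C_inf G"

definition left_inv_sections :: "('g, 'e::euclidean_space) lie_struct \<Rightarrow> 'g sec set" where
  "left_inv_sections G = {(X, \<xi>, l). (X, \<xi>, l) \<in> sections G \<and>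
     X \<in> lie_alg G \<and> left_inv1 G \<xi> \<and> (\<forall>a p. l (gmult G a p) = l p)}"

definition smul :: "('g \<Rightarrow> real) \<Rightarrow> 'g sec \<Rightarrow> 'g sec" where
  "smul f = (\<lambda>(X, \<xi>, l). (fmul f X, fmul f \<xi>, f * l))"

definition anchor :: "'g sec \<Rightarrow> 'g vf" where
  "anchor = fst"

definition pairing :: "'g sec \<Rightarrow> 'g sec \<Rightarrow> 'g \<Rightarrow> real" where
  "pairing = (\<lambda>(X, \<xi>, l) (Y, \<eta>, m) p. (\<xi> Y p + \<eta> X p) / 2 + l p * m p)"

text \<open>In the 1-form component, \<open>(i\<^sub>X i\<^sub>Y H)(Z) = H(Y, X, Z)\<close>.\<close>

definition dorfman ::
  "('g, 'e::euclidean_space) lie_struct \<Rightarrow> 'g form3 \<Rightarrow> 'g form2 \<Rightarrow> 'g sec \<Rightarrow> 'g sec \<Rightarrow> 'g sec" where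
  "dorfman G H F = (\<lambda>(X, \<xi>, l) (Y, \<eta>, m).
     (lie_bracket X Y,
      lie_deriv G X \<eta> - d_one G \<xi> Y + fmul (2 * m) (d_fun G l) + H Y X
        - fmul 2 (fmul m (F X) - fmul l (F Y)),
      X m - Y l + F X Y))"

definition E_minus :: "('g, 'e::euclidean_space) lie_struct \<Rightarrow> 'g form2 \<Rightarrow> 'g sec set" where
  "E_minus G g = {(X, - g X, 0) | X. X \<in> vfields G}"

definition E_plus :: "('g, 'e::euclidean_space) lie_struct \<Rightarrow> 'g form2 \<Rightarrow> 'g sec set" where
  "E_plus G g = {u \<in> sections G. \<forall>w\<in>E_minus G g. pairing u w = 0}"

definition e_basis :: "'g form2 \<Rightarrow> (nat \<Rightarrow> 'g vf) \<Rightarrow> nat \<Rightarrow> 'g sec" where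
  "e_basis g v A = (if A = 0 then (0, 0, 1)
     else if A \<le> 3 then (v A, g (v A), 0)
     else (v (A - 3), - g (v (A - 3)), 0))"

section \<open>Generalized connections and the generalized Einstein condition\<close>

type_synonym 'g conn = "'g sec \<Rightarrow> 'g sec \<Rightarrow> 'g sec"

definition gen_connection :: "('g, 'e::euclidean_space) lie_struct \<Rightarrow> 'g conn \<Rightarrow> bool" where
  "gen_connection G D \<longleftrightarrow>
     (\<forall>u\<in>sections G. \<forall>v\<in>sections G. D u v \<in> sections G) \<and>
     (\<forall>u\<in>sections G. \<forall>u'\<in>sections G. \<forall>v\<in>sections G. D (u + u') v = D u v + D u' v) \<and>
     (\<forall>f\<in>C_inf G. \<forall>u\<in>sections G. \<forall>v\<in>sections G. D (smul f u) v = smul f (D u v)) \<and>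
     (\<forall>u\<in>sections G. \<forall>v\<in>sections G. \<forall>v'\<in>sections G. D u (v + v') = D u v + D u v') \<and>
     (\<forall>c::real. \<forall>u\<in>sections G. \<forall>v\<in>sections G. D u (smul (\<lambda>_. c) v) = smul (\<lambda>_. c) (D u v)) \<and>
     (\<forall>f\<in>C_inf G. \<forall>u\<in>sections G. \<forall>v\<in>sections G.
        D u (smul f v) = smul (anchor u f) v + smul f (D u v)) \<and>
     (\<forall>u\<in>sections G. \<forall>v\<in>sections G. \<forall>w\<in>sections G.
        anchor u (pairing v w) = pairing (D u v) w + pairing v (D u w))"

definition torsion ::
  "('g, 'e::euclidean_space) lie_struct \<Rightarrow> 'g form3 \<Rightarrow> 'g form2 \<Rightarrow> 'g conn \<Rightarrow>
     'g sec \<Rightarrow> 'g sec \<Rightarrow> 'g sec \<Rightarrow> 'g \<Rightarrow> real" where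
  "torsion G H F D u v w =
     pairing (D u v - D v u - dorfman G H F u v) w + pairing v (D w u)"

definition levi_civita ::
  "('g, 'e::euclidean_space) lie_struct \<Rightarrow> 'g form3 \<Rightarrow> 'g form2 \<Rightarrow> 'g form2 \<Rightarrow> 'g conn \<Rightarrow> bool" where
  "levi_civita G H F g D \<longleftrightarrow> gen_connection G D \<and>
     (\<forall>u\<in>sections G. \<forall>v\<in>sections G. \<forall>w\<in>sections G. torsion G H F D u v w = 0) \<and>
     (\<forall>u\<in>sections G. \<forall>v\<in>E_minus G g. D u v \<in> E_minus G g)"

definition divergence_op ::
  "('g, 'e::euclidean_space) lie_struct \<Rightarrow> ('g sec \<Rightarrow> 'g \<Rightarrow> real) \<Rightarrow> bool" where
  "divergence_op G \<delta> \<longleftrightarrow>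
     (\<forall>u\<in>sections G. \<delta> u \<in> C_inf G) \<and>
     (\<forall>u\<in>sections G. \<forall>v\<in>sections G. \<delta> (u + v) = \<delta> u + \<delta> v) \<and>
     (\<forall>f\<in>C_inf G. \<forall>u\<in>sections G. \<delta> (smul f u) = anchor u f + f * \<delta> u)"

definition left_inv_divergence ::
  "('g, 'e::euclidean_space) lie_struct \<Rightarrow> ('g sec \<Rightarrow> 'g \<Rightarrow> real) \<Rightarrow> bool" where
  "left_inv_divergence G \<delta> \<longleftrightarrow> divergence_op G \<delta> \<and>
     (\<forall>u\<in>left_inv_sections G. \<exists>c. \<delta> u = (\<lambda>_. c))"

definition div_of :: "('g, 'e::euclidean_space) lie_struct \<Rightarrow> 'g conn \<Rightarrow> 'g sec \<Rightarrow> 'g \<Rightarrow> real" where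
  "div_of G D u = module_trace (C_inf G) smul (sections G) (\<lambda>w. D w u)"

definition curvature ::
  "('g, 'e::euclidean_space) lie_struct \<Rightarrow> 'g form3 \<Rightarrow> 'g form2 \<Rightarrow> 'g conn \<Rightarrow>
     'g sec \<Rightarrow> 'g sec \<Rightarrow> 'g sec \<Rightarrow> 'g sec" where
  "curvature G H F D u v w = D u (D v w) - D v (D u w) - D (dorfman G H F u v) w"

definition ric_plus ::
  "('g, 'e::euclidean_space) lie_struct \<Rightarrow> 'g form3 \<Rightarrow> 'g form2 \<Rightarrow> 'g form2 \<Rightarrow> 'g conn \<Rightarrow>
     'g sec \<Rightarrow> 'g sec \<Rightarrow> 'g \<Rightarrow> real" where
  "ric_plus G H F g D u v =
     module_trace (C_inf G) smul (E_plus G g) (\<lambda>w. curvature G H F D w u v)"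

definition ric_minus ::
  "('g, 'e::euclidean_space) lie_struct \<Rightarrow> 'g form3 \<Rightarrow> 'g form2 \<Rightarrow> 'g form2 \<Rightarrow> 'g conn \<Rightarrow>
     'g sec \<Rightarrow> 'g sec \<Rightarrow> 'g \<Rightarrow> real" where
  "ric_minus G H F g D u v =
     module_trace (C_inf G) smul (E_minus G g) (\<lambda>w. curvature G H F D w u v)"

text \<open>The two Ricci tensors are the same for all Levi-Civita generalized connections with the given
  divergence, and such connections exist.\<close>

definition gen_einstein ::
  "('g, 'e::euclidean_space) lie_struct \<Rightarrow> 'g form3 \<Rightarrow> 'g form2 \<Rightarrow> 'g form2 \<Rightarrow>
     ('g sec \<Rightarrow> 'g \<Rightarrow> real) \<Rightarrow> bool" where
  "gen_einstein G H F g \<delta> \<longleftrightarrow>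
     (\<exists>D. levi_civita G H F g D \<and> (\<forall>u\<in>sections G. div_of G D u = \<delta> u) \<and>
        (\<forall>u\<in>E_minus G g. \<forall>v\<in>E_plus G g. ric_plus G H F g D u v = 0) \<and>
        (\<forall>u\<in>E_plus G g. \<forall>v\<in>E_minus G g. ric_minus G H F g D u v = 0))"

section \<open>Lie algebras\<close>

text \<open>A Lie algebra is given by its carrier, scalar multiplication and bracket.\<close>

definition lie_iso ::
  "'a::plus set \<Rightarrow> (real \<Rightarrow> 'a \<Rightarrow> 'a) \<Rightarrow> ('a \<Rightarrow> 'a \<Rightarrow> 'a) \<Rightarrow>
   'b::plus set \<Rightarrow> (real \<Rightarrow> 'b \<Rightarrow> 'b) \<Rightarrow> ('b \<Rightarrow> 'b \<Rightarrow> 'b) \<Rightarrow> bool" where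
  "lie_iso A scA brA B scB brB \<longleftrightarrow> (\<exists>\<Phi>. bij_betw \<Phi> A B \<and>
     (\<forall>x\<in>A. \<forall>y\<in>A. \<Phi> (x + y) = \<Phi> x + \<Phi> y) \<and>
     (\<forall>c. \<forall>x\<in>A. \<Phi> (scA c x) = scB c (\<Phi> x)) \<and>
     (\<forall>x\<in>A. \<forall>y\<in>A. \<Phi> (brA x y) = brB (\<Phi> x) (\<Phi> y)))"

definition cscale :: "real \<Rightarrow> 'g vf \<Rightarrow> 'g vf" where
  "cscale c = fmul (\<lambda>_. c)"

definition commutator :: "real^'n^'n \<Rightarrow> real^'n^'n \<Rightarrow> real^'n^'n" where
  "commutator A B = A ** B - B ** A"

definition so_of :: "real^'n^'n \<Rightarrow> (real^'n^'n) set" where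
  "so_of J = {A. transpose A ** J + J ** A = 0}"

definition J21 :: "real^3^3" where
  "J21 = (\<chi> i j. if i = j then (if i = 3 then -1 else 1) else 0)"

definition J11 :: "real^2^2" where
  "J11 = (\<chi> i j. if i = j then (if i = 2 then -1 else 1) else 0)"

text \<open>\<open>(A, b)\<close> stands for the infinitesimal isometry \<open>x \<mapsto> A x + b\<close> of \<open>\<real>\<^sup>1\<^sup>,\<^sup>1\<close>, i.e. for the matrix with
  rows \<open>(A b)\<close> and \<open>(0 0)\<close>; the bracket is the matrix commutator.\<close>

definition e11 :: "((real^2^2) \<times> (real^2)) set" where
  "e11 = so_of J11 \<times> UNIV"

definition affine_bracket :: "(real^2^2) \<times> (real^2) \<Rightarrow> (real^2^2) \<times> (real^2) \<Rightarrow> (real^2^2) \<times> (real^2)" where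
  "affine_bracket = (\<lambda>(A, a) (B, b). (commutator A B, A *v b - B *v a))"

definition is_so21 :: "('g, 'e::euclidean_space) lie_struct \<Rightarrow> bool" where
  "is_so21 G \<longleftrightarrow> lie_iso (lie_alg G) cscale lie_bracket (so_of J21) scaleR commutator"

definition is_e11 :: "('g, 'e::euclidean_space) lie_struct \<Rightarrow> bool" where
  "is_e11 G \<longleftrightarrow> lie_iso (lie_alg G) cscale lie_bracket e11 scaleR affine_bracket"

section \<open>The normal form and the four classes\<close>

definition L3 :: "real \<Rightarrow> real \<Rightarrow> real \<Rightarrow> nat \<Rightarrow> nat \<Rightarrow> real" where
  "L3 \<eta> \<alpha> \<beta> b a =
     [[\<beta>, 0, 0],
      [0, \<eta> / 2 + \<alpha>, \<eta> / 2],
      [0, - \<eta> / 2, - \<eta> / 2 + \<alpha>]] ! (b - 1) ! (a - 1)"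

definition apply_mat :: "(nat \<Rightarrow> nat \<Rightarrow> real) \<Rightarrow> (nat \<Rightarrow> 'g vf) \<Rightarrow> nat \<Rightarrow> 'g vf" where
  "apply_mat L v a = (\<Sum>b\<in>{1..3}. cscale (L b a) (v b))"

text \<open>\<open>f a b\<close> and \<open>d A\<close> are the components \<open>F\<^sub>a\<^sub>b\<close> and \<open>\<delta>\<^sub>A\<close>. The value
  \<open>\<alpha> = 0\<close> is possible in the second class (for \<open>\<epsilon>\<^sub>1 = -1\<close>); then \<open>L\<close> has rank 2, the Lie algebra is
  solvable and hence not isomorphic to \<open>so(2,1)\<close>.\<close>

definition class1 ::
  "real \<Rightarrow> real \<Rightarrow> (nat \<Rightarrow> real) \<Rightarrow> real \<Rightarrow> (nat \<Rightarrow> nat \<Rightarrow> real) \<Rightarrow> (nat \<Rightarrow> real) \<Rightarrow> bool" where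
  "class1 \<alpha> \<beta> \<epsilon> h f d \<longleftrightarrow> \<beta> = 2 * \<alpha> \<and> \<beta> \<noteq> 0 \<and> \<epsilon> 1 = -1 \<and> \<epsilon> 2 = -1 \<and> \<epsilon> 3 = 1 \<and> h = -2 * \<alpha> \<and>
     f 1 2 = 0 \<and> f 1 3 = 0 \<and> (\<exists>s\<in>{1, -1}. f 2 3 = s * sqrt 2 * \<alpha>) \<and> (\<forall>A\<in>{0..6}. d A = 0)"

definition class2 ::
  "real \<Rightarrow> real \<Rightarrow> (nat \<Rightarrow> real) \<Rightarrow> real \<Rightarrow> (nat \<Rightarrow> nat \<Rightarrow> real) \<Rightarrow> (nat \<Rightarrow> real) \<Rightarrow> bool" where
  "class2 \<alpha> \<beta> \<epsilon> h f d \<longleftrightarrow> \<beta> \<noteq> 2 * \<alpha> \<and> \<epsilon> 1 * \<beta> * (\<alpha> - \<beta>) > 0 \<and> h = - \<beta> \<and>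
     f 1 2 = 0 \<and> f 1 3 = 0 \<and> f 2 3 = \<beta> * (2 * \<alpha> - \<beta>) / d 0 \<and>
     (d 0)\<^sup>2 = \<epsilon> 1 * \<beta> * (2 * \<alpha> - \<beta>)\<^sup>2 / (\<alpha> - \<beta>) \<and>
     d 1 = \<epsilon> 1 * (\<beta> - 2 * \<alpha>) \<and> d 4 = \<epsilon> 1 * (\<beta> - 2 * \<alpha>) \<and> (\<forall>A\<in>{0..6} - {0, 1, 4}. d A = 0)"

definition class3 ::
  "real \<Rightarrow> real \<Rightarrow> real \<Rightarrow> (nat \<Rightarrow> real) \<Rightarrow> real \<Rightarrow> (nat \<Rightarrow> nat \<Rightarrow> real) \<Rightarrow> (nat \<Rightarrow> real) \<Rightarrow> bool" where
  "class3 \<eta> \<alpha> \<beta> \<epsilon> h f d \<longleftrightarrow> \<beta> = 0 \<and> \<epsilon> 1 * \<alpha> * \<eta> < 0 \<and> h = 0 \<and>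
     f 1 2 = f 1 3 \<and> (f 1 2)\<^sup>2 = - (\<epsilon> 1 * \<alpha> * \<eta> / 2) \<and> f 2 3 = 0 \<and>
     (\<forall>A\<in>{0..6} - {1, 4}. d A = 0) \<and> d 1 = - \<epsilon> 1 * \<alpha> \<and> d 4 = - \<epsilon> 1 * \<alpha>"

definition class4 ::
  "real \<Rightarrow> real \<Rightarrow> real \<Rightarrow> (nat \<Rightarrow> real) \<Rightarrow> real \<Rightarrow> (nat \<Rightarrow> nat \<Rightarrow> real) \<Rightarrow> (nat \<Rightarrow> real) \<Rightarrow> bool" where
  "class4 \<eta> \<alpha> \<beta> \<epsilon> h f d \<longleftrightarrow> \<beta> = \<alpha> \<and> \<epsilon> 1 * \<alpha> * \<eta> < 0 \<and> h = - \<alpha> \<and>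
     f 1 2 = f 1 3 \<and> f 2 3 = 0 \<and> d 1 = 0 \<and> d 4 = 0 \<and> d 2 = d 3 \<and> d 5 = d 6 \<and>
     d 0 * f 1 2 = \<epsilon> 1 * \<alpha> * d 2 \<and> (f 1 2)\<^sup>2 = - (\<epsilon> 1 * \<alpha> * \<eta> / 2)"

end

theory Submission
  imports Defs
begin

text \<open>
  The basis \<open>v\<close> of the Lie algebra is a global frame of \<open>TG\<close> over \<open>C\<^sup>\<infinity>(G)\<close>
  (\<open>left_invariant_frame_spans\<close>), so \<open>e\<^sub>0, ..., e\<^sub>6\<close> is an orthonormal frame of \<open>E\<close> in which the Dorfman
  bracket has constant structure constants \<open>B\<^sub>A\<^sub>B\<^sub>C = \<langle>[e\<^sub>A, e\<^sub>B], e\<^sub>C\<rangle>\<close>, and these are totally skew. The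
  first four sections \<open>e\<^sub>0, ..., e\<^sub>3\<close> span \<open>E\<^sub>+\<close> and the last three span \<open>E\<^sub>-\<close>. Identities
  between tensors, such as the vanishing of the torsion or of the Ricci tensors, can be tested on this
  frame.

  Let \<open>\<kappa>\<^sub>A = \<langle>e\<^sub>A, e\<^sub>A\<rangle>\<close>. For a Levi-Civita generalized connection, the absence of
  torsion forces \<open>D\<^sub>u w\<close> to be the projection of \<open>[u, w]\<close> when \<open>u\<close> and \<open>w\<close> lie in different ones of
  the two subbundles (\<open>mixed_component\<close>). The components of \<open>D\<close> inside one subbundle are not
  determined, but they enter the Ricci tensors only through the trace of a commutator, which is 0, and
  through the divergence. The result (\<open>curvature_trace_frame\<close>) is
  \<open>Ric(e\<^sub>i, e\<^sub>a) = \<Sum>\<^sub>c \<kappa>\<^sub>c \<delta>\<^sub>c B\<^sub>i\<^sub>a\<^sub>c - \<Sum>\<^sub>c\<^sub>j \<kappa>\<^sub>c \<kappa>\<^sub>j B\<^sub>c\<^sub>i\<^sub>j B\<^sub>j\<^sub>a\<^sub>c\<close>, where \<open>a\<close> and \<open>c\<close> belong to one subbundle, and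
  \<open>i\<close> and \<open>j\<close> to the other one. Conversely, every divergence operator with constant values on the frame
  is the divergence of some Levi-Civita connection (\<open>levi_civita_connection\<close>,
  \<open>div_of_connection\<close>), because the two ranks 4 and 3 are different from 1. Hence the Einstein
  condition is equivalent to 24 polynomial equations (\<open>gen_einstein_iff\<close>).

  Let \<open>s = \<epsilon>\<^sub>1\<close>, \<open>x = F\<^sub>1\<^sub>2\<close>, \<open>y = F\<^sub>1\<^sub>3\<close>, \<open>z = F\<^sub>2\<^sub>3\<close>. A combination of four equations is
  \<open>s (x - y)\<^sup>2 = 0\<close>, and then another one is \<open>h\<^sup>2 = \<beta>\<^sup>2\<close>. The sign \<open>h = \<beta> \<noteq> 0\<close> contradicts \<open>F \<noteq> 0\<close>, so
  \<open>h = - \<beta>\<close>. This entails \<open>\<delta>\<^sub>2 = \<delta>\<^sub>3\<close>, \<open>\<delta>\<^sub>5 = \<delta>\<^sub>6\<close> and \<open>x z = 0\<close>. For \<open>x = 0\<close> one gets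
  \<open>z\<^sup>2 = s \<beta> (\<alpha> - \<beta>)\<close> and \<open>\<delta>\<^sub>0 z = \<beta> (2 \<alpha> - \<beta>)\<close>, which are the classes 1 and 2 according to whether
  \<open>\<beta> = 2 \<alpha>\<close>; for \<open>z = 0\<close> one gets \<open>\<beta> (\<beta> - \<alpha>) = 0\<close>, which are the classes 3 and 4
  (\<open>equations_imp_classes\<close>). The converse is a substitution.

  For \<open>\<alpha> \<noteq> 0\<close>, \<open>ad v\<^sub>1\<close> is diagonalizable with eigenvalues \<open>0\<close> and \<open>\<plusminus> \<alpha>\<close>, and the
  bracket of the other two eigenvectors is a multiple of \<open>\<beta> v\<^sub>1\<close>. So one obtains \<open>so(2,1)\<close> if
  \<open>\<beta> \<noteq> 0\<close> and \<open>e(1,1)\<close> if \<open>\<beta> = 0\<close>. For \<open>\<alpha> = 0\<close> the brackets do not span the Lie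
  algebra, unlike in \<open>so(2,1)\<close>.
\<close>

section \<open>Smooth maps\<close>

lemma Ck_on_cong:
  assumes "open S" "\<And>x. x \<in> S \<Longrightarrow> f x = h x"
  shows "Ck_on k S f \<longleftrightarrow> Ck_on k S h"
  using assms(2)
proof (induction k arbitrary: f h)
  case 0
  then show ?case using continuous_on_cong[of S S f h] by simp
next
  case (Suc k)
  have d: "(f has_derivative D) (at x) \<longleftrightarrow> (h has_derivative D) (at x)" if "x \<in> S" for x D
    using has_derivative_transform_within_open[OF _ \<open>open S\<close> that, where f = f and g = h]
      has_derivative_transform_within_open[OF _ \<open>open S\<close> that, where f = h and g = f] Suc.prems
    by auto
  then have "f differentiable (at x) \<longleftrightarrow> h differentiable (at x)" if "x \<in> S" for x
    using that by (simp add: differentiable_def)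
  moreover have "frechet_derivative f (at x) = frechet_derivative h (at x)" if "x \<in> S" for x
    using d[OF that] by (simp add: frechet_derivative_def)
  ultimately show ?case
    using Suc.IH[of "\<lambda>x. frechet_derivative f (at x) _" "\<lambda>x. frechet_derivative h (at x) _"] by simp
qed

lemma Ck_on_SucI:
  assumes "open S" "\<And>x. x \<in> S \<Longrightarrow> (f has_derivative f' x) (at x)"
    "\<And>w. Ck_on k S (\<lambda>x. f' x w)"
  shows "Ck_on (Suc k) S f"
proof -
  have "frechet_derivative f (at x) = f' x" if "x \<in> S" for x
    using frechet_derivative_at[OF assms(2)[OF that]] by simp
  then have "Ck_on k S (\<lambda>x. frechet_derivative f (at x) w)" for w
    using Ck_on_cong[OF assms(1), of "\<lambda>x. frechet_derivative f (at x) w" "\<lambda>x. f' x w"] assms(3) by simp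
  then show ?thesis using assms(2) by (auto simp: differentiable_def)
qed

lemma Ck_on_SucD:
  assumes "Ck_on (Suc k) S f" "x \<in> S"
  shows "(f has_derivative frechet_derivative f (at x)) (at x)"
  using assms by (simp add: frechet_derivative_works)

lemma Ck_on_Suc_imp: "Ck_on (Suc k) S f \<Longrightarrow> Ck_on k S f"
proof (induction k arbitrary: f)
  case 0
  then show ?case
    by (auto intro!: continuous_at_imp_continuous_on differentiable_imp_continuous_within)
qed auto

lemma Ck_on_const: "open S \<Longrightarrow> Ck_on k S (\<lambda>x. c)"
proof (induction k arbitrary: c)
  case (Suc k)
  then show ?case by (intro Ck_on_SucI[where f' = "\<lambda>_ _. 0"] has_derivative_const)
qed simp

lemma Ck_on_add:
  assumes "open S" "Ck_on k S f" "Ck_on k S h"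
  shows "Ck_on k S (\<lambda>x. f x + h x)"
  using assms(2,3)
proof (induction k arbitrary: f h)
  case (Suc k)
  show ?case
    by (rule Ck_on_SucI[OF \<open>open S\<close> has_derivative_add[OF Ck_on_SucD[OF Suc.prems(1)] Ck_on_SucD[OF Suc.prems(2)]]])
       (use Suc in auto)
qed (auto intro: continuous_intros)

lemma Ck_on_sum:
  assumes "open S" "\<And>i. i \<in> I \<Longrightarrow> Ck_on k S (f i)"
  shows "Ck_on k S (\<lambda>x. \<Sum>i\<in>I. f i x)"
  using assms(2)
  by (induction I rule: infinite_finite_induct) (auto simp: Ck_on_const Ck_on_add assms(1))

lemma (in bounded_bilinear) Ck_on:
  assumes "open S" "Ck_on k S f" "Ck_on k S h"
  shows "Ck_on k S (\<lambda>x. prod (f x) (h x))"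
  using assms(2,3)
proof (induction k arbitrary: f h)
  case 0
  then show ?case by (auto intro: continuous_on)
next
  case (Suc k)
  show ?case
  proof (rule Ck_on_SucI[OF \<open>open S\<close> FDERIV[OF Ck_on_SucD[OF Suc.prems(1)] Ck_on_SucD[OF Suc.prems(2)]]])
    show "Ck_on k S (\<lambda>x. prod (f x) (frechet_derivative h (at x) w) + prod (frechet_derivative f (at x) w) (h x))" for w
      using Suc.prems Ck_on_Suc_imp[OF Suc.prems(1)] Ck_on_Suc_imp[OF Suc.prems(2)]
      by (intro Ck_on_add[OF \<open>open S\<close>] Suc.IH) auto
  qed
qed

lemma Ck_on_inverse:
  fixes f :: "'a::real_normed_vector \<Rightarrow> real"
  assumes "open S" "\<And>x. x \<in> S \<Longrightarrow> f x \<noteq> 0" "Ck_on k S f"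
  shows "Ck_on k S (\<lambda>x. inverse (f x))"
  using assms(3)
proof (induction k)
  case 0
  then show ?case using assms(2) by (auto intro: continuous_on_inverse)
next
  case (Suc k)
  note mult = bounded_bilinear.Ck_on[OF bounded_bilinear_mult \<open>open S\<close>]
  have inv: "Ck_on k S (\<lambda>x. inverse (f x))"
    using Suc Ck_on_Suc_imp by blast
  show ?case
  proof (rule Ck_on_SucI[OF \<open>open S\<close> Deriv.has_derivative_inverse[OF assms(2) Ck_on_SucD[OF Suc.prems]]])
    fix w
    have "Ck_on k S (\<lambda>x. (-1) * (inverse (f x) * frechet_derivative f (at x) w * inverse (f x)))"
      using Suc.prems by (intro mult inv Ck_on_const \<open>open S\<close>) auto
    then show "Ck_on k S (\<lambda>x. - (inverse (f x) * frechet_derivative f (at x) w * inverse (f x)))"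
      by simp
  qed auto
qed

text \<open>A direction that varies smoothly is a smooth combination of fixed basis directions.\<close>

lemma Ck_on_directional:
  fixes f :: "'a::euclidean_space \<Rightarrow> 'b::real_normed_vector"
  assumes "open S" "Ck_on (Suc k) S f" "Ck_on k S \<xi>"
  shows "Ck_on k S (\<lambda>x. frechet_derivative f (at x) (\<xi> x))"
proof -
  have "frechet_derivative f (at x) (\<xi> x) = (\<Sum>b\<in>Basis. (\<xi> x \<bullet> b) *\<^sub>R frechet_derivative f (at x) b)"
    if "x \<in> S" for x
  proof -
    interpret linear "frechet_derivative f (at x)"
      using Ck_on_SucD[OF assms(2) that] by (rule has_derivative_linear)
    show ?thesis
      by (subst euclidean_representation[of "\<xi> x", symmetric]) (simp add: sum scale)
  qed
  moreover have "Ck_on k S (\<lambda>x. \<Sum>b\<in>Basis. (\<xi> x \<bullet> b) *\<^sub>R frechet_derivative f (at x) b)"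
  proof (intro Ck_on_sum bounded_bilinear.Ck_on[OF bounded_bilinear_scaleR] \<open>open S\<close>)
    show "Ck_on k S (\<lambda>x. \<xi> x \<bullet> b)" for b
      by (intro bounded_bilinear.Ck_on[OF bounded_bilinear_inner] assms Ck_on_const)
  qed (use assms(2) in simp)
  ultimately show ?thesis
    by (subst Ck_on_cong[OF assms(1), where h = "\<lambda>x. \<Sum>b\<in>Basis. (\<xi> x \<bullet> b) *\<^sub>R frechet_derivative f (at x) b"])
       simp_all
qed

lemma smooth_on_cong:
  "open S \<Longrightarrow> (\<And>x. x \<in> S \<Longrightarrow> f x = h x) \<Longrightarrow> smooth_on S f \<longleftrightarrow> smooth_on S h"
  using Ck_on_cong unfolding smooth_on_def by blast

lemma smooth_on_const: "open S \<Longrightarrow> smooth_on S (\<lambda>x. c)"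
  and smooth_on_add: "open S \<Longrightarrow> smooth_on S f \<Longrightarrow> smooth_on S h \<Longrightarrow> smooth_on S (\<lambda>x. f x + h x)"
  by (auto simp: smooth_on_def Ck_on_const Ck_on_add)

lemma (in bounded_bilinear) smooth_on:
  "open S \<Longrightarrow> smooth_on S f \<Longrightarrow> smooth_on S h \<Longrightarrow> smooth_on S (\<lambda>x. prod (f x) (h x))"
  by (simp add: smooth_on_def Ck_on)

lemma smooth_on_divide:
  fixes f h :: "'a::real_normed_vector \<Rightarrow> real"
  assumes "open S" "smooth_on S f" "smooth_on S h" "\<And>x. x \<in> S \<Longrightarrow> h x \<noteq> 0"
  shows "smooth_on S (\<lambda>x. f x / h x)"
proof -
  have "smooth_on S (\<lambda>x. inverse (h x))" using assms Ck_on_inverse unfolding smooth_on_def by blast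
  then show ?thesis
    unfolding divide_inverse by (rule bounded_bilinear.smooth_on[OF bounded_bilinear_mult assms(1,2)])
qed

lemma smooth_on_directional:
  fixes f :: "'a::euclidean_space \<Rightarrow> 'b::real_normed_vector"
  shows "open S \<Longrightarrow> smooth_on S f \<Longrightarrow> smooth_on S \<xi> \<Longrightarrow>
    smooth_on S (\<lambda>x. frechet_derivative f (at x) (\<xi> x))"
  unfolding smooth_on_def using Ck_on_directional by blast

lemma smooth_on_has_derivative:
  "smooth_on S f \<Longrightarrow> x \<in> S \<Longrightarrow> (f has_derivative frechet_derivative f (at x)) (at x)"
  unfolding smooth_on_def using Ck_on_SucD by blast

section \<open>Functions and vector fields\<close>

lemma fmul_apply [simp]: "fmul f T x p = f p * T x p"
  by (simp add: fmul_def)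

locale smooth_manifold =
  fixes G :: "('g::topological_space, 'e::euclidean_space) lie_struct"
  assumes atlas: "smooth_atlas (charts G)"
begin

lemma chart:
  assumes "(U, \<phi>) \<in> charts G"
  shows "open (\<phi> ` U)" "p \<in> U \<Longrightarrow> inv_into U \<phi> (\<phi> p) = p"
proof -
  obtain \<psi> where "open (\<phi> ` U)" "homeomorphism U (\<phi> ` U) \<phi> \<psi>"
    using atlas assms unfolding smooth_atlas_def by blast
  moreover have "inj_on \<phi> U" by (metis calculation(2) homeomorphism_def inj_on_def)
  ultimately show "open (\<phi> ` U)" "p \<in> U \<Longrightarrow> inv_into U \<phi> (\<phi> p) = p" by simp_all
qed

lemma chart_at: obtains U \<phi> where "(U, \<phi>) \<in> charts G" "p \<in> U"
proof -
  have "p \<in> (\<Union>c\<in>charts G. fst c)" using atlas by (simp add: smooth_atlas_def case_prod_beta)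
  then obtain c where "c \<in> charts G" "p \<in> fst c" by (rule UN_E)
  then show ?thesis by (cases c) (auto intro: that)
qed

lemma C_inf_iff:
  "f \<in> C_inf G \<longleftrightarrow> (\<forall>U \<phi>. (U, \<phi>) \<in> charts G \<longrightarrow> smooth_on (\<phi> ` U) (f \<circ> inv_into U \<phi>))"
  by (auto simp: C_inf_def)

lemma C_inf_smooth: "f \<in> C_inf G \<Longrightarrow> (U, \<phi>) \<in> charts G \<Longrightarrow> smooth_on (\<phi> ` U) (f \<circ> inv_into U \<phi>)"
  by (simp add: C_inf_iff)

lemma C_infI:
  "(\<And>U \<phi>. (U, \<phi>) \<in> charts G \<Longrightarrow> smooth_on (\<phi> ` U) (f \<circ> inv_into U \<phi>)) \<Longrightarrow> f \<in> C_inf G"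
  by (simp add: C_inf_iff)

lemma C_inf_const [simp]: "(\<lambda>_. c) \<in> C_inf G"
  by (rule C_infI) (simp add: comp_def smooth_on_const chart)

lemma C_inf_add [simp]: "f \<in> C_inf G \<Longrightarrow> h \<in> C_inf G \<Longrightarrow> f + h \<in> C_inf G"
  using smooth_on_add[OF _ C_inf_smooth C_inf_smooth, of _ _ f h]
  by (intro C_infI) (simp add: comp_def chart)

lemma C_inf_mult [simp]: "f \<in> C_inf G \<Longrightarrow> h \<in> C_inf G \<Longrightarrow> f * h \<in> C_inf G"
  using bounded_bilinear.smooth_on[OF bounded_bilinear_mult _ C_inf_smooth C_inf_smooth, of _ _ f h]
  by (intro C_infI) (simp add: comp_def chart)

lemma C_inf_0 [simp]: "0 \<in> C_inf G"
  and C_inf_1 [simp]: "1 \<in> C_inf G"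
  unfolding zero_fun_def one_fun_def by simp_all

lemma C_inf_uminus [simp]: "f \<in> C_inf G \<Longrightarrow> - f \<in> C_inf G"
  using C_inf_mult[of "\<lambda>_. -1" f] by (simp add: times_fun_def fun_Compl_def)

lemma C_inf_diff [simp]: "f \<in> C_inf G \<Longrightarrow> h \<in> C_inf G \<Longrightarrow> f - h \<in> C_inf G"
  using C_inf_add[of f "- h"] by simp

lemma C_inf_sum: "(\<And>i. i \<in> I \<Longrightarrow> f i \<in> C_inf G) \<Longrightarrow> sum f I \<in> C_inf G"
  by (induction I rule: infinite_finite_induct) auto

abbreviation chart_deriv :: "'g set \<Rightarrow> ('g \<Rightarrow> 'e) \<Rightarrow> ('g \<Rightarrow> real) \<Rightarrow> 'g \<Rightarrow> 'e \<Rightarrow> real" where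
  "chart_deriv U \<phi> f p \<equiv> frechet_derivative (f \<circ> inv_into U \<phi>) (at (\<phi> p))"

lemma vfields_iff:
  "X \<in> vfields G \<longleftrightarrow> (\<forall>f. f \<notin> C_inf G \<longrightarrow> X f = 0) \<and>
     (\<forall>U \<phi>. (U, \<phi>) \<in> charts G \<longrightarrow> (\<exists>\<xi>. smooth_on (\<phi> ` U) \<xi> \<and>
        (\<forall>f\<in>C_inf G. \<forall>p\<in>U. X f p =
           chart_deriv U \<phi> f p (\<xi> (\<phi> p)))))"
  by (auto simp: vfields_def)

lemma vfields_chart:
  assumes "X \<in> vfields G" "(U, \<phi>) \<in> charts G"
  shows "\<exists>\<xi>. smooth_on (\<phi> ` U) \<xi> \<and>
      (\<forall>f\<in>C_inf G. \<forall>p\<in>U. X f p =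
         chart_deriv U \<phi> f p (\<xi> (\<phi> p)))"
  using assms by (simp add: vfields_iff)

lemma vfields_not_smooth: "X \<in> vfields G \<Longrightarrow> f \<notin> C_inf G \<Longrightarrow> X f = 0"
  by (simp add: vfields_iff)

lemma vfields_eqI:
  assumes "X \<in> vfields G" "Y \<in> vfields G" "\<And>f p. f \<in> C_inf G \<Longrightarrow> X f p = Y f p"
  shows "X = Y"
  by (intro ext) (metis assms vfields_not_smooth)

lemma vfields_C_inf [simp]:
  assumes "X \<in> vfields G" shows "X f \<in> C_inf G"
proof (cases "f \<in> C_inf G")
  case True
  show ?thesis
  proof (rule C_infI)
    fix U \<phi> assume c: "(U, \<phi>) \<in> charts G"
    obtain \<xi> where \<xi>: "smooth_on (\<phi> ` U) \<xi>"
      "\<forall>f\<in>C_inf G. \<forall>p\<in>U. 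
        X f p = chart_deriv U \<phi> f p (\<xi> (\<phi> p))"
      using vfields_chart[OF assms c] by blast
    have "smooth_on (\<phi> ` U) (\<lambda>x. frechet_derivative (f \<circ> inv_into U \<phi>) (at x) (\<xi> x))"
      by (intro smooth_on_directional chart[OF c] C_inf_smooth[OF True c] \<xi>)
    then show "smooth_on (\<phi> ` U) (X f \<circ> inv_into U \<phi>)"
      by (rule smooth_on_cong[THEN iffD1, rotated 2])
         (use chart[OF c] True \<xi>(2) in auto)
  qed
qed (simp add: vfields_not_smooth[OF assms])

lemma vfields_derivation:
  assumes X: "X \<in> vfields G" and f: "f \<in> C_inf G" "h \<in> C_inf G"
  shows "X (f + h) = X f + X h" "X (f * h) = X f * h + f * X h"
proof -
  have "X (f + h) p = X f p + X h p \<and> X (f * h) p = X f p * h p + f p * X h p" for p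
  proof -
    obtain U \<phi> where c: "(U, \<phi>) \<in> charts G" "p \<in> U" by (rule chart_at[of p])
    obtain \<xi> where "smooth_on (\<phi> ` U) \<xi>" and \<xi>: "\<forall>f\<in>C_inf G. \<forall>p\<in>U. 
        X f p = chart_deriv U \<phi> f p (\<xi> (\<phi> p))"
      using vfields_chart[OF X c(1)] by blast
    note d = smooth_on_has_derivative[OF C_inf_smooth[OF f(1) c(1)] imageI[OF c(2)]]
      smooth_on_has_derivative[OF C_inf_smooth[OF f(2) c(1)] imageI[OF c(2)]]
    have "chart_deriv U \<phi> (f + h) p (\<xi> (\<phi> p))
       = chart_deriv U \<phi> f p (\<xi> (\<phi> p))
       + frechet_derivative (h \<circ> inv_into U \<phi>) (at (\<phi> p)) (\<xi> (\<phi> p))"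
      using frechet_derivative_at[OF has_derivative_add[OF d], symmetric]
      by (simp add: comp_def plus_fun_def)
    moreover have "chart_deriv U \<phi> (f * h) p (\<xi> (\<phi> p))
       = chart_deriv U \<phi> f p (\<xi> (\<phi> p)) * h p
       + f p * frechet_derivative (h \<circ> inv_into U \<phi>) (at (\<phi> p)) (\<xi> (\<phi> p))"
      using frechet_derivative_at[OF has_derivative_mult[OF d], symmetric] chart(2)[OF c]
      by (simp add: comp_def times_fun_def)
    ultimately show ?thesis using f c by (simp add: \<xi>)
  qed
  then show "X (f + h) = X f + X h" "X (f * h) = X f * h + f * X h"
    by (simp_all add: fun_eq_iff)
qed

lemma vfields_const: assumes "X \<in> vfields G" shows "X (\<lambda>_. c) = 0"
proof -
  have "X (\<lambda>_. c) p = 0" for p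
  proof -
    obtain U \<phi> where c: "(U, \<phi>) \<in> charts G" "p \<in> U" by (rule chart_at[of p])
    obtain \<xi> where "smooth_on (\<phi> ` U) \<xi>" "\<forall>f\<in>C_inf G. \<forall>p\<in>U. 
        X f p = chart_deriv U \<phi> f p (\<xi> (\<phi> p))"
      using vfields_chart[OF assms c(1)] by blast
    then show ?thesis using c(2) by (simp add: comp_def)
  qed
  then show ?thesis by (simp add: fun_eq_iff)
qed

lemma vfields_linear:
  assumes X: "X \<in> vfields G" and f: "f \<in> C_inf G" "h \<in> C_inf G"
  shows "X 0 = 0" "X (- f) = - X f" "X (f - h) = X f - X h" "X ((\<lambda>_. c) * f) = (\<lambda>_. c) * X f"
proof -
  show 0: "X 0 = 0" using vfields_const[OF X] by (simp add: zero_fun_def)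
  have n: "X (- f) = - X f" if "f \<in> C_inf G" for f
    using vfields_derivation(1)[OF X that C_inf_uminus[OF that]] 0 by (simp add: eq_neg_iff_add_eq_0 add.commute)
  show "X (- f) = - X f" using n f by simp
  show "X (f - h) = X f - X h"
    using vfields_derivation(1)[OF X f(1) C_inf_uminus[OF f(2)]] n[OF f(2)] by simp
  show "X ((\<lambda>_. c) * f) = (\<lambda>_. c) * X f"
    using vfields_derivation(2)[OF X C_inf_const f(1), of c] vfields_const[OF X] by simp
qed

lemma vfieldsI:
  assumes "\<And>f. f \<notin> C_inf G \<Longrightarrow> X f = 0"
    "\<And>U \<phi>. (U, \<phi>) \<in> charts G \<Longrightarrow> \<exists>\<xi>. smooth_on (\<phi> ` U) \<xi> \<and>
        (\<forall>f\<in>C_inf G. \<forall>p\<in>U. X f p =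
           chart_deriv U \<phi> f p (\<xi> (\<phi> p)))"
  shows "X \<in> vfields G"
  using assms by (simp add: vfields_iff)

lemma linear_chart_derivative:
  assumes "f \<in> C_inf G" "(U, \<phi>) \<in> charts G" "p \<in> U"
  shows "linear (chart_deriv U \<phi> f p)"
  using smooth_on_has_derivative[OF C_inf_smooth[OF assms(1,2)]] assms(3)
  by (blast intro: has_derivative_linear)

lemma vfields_add [simp]:
  assumes "X \<in> vfields G" "Y \<in> vfields G" shows "X + Y \<in> vfields G"
proof (rule vfieldsI)
  fix U \<phi> assume c: "(U, \<phi>) \<in> charts G"
  obtain \<xi> where "smooth_on (\<phi> ` U) \<xi>" "\<forall>f\<in>C_inf G. \<forall>p\<in>U. 
      X f p = chart_deriv U \<phi> f p (\<xi> (\<phi> p))"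
    using vfields_chart[OF assms(1) c] by blast
  moreover obtain \<zeta> where "smooth_on (\<phi> ` U) \<zeta>" "\<forall>f\<in>C_inf G. \<forall>p\<in>U. 
      Y f p = chart_deriv U \<phi> f p (\<zeta> (\<phi> p))"
    using vfields_chart[OF assms(2) c] by blast
  ultimately show "\<exists>\<xi>. smooth_on (\<phi> ` U) \<xi> \<and> (\<forall>f\<in>C_inf G. \<forall>p\<in>U. (X + Y) f p =
      chart_deriv U \<phi> f p (\<xi> (\<phi> p)))"
    by (intro exI[of _ "\<lambda>x. \<xi> x + \<zeta> x"])
       (simp add: smooth_on_add chart[OF c] linear_add[OF linear_chart_derivative[OF _ c]])
qed (simp add: vfields_not_smooth[OF assms(1)] vfields_not_smooth[OF assms(2)])

lemma vfields_fmul [simp]: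
  assumes "k \<in> C_inf G" "X \<in> vfields G" shows "fmul k X \<in> vfields G"
proof (rule vfieldsI)
  fix U \<phi> assume c: "(U, \<phi>) \<in> charts G"
  obtain \<xi> where "smooth_on (\<phi> ` U) \<xi>" "\<forall>f\<in>C_inf G. \<forall>p\<in>U. 
      X f p = chart_deriv U \<phi> f p (\<xi> (\<phi> p))"
    using vfields_chart[OF assms(2) c] by blast
  then show "\<exists>\<xi>. smooth_on (\<phi> ` U) \<xi> \<and> (\<forall>f\<in>C_inf G. \<forall>p\<in>U. fmul k X f p =
      chart_deriv U \<phi> f p (\<xi> (\<phi> p)))"
    using C_inf_smooth[OF assms(1) c]
    by (intro exI[of _ "\<lambda>x. (k \<circ> inv_into U \<phi>) x *\<^sub>R \<xi> x"] conjI
        bounded_bilinear.smooth_on[OF bounded_bilinear_scaleR] chart(1)[OF c])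
       (simp_all add: chart[OF c] linear_scale[OF linear_chart_derivative[OF _ c]], simp_all add: comp_def)
qed (simp add: vfields_not_smooth[OF assms(2)] fun_eq_iff)

lemma vfields_cscale [simp]: "X \<in> vfields G \<Longrightarrow> cscale k X \<in> vfields G"
  by (simp add: cscale_def)

lemma vfields_uminus [simp]: "X \<in> vfields G \<Longrightarrow> - X \<in> vfields G"
  using vfields_cscale[of X "-1"] by (simp add: cscale_def fmul_def fun_eq_iff fun_Compl_def times_fun_def)

lemma vfields_diff [simp]: "X \<in> vfields G \<Longrightarrow> Y \<in> vfields G \<Longrightarrow> X - Y \<in> vfields G"
  using vfields_add[of X "- Y"] by simp

lemma vfields_0 [simp]: "0 \<in> vfields G"
proof (rule vfieldsI)
  fix U \<phi> assume c: "(U, \<phi>) \<in> charts G"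
  then show "\<exists>\<xi>. smooth_on (\<phi> ` U) \<xi> \<and> (\<forall>f\<in>C_inf G. \<forall>p\<in>U. 0 f p =
      chart_deriv U \<phi> f p (\<xi> (\<phi> p)))"
    by (intro exI[of _ "\<lambda>_. 0"]) (simp add: smooth_on_const chart linear_0[OF linear_chart_derivative])
qed simp

lemma vfields_sum: "(\<And>i. i \<in> I \<Longrightarrow> X i \<in> vfields G) \<Longrightarrow> sum X I \<in> vfields G"
  by (induction I rule: infinite_finite_induct) auto

end

section \<open>Left-invariant frames\<close>

lemma sum_fun_apply2: "(\<Sum>i\<in>I. X i) f p = (\<Sum>i\<in>I. X i f p)"
  by (induction I rule: infinite_finite_induct) auto

lemma sum_1_3: "(\<Sum>i\<in>{1..3::nat}. x i) = x 1 + x 2 + x 3"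
  by (simp add: eval_nat_numeral)

text \<open>Cramer's rule for a linear system with the columns \<open>a\<close>, \<open>b\<close>, \<open>c\<close>.\<close>

lemma cross3_triple_expansion:
  fixes a b c y :: "real^3"
  shows "(a \<bullet> (cross3 b c)) *\<^sub>R y = (y \<bullet> (cross3 b c)) *\<^sub>R a + (y \<bullet> (cross3 c a)) *\<^sub>R b + (y \<bullet> (cross3 a b)) *\<^sub>R c"
  by (simp add: cross3_simps forall_3)

lemma triple_product_nonzero:
  fixes a b c :: "real^3"
  assumes indep: "\<And>r s t. r *\<^sub>R a + s *\<^sub>R b + t *\<^sub>R c = 0 \<Longrightarrow> r = 0 \<and> s = 0 \<and> t = 0"
  shows "a \<bullet> (cross3 b c) \<noteq> 0"
proof
  assume "a \<bullet> (cross3 b c) = 0"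
  then have "y \<bullet> (cross3 b c) = 0" for y
    using indep[of "y \<bullet> (cross3 b c)" "y \<bullet> (cross3 c a)" "y \<bullet> (cross3 a b)"] cross3_triple_expansion[of a b c y]
    by simp
  then have "cross3 b c = 0" using inner_eq_zero_iff by blast
  then have "collinear {0, b, c}" by (simp add: cross_eq_0)
  then show False
    unfolding collinear_lemma using indep[of 0 1 0] indep[of 0 0 1] indep[of 0 _ "-1"] by auto
qed

lemma smooth_on_triple_product:
  fixes a b c :: "'a::real_normed_vector \<Rightarrow> real^3"
  assumes "open S" "smooth_on S a" "smooth_on S b" "smooth_on S c"
  shows "smooth_on S (\<lambda>x. a x \<bullet> (cross3 (b x) (c x)))"
  using bilinear_cross
  by (intro bounded_bilinear.smooth_on[OF bounded_bilinear_inner] assms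
      bounded_bilinear.smooth_on[where prod = cross3]) (simp add: bilinear_conv_bounded_bilinear)

lemma lie_alg_vfields: "X \<in> lie_alg G \<Longrightarrow> X \<in> vfields G"
  by (simp add: lie_alg_def)

text \<open>A left-invariant field is determined by its value at one point: the translate of a test
  function carries the value at \<open>p\<close> to any other point.\<close>

lemma left_invariant_vanishing:
  fixes G :: "('g::{t2_space, second_countable_topology}, 'e::euclidean_space) lie_struct"
    and v :: "'i \<Rightarrow> 'g vf"
  assumes G: "lie_group G" and v: "\<And>i. i \<in> I \<Longrightarrow> v i \<in> lie_alg G"
    and 0: "\<And>f. f \<in> C_inf G \<Longrightarrow> (\<Sum>i\<in>I. k i * v i f p) = 0"
  shows "(\<Sum>i\<in>I. cscale (k i) (v i)) = 0"
proof (intro ext)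
  fix f :: "'g \<Rightarrow> real" and q
  interpret group "gmult G" "gone G" "ginv G" using G by (simp add: lie_group_def)
  define a where "a = gmult G q (ginv G p)"
  let ?f = "\<lambda>x. f (gmult G a x)"
  have aq: "gmult G (ginv G a) q = p"
    unfolding a_def by (simp add: inverse_distrib_swap assoc)
  have "v i f q = v i ?f p" if "i \<in> I" for i
  proof -
    have "push G a (v i) f q = v i f q" using v[OF that] by (simp add: lie_alg_def)
    then show ?thesis by (simp add: push_def aq)
  qed
  then have "(\<Sum>i\<in>I. cscale (k i) (v i)) f q = (\<Sum>i\<in>I. k i * v i ?f p)"
    by (simp add: sum_fun_apply2 cscale_def)
  also have "\<dots> = 0"
  proof (cases "?f \<in> C_inf G")
    case False
    \<comment> \<open>The operators representing vector fields are 0 on functions that are not smooth.\<close>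
    then have "v i ?f = 0" if "i \<in> I" for i
      using lie_alg_vfields[OF v[OF that]] by (simp add: vfields_def)
    then show ?thesis by simp
  qed (rule 0)
  finally show "(\<Sum>i\<in>I. cscale (k i) (v i)) f q = 0 f q" by simp
qed

lemma lie_alg_closed:
  assumes "smooth_manifold G"
  shows "0 \<in> lie_alg G" "X \<in> lie_alg G \<Longrightarrow> Y \<in> lie_alg G \<Longrightarrow> X + Y \<in> lie_alg G"
    "X \<in> lie_alg G \<Longrightarrow> cscale k X \<in> lie_alg G"
proof -
  interpret smooth_manifold G by fact
  show "0 \<in> lie_alg G" "X \<in> lie_alg G \<Longrightarrow> Y \<in> lie_alg G \<Longrightarrow> X + Y \<in> lie_alg G"
    "X \<in> lie_alg G \<Longrightarrow> cscale k X \<in> lie_alg G"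
    by (auto simp: lie_alg_def push_def fun_eq_iff cscale_def)
qed

lemma free_basis_indep:
  assumes "smooth_manifold G" "free_basis UNIV cscale (lie_alg G) I v"
    and 0: "(\<Sum>i\<in>I. cscale (k i) (v i)) = 0" and i: "i \<in> I"
  shows "k i = 0"
proof -
  have "\<exists>!c. c \<in> I \<rightarrow>\<^sub>E UNIV \<and> 0 = (\<Sum>i\<in>I. cscale (c i) (v i))"
    using assms(2) lie_alg_closed(1)[OF assms(1)] unfolding free_basis_def by blast
  moreover have "restrict k I \<in> I \<rightarrow>\<^sub>E UNIV" "0 = (\<Sum>i\<in>I. cscale (restrict k I i) (v i))"
    using 0 by simp_all
  moreover have "restrict (\<lambda>_. 0) I \<in> I \<rightarrow>\<^sub>E UNIV" "0 = (\<Sum>i\<in>I. cscale (restrict (\<lambda>_. 0) I i) (v i))"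
    by (simp_all add: cscale_def fmul_def fun_eq_iff sum_fun_apply2)
  ultimately have "restrict k I = restrict (\<lambda>_. 0) I" by blast
  then show ?thesis using i by (metis restrict_apply')
qed

text \<open>The \<open>v i\<close> are linearly independent at every point, since a combination that is 0 at one point is
  0 everywhere by left-invariance. So in each chart the coefficients are given by Cramer's rule with a
  nonvanishing determinant and are smooth; as they are unique at each point, those of different charts fit
  together.\<close>

lemma left_invariant_frame_spans:
  fixes G :: "('g::{t2_space, second_countable_topology}, real^3) lie_struct"
  assumes G: "lie_group G" and basis: "free_basis UNIV cscale (lie_alg G) {1..3::nat} v"
    and X: "X \<in> vfields G"
  shows "\<exists>c. (\<forall>i\<in>{1..3}. c i \<in> C_inf G) \<and> X = (\<Sum>i\<in>{1..3}. fmul (c i) (v i))"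
proof -
  interpret smooth_manifold G using G by unfold_locales (simp add: lie_group_def)
  have I: "{1..3::nat} = {1, 2, 3}" by auto
  have lie: "v i \<in> lie_alg G" if "i \<in> {1..3}" for i
    using basis that unfolding free_basis_def by blast
  then have vf: "v i \<in> vfields G" if "i \<in> {1..3}" for i
    using that lie_alg_vfields by blast
  have indep: "r = 0 \<and> s = 0 \<and> t = 0"
    if "\<And>f. f \<in> C_inf G \<Longrightarrow> r * v 1 f p + s * v 2 f p + t * v 3 f p = 0" for p r s t
  proof -
    define k where "k i = (if i = 1 then r else if i = 2 then s else t)" for i :: nat
    have "(\<Sum>i\<in>{1..3}. cscale (k i) (v i)) = 0"
      by (rule left_invariant_vanishing[OF G lie, where p = p]) (use that in \<open>auto simp: sum_1_3 k_def simp del: One_nat_def\<close>)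
    then have "k 1 = 0" "k 2 = 0" "k 3 = 0"
      using free_basis_indep[OF smooth_manifold_axioms basis, of k] by auto
    then show ?thesis by (simp add: k_def)
  qed
  have local: "\<exists>c1 c2 c3. smooth_on (\<phi> ` U) c1 \<and> smooth_on (\<phi> ` U) c2 \<and> smooth_on (\<phi> ` U) c3 \<and>
      (\<forall>p\<in>U. \<forall>f\<in>C_inf G. X f p = c1 (\<phi> p) * v 1 f p + c2 (\<phi> p) * v 2 f p + c3 (\<phi> p) * v 3 f p)"
    if c: "(U, \<phi>) \<in> charts G" for U \<phi>
  proof -
    let ?D = "\<lambda>f p. frechet_derivative (f \<circ> inv_into U \<phi>) (at (\<phi> p))"
    obtain y where y: "smooth_on (\<phi> ` U) y" "\<forall>f\<in>C_inf G. \<forall>p\<in>U. X f p = ?D f p (y (\<phi> p))"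
      using vfields_chart[OF X c] by blast
    have "\<exists>x. smooth_on (\<phi> ` U) x \<and> (\<forall>f\<in>C_inf G. \<forall>p\<in>U. v i f p = ?D f p (x (\<phi> p)))"
      if "i \<in> {1..3}" for i
      using vfields_chart[OF vf[OF that] c] .
    then obtain x where x: "smooth_on (\<phi> ` U) (x i)" "\<forall>f\<in>C_inf G. \<forall>p\<in>U. v i f p = ?D f p (x i (\<phi> p))"
      if "i \<in> {1..3}" for i
      by metis
    define T where "T q = x 1 q \<bullet> (cross3 (x 2 q) (x 3 q))" for q
    have T: "T q \<noteq> 0" if q: "q \<in> \<phi> ` U" for q
      unfolding T_def
    proof (rule triple_product_nonzero)
      fix r s t assume 0: "r *\<^sub>R x 1 q + s *\<^sub>R x 2 q + t *\<^sub>R x 3 q = 0"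
      obtain p where p: "p \<in> U" "q = \<phi> p" using q by blast
      show "r = 0 \<and> s = 0 \<and> t = 0"
      proof (rule indep)
        fix f assume f: "f \<in> C_inf G"
        interpret linear "?D f p" by (rule linear_chart_derivative[OF f c p(1)])
        have "r * v 1 f p + s * v 2 f p + t * v 3 f p = ?D f p (r *\<^sub>R x 1 q + s *\<^sub>R x 2 q + t *\<^sub>R x 3 q)"
          using x(2) f p by (simp add: add scale)
        then show "r * v 1 f p + s * v 2 f p + t * v 3 f p = 0" by (simp only: 0 zero)
      qed
    qed
    note smooth = smooth_on_triple_product[OF chart(1)[OF c]]
    have "smooth_on (\<phi> ` U) (\<lambda>q. (y q \<bullet> (cross3 (x 2 q) (x 3 q))) / T q)"
      "smooth_on (\<phi> ` U) (\<lambda>q. (y q \<bullet> (cross3 (x 3 q) (x 1 q))) / T q)"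
      "smooth_on (\<phi> ` U) (\<lambda>q. (y q \<bullet> (cross3 (x 1 q) (x 2 q))) / T q)"
      using T unfolding T_def by (intro smooth_on_divide smooth chart(1)[OF c] y x; simp)+
    moreover have "X f p = (y (\<phi> p) \<bullet> (cross3 (x 2 (\<phi> p)) (x 3 (\<phi> p)))) / T (\<phi> p) * v 1 f p
        + (y (\<phi> p) \<bullet> (cross3 (x 3 (\<phi> p)) (x 1 (\<phi> p)))) / T (\<phi> p) * v 2 f p
        + (y (\<phi> p) \<bullet> (cross3 (x 1 (\<phi> p)) (x 2 (\<phi> p)))) / T (\<phi> p) * v 3 f p"
      if p: "p \<in> U" and f: "f \<in> C_inf G" for p f
    proof -
      interpret linear "?D f p" by (rule linear_chart_derivative[OF f c p])
      have "T (\<phi> p) * X f p = ?D f p (T (\<phi> p) *\<^sub>R y (\<phi> p))"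
        using y(2) p f by (simp add: scale)
      also have "\<dots> = (y (\<phi> p) \<bullet> (cross3 (x 2 (\<phi> p)) (x 3 (\<phi> p)))) * v 1 f p
        + (y (\<phi> p) \<bullet> (cross3 (x 3 (\<phi> p)) (x 1 (\<phi> p)))) * v 2 f p
        + (y (\<phi> p) \<bullet> (cross3 (x 1 (\<phi> p)) (x 2 (\<phi> p)))) * v 3 f p"
        unfolding T_def by (subst cross3_triple_expansion) (use x(2) p f in \<open>simp add: add scale\<close>)
      finally show ?thesis using T[OF imageI[OF p]] by (simp add: field_simps)
    qed
    ultimately show ?thesis by blast
  qed
  have "\<exists>k. \<forall>f\<in>C_inf G. X f p = k 1 * v 1 f p + k 2 * v 2 f p + k (3::nat) * v 3 f p" for p
  proof -
    obtain U \<phi> where c: "(U, \<phi>) \<in> charts G" "p \<in> U" by (rule chart_at[of p])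
    from local[OF c(1)] c(2) obtain c1 c2 c3 where
      "\<forall>f\<in>C_inf G. X f p = c1 (\<phi> p) * v 1 f p + c2 (\<phi> p) * v 2 f p + c3 (\<phi> p) * v 3 f p"
      by blast
    then show ?thesis
      by (intro exI[of _ "\<lambda>i. if i = 1 then c1 (\<phi> p) else if i = 2 then c2 (\<phi> p) else c3 (\<phi> p)"]) simp
  qed
  then obtain k where k:
    "\<forall>f\<in>C_inf G. X f p = k p 1 * v 1 f p + k p 2 * v 2 f p + k p (3::nat) * v 3 f p" for p
    by metis
  have unique: "k p 1 = r \<and> k p 2 = s \<and> k p 3 = t"
    if "\<forall>f\<in>C_inf G. X f p = r * v 1 f p + s * v 2 f p + t * v 3 f p" for p r s t
    using indep[of "k p 1 - r" p "k p 2 - s" "k p 3 - t"] k[of p] that by (auto simp: algebra_simps)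
  have smooth: "(\<lambda>p. k p i) \<in> C_inf G" if i: "i \<in> {1, 2, 3}" for i
  proof (rule C_infI)
    fix U \<phi> assume c: "(U, \<phi>) \<in> charts G"
    obtain c1 c2 c3 where cs: "smooth_on (\<phi> ` U) c1" "smooth_on (\<phi> ` U) c2" "smooth_on (\<phi> ` U) c3"
      "\<forall>p\<in>U. \<forall>f\<in>C_inf G. X f p = c1 (\<phi> p) * v 1 f p + c2 (\<phi> p) * v 2 f p + c3 (\<phi> p) * v 3 f p"
      using local[OF c] by blast
    then have "k p 1 = c1 (\<phi> p) \<and> k p 2 = c2 (\<phi> p) \<and> k p 3 = c3 (\<phi> p)" if "p \<in> U" for p
      using unique[of p "c1 (\<phi> p)" "c2 (\<phi> p)" "c3 (\<phi> p)"] that by blast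
    then have "((\<lambda>p. k p i) \<circ> inv_into U \<phi>) q = (if i = 1 then c1 q else if i = 2 then c2 q else c3 q)"
      if "q \<in> \<phi> ` U" for q
      using i that chart(2)[OF c] by auto
    then show "smooth_on (\<phi> ` U) ((\<lambda>p. k p i) \<circ> inv_into U \<phi>)"
      using i cs
      by (subst smooth_on_cong[OF chart(1)[OF c], where h = "if i = 1 then c1 else if i = 2 then c2 else c3"]) auto
  qed
  have "X = (\<Sum>i\<in>{1..3}. fmul (\<lambda>p. k p i) (v i))"
  proof (rule vfields_eqI[OF X vfields_sum])
    show "X f p = (\<Sum>i\<in>{1..3}. fmul (\<lambda>p. k p i) (v i)) f p" if "f \<in> C_inf G" for f p
      using k[of p] that by (simp add: sum_fun_apply2 sum_1_3 del: One_nat_def)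
  qed (metis I smooth vf vfields_fmul)
  then show ?thesis unfolding I using smooth by (intro exI[of _ "\<lambda>i p. k p i"]) blast
qed

section \<open>Traces in free modules\<close>

locale scalar_action =
  fixes K :: "'k::comm_ring_1 set" and sc :: "'k \<Rightarrow> 'm \<Rightarrow> 'm::ab_group_add"
  assumes K: "0 \<in> K" "1 \<in> K" "a \<in> K \<Longrightarrow> b \<in> K \<Longrightarrow> a + b \<in> K"
      "a \<in> K \<Longrightarrow> b \<in> K \<Longrightarrow> a - b \<in> K" "a \<in> K \<Longrightarrow> b \<in> K \<Longrightarrow> a * b \<in> K"
    and sc: "sc (a + b) x = sc a x + sc b x" "sc a (x + y) = sc a x + sc a y"
      "sc (a * b) x = sc a (sc b x)" "sc 1 x = x"
begin

lemma sc_0 [simp]: "sc 0 x = 0" "sc a 0 = 0"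
  using sc(1)[of 0 0 x] sc(2)[of a 0 0] by simp_all

lemma sc_sum_left: "sc (\<Sum>i\<in>I. a i) x = (\<Sum>i\<in>I. sc (a i) x)"
  by (induction I rule: infinite_finite_induct) (auto simp: sc)

lemma sc_sum_right: "sc a (\<Sum>i\<in>I. x i) = (\<Sum>i\<in>I. sc a (x i))"
  by (induction I rule: infinite_finite_induct) (auto simp: sc)

lemma K_sum: "(\<And>i. i \<in> I \<Longrightarrow> a i \<in> K) \<Longrightarrow> sum a I \<in> K"
  by (induction I rule: infinite_finite_induct) (auto simp: K)

lemma free_basisI:
  assumes "finite I" "e ` I \<subseteq> S"
    and span: "\<And>s. s \<in> S \<Longrightarrow> \<exists>c. (\<forall>i\<in>I. c i \<in> K) \<and> s = (\<Sum>i\<in>I. sc (c i) (e i))"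
    and unique: "\<And>c c' i. (\<Sum>i\<in>I. sc (c i) (e i)) \<in> S \<Longrightarrow> \<forall>i\<in>I. c i \<in> K \<Longrightarrow> \<forall>i\<in>I. c' i \<in> K \<Longrightarrow>
      (\<Sum>i\<in>I. sc (c i) (e i)) = (\<Sum>i\<in>I. sc (c' i) (e i)) \<Longrightarrow> i \<in> I \<Longrightarrow> c i = c' i"
  shows "free_basis K sc S I e"
  unfolding free_basis_def
proof (intro conjI ballI assms(1,2))
  fix s assume s: "s \<in> S"
  then obtain c where c: "\<forall>i\<in>I. c i \<in> K" "s = (\<Sum>i\<in>I. sc (c i) (e i))"
    using span by blast
  show "\<exists>!c. c \<in> I \<rightarrow>\<^sub>E K \<and> s = (\<Sum>i\<in>I. sc (c i) (e i))"
  proof (rule ex1I[of _ "restrict c I"])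
    show "restrict c I \<in> I \<rightarrow>\<^sub>E K \<and> s = (\<Sum>i\<in>I. sc (restrict c I i) (e i))"
      using c by simp
  next
    fix c' assume c': "c' \<in> I \<rightarrow>\<^sub>E K \<and> s = (\<Sum>i\<in>I. sc (c' i) (e i))"
    then have "c i = c' i" if "i \<in> I" for i
      using unique[of c c' i] c s that by (auto simp: PiE_def)
    then show "c' = restrict c I"
      using c' by (intro extensionalityI[of _ I]) (auto simp: PiE_def)
  qed
qed

lemma free_basis_coeffs_unique:
  assumes "free_basis K sc S I e" "s \<in> S" "\<forall>i\<in>I. c i \<in> K" "\<forall>i\<in>I. c' i \<in> K"
    "s = (\<Sum>i\<in>I. sc (c i) (e i))" "s = (\<Sum>i\<in>I. sc (c' i) (e i))" "i \<in> I"
  shows "c i = c' i"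
proof -
  have "\<exists>!c. c \<in> I \<rightarrow>\<^sub>E K \<and> s = (\<Sum>i\<in>I. sc (c i) (e i))"
    using assms(1,2) unfolding free_basis_def by blast
  moreover have "restrict c I \<in> I \<rightarrow>\<^sub>E K \<and> s = (\<Sum>i\<in>I. sc (restrict c I i) (e i))"
    using assms(3,5) by simp
  moreover have "restrict c' I \<in> I \<rightarrow>\<^sub>E K \<and> s = (\<Sum>i\<in>I. sc (restrict c' I i) (e i))"
    using assms(4,6) by simp
  ultimately have "restrict c I = restrict c' I" by blast
  then show ?thesis using assms(7) by (metis restrict_apply')
qed

lemma free_basis_span:
  assumes "free_basis K sc S I e" "s \<in> S"
  shows "\<exists>c. (\<forall>i\<in>I. c i \<in> K) \<and> s = (\<Sum>i\<in>I. sc (c i) (e i))"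
proof -
  have "\<exists>!c. c \<in> I \<rightarrow>\<^sub>E K \<and> s = (\<Sum>i\<in>I. sc (c i) (e i))"
    using assms unfolding free_basis_def by blast
  then show ?thesis by (metis PiE_mem)
qed

lemma free_basis_subst:
  assumes b: "\<forall>k\<in>J. e' k = (\<Sum>i\<in>I. sc (b i k) (e i))"
  shows "(\<Sum>k\<in>J. sc (a k) (e' k)) = (\<Sum>i\<in>I. sc (\<Sum>k\<in>J. a k * b i k) (e i))"
proof -
  have "(\<Sum>k\<in>J. sc (a k) (e' k)) = (\<Sum>k\<in>J. \<Sum>i\<in>I. sc (a k * b i k) (e i))"
    using b by (intro sum.cong) (simp_all add: sc_sum_right sc)
  then show ?thesis by (subst (asm) sum.swap) (simp add: sc_sum_left)
qed

text \<open>The matrices \<open>P\<close> and \<open>Q\<close> of the changes of basis satisfy \<open>P Q = 1\<close>, and \<open>C' = Q C P\<close> for the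
  matrices of the map, so \<open>tr C' = tr (C P Q) = tr C\<close>. It covers rectangular
  \<open>P\<close> and \<open>Q\<close>, as the definition of the trace admits bases of any length.\<close>

lemma trace_basis_independent:
  assumes e: "free_basis K sc S I e" and e': "free_basis K sc S J e'"
    and T: "\<And>a. \<forall>i\<in>I. a i \<in> K \<Longrightarrow> T (\<Sum>i\<in>I. sc (a i) (e i)) = (\<Sum>i\<in>I. sc (a i) (T (e i)))"
      "\<And>i. i \<in> I \<Longrightarrow> T (e i) \<in> S" "\<And>j. j \<in> J \<Longrightarrow> T (e' j) \<in> S"
    and C: "\<forall>i\<in>I. \<forall>j\<in>I. C i j \<in> K" "\<forall>j\<in>I. T (e j) = (\<Sum>i\<in>I. sc (C i j) (e i))"
    and C': "\<forall>i\<in>J. \<forall>j\<in>J. C' i j \<in> K" "\<forall>j\<in>J. T (e' j) = (\<Sum>i\<in>J. sc (C' i j) (e' i))"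
  shows "(\<Sum>j\<in>J. C' j j) = (\<Sum>i\<in>I. C i i)"
proof -
  have finI: "finite I" and Se: "\<And>i. i \<in> I \<Longrightarrow> e i \<in> S" "\<And>j. j \<in> J \<Longrightarrow> e' j \<in> S"
    using e e' unfolding free_basis_def by blast+
  have "\<forall>j\<in>J. \<exists>c. (\<forall>i\<in>I. c i \<in> K) \<and> e' j = (\<Sum>i\<in>I. sc (c i) (e i))"
    using free_basis_span[OF e] Se by blast
  then obtain P' where P': "\<forall>j\<in>J. (\<forall>i\<in>I. P' j i \<in> K) \<and> e' j = (\<Sum>i\<in>I. sc (P' j i) (e i))"
    by metis
  define P where "P i j = P' j i" for i j
  have P: "\<forall>j\<in>J. \<forall>i\<in>I. P i j \<in> K" "\<forall>j\<in>J. e' j = (\<Sum>i\<in>I. sc (P i j) (e i))"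
    using P' by (auto simp: P_def)
  have "\<forall>i\<in>I. \<exists>c. (\<forall>j\<in>J. c j \<in> K) \<and> e i = (\<Sum>j\<in>J. sc (c j) (e' j))"
    using free_basis_span[OF e'] Se by blast
  then obtain Q' where Q': "\<forall>i\<in>I. (\<forall>j\<in>J. Q' i j \<in> K) \<and> e i = (\<Sum>j\<in>J. sc (Q' i j) (e' j))"
    by metis
  define Q where "Q j i = Q' i j" for i j
  have Q: "\<forall>i\<in>I. \<forall>j\<in>J. Q j i \<in> K" "\<forall>i\<in>I. e i = (\<Sum>j\<in>J. sc (Q j i) (e' j))"
    using Q' by (auto simp: Q_def)
  have PQ: "(\<Sum>k\<in>J. Q k i' * P i k) = (if i = i' then 1 else 0)" if i: "i \<in> I" "i' \<in> I" for i i'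
  proof (rule free_basis_coeffs_unique[OF e Se(1)[OF i(2)],
        where c = "\<lambda>i. \<Sum>k\<in>J. Q k i' * P i k" and c' = "\<lambda>i. if i = i' then 1 else 0" and i = i])
    show "e i' = (\<Sum>i\<in>I. sc (\<Sum>k\<in>J. Q k i' * P i k) (e i))"
      using Q(2) i(2) free_basis_subst[OF P(2), of "\<lambda>k. Q k i'"] by simp
    have "(\<Sum>i\<in>I. sc (if i = i' then 1 else 0) (e i)) = (\<Sum>i\<in>I. if i = i' then e i else 0)"
      by (intro sum.cong) (auto simp: sc)
    then show "e i' = (\<Sum>i\<in>I. sc (if i = i' then 1 else 0) (e i))" using i finI by simp
  qed (use P Q i in \<open>auto intro!: K_sum K\<close>)
  have C'_eq: "C' j' j = (\<Sum>i\<in>I. (\<Sum>k\<in>I. P k j * C i k) * Q j' i)" if j: "j \<in> J" "j' \<in> J" for j j'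
  proof (rule free_basis_coeffs_unique[OF e' T(3)[OF j(1)], where c = "\<lambda>j'. C' j' j" and i = j'
        and c' = "\<lambda>j'. \<Sum>i\<in>I. (\<Sum>k\<in>I. P k j * C i k) * Q j' i"])
    show "T (e' j) = (\<Sum>i\<in>J. sc (C' i j) (e' i))" using C' j by blast
    have "T (e' j) = (\<Sum>k\<in>I. sc (P k j) (T (e k)))" using P j T(1)[of "\<lambda>k. P k j"] by simp
    also have "\<dots> = (\<Sum>i\<in>I. sc (\<Sum>k\<in>I. P k j * C i k) (e i))"
      by (rule free_basis_subst[OF C(2)])
    also have "\<dots> = (\<Sum>j'\<in>J. sc (\<Sum>i\<in>I. (\<Sum>k\<in>I. P k j * C i k) * Q j' i) (e' j'))"
      by (rule free_basis_subst[OF Q(2)])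
    finally show "T (e' j) = (\<Sum>j'\<in>J. sc (\<Sum>i\<in>I. (\<Sum>k\<in>I. P k j * C i k) * Q j' i) (e' j'))" .
  qed (use j P Q C C' in \<open>auto intro!: K_sum K\<close>)
  have "(\<Sum>j\<in>J. C' j j) = (\<Sum>j\<in>J. \<Sum>i\<in>I. \<Sum>k\<in>I. C i k * (Q j i * P k j))"
    by (intro sum.cong) (simp_all add: C'_eq sum_distrib_left sum_distrib_right ac_simps)
  also have "\<dots> = (\<Sum>i\<in>I. \<Sum>k\<in>I. \<Sum>j\<in>J. C i k * (Q j i * P k j))"
    by (subst sum.swap, intro sum.cong refl, subst sum.swap) simp
  also have "\<dots> = (\<Sum>i\<in>I. \<Sum>k\<in>I. if k = i then C i k else 0)"
    by (intro sum.cong refl) (simp add: sum_distrib_left[symmetric] PQ)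
  also have "\<dots> = (\<Sum>i\<in>I. C i i)" using finI by simp
  finally show ?thesis .
qed

text \<open>The definition of the trace refers to bases indexed by initial segments of the natural numbers.
  Reindexing \<open>e\<close> gives such a basis, and the value is the same for all others by
  \<open>trace_basis_independent\<close>.\<close>

lemma module_trace_eq:
  assumes e: "free_basis K sc S I e"
    and T: "\<And>a. \<forall>i\<in>I. a i \<in> K \<Longrightarrow> T (\<Sum>i\<in>I. sc (a i) (e i)) = (\<Sum>i\<in>I. sc (a i) (T (e i)))"
      "\<And>s. s \<in> S \<Longrightarrow> T s \<in> S"
    and C: "\<forall>i\<in>I. \<forall>j\<in>I. C i j \<in> K" "\<forall>j\<in>I. T (e j) = (\<Sum>i\<in>I. sc (C i j) (e i))"
  shows "module_trace K sc S T = (\<Sum>i\<in>I. C i i)"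
  unfolding module_trace_def
proof (rule the_equality)
  have fin: "finite I" and Se: "e ` I \<subseteq> S" using e by (auto simp: free_basis_def)
  let ?n = "card I"
  obtain h where h: "bij_betw h {..<?n} I"
    using ex_bij_betw_nat_finite[OF fin] by (auto simp: atLeast0LessThan)
  then have hI: "h i \<in> I" if "i < ?n" for i using that by (auto simp: bij_betw_def)
  note re = sum.reindex_bij_betw[OF h]
  have "free_basis K sc S {..<?n} (e \<circ> h)"
  proof (rule free_basisI)
    show "(e \<circ> h) ` {..<?n} \<subseteq> S" using hI Se by auto
    show "\<exists>c. (\<forall>i\<in>{..<?n}. c i \<in> K) \<and> s = (\<Sum>i\<in>{..<?n}. sc (c i) ((e \<circ> h) i))" if s: "s \<in> S" for s
    proof -
      obtain c where "\<forall>i\<in>I. c i \<in> K" "s = (\<Sum>i\<in>I. sc (c i) (e i))" using free_basis_span[OF e s] by blast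
      then show ?thesis using hI re[of "\<lambda>i. sc (c i) (e i)"] by (intro exI[of _ "c \<circ> h"]) auto
    qed
    fix c c' i
    assume S: "(\<Sum>i\<in>{..<?n}. sc (c i) ((e \<circ> h) i)) \<in> S"
      and c: "\<forall>i\<in>{..<?n}. c i \<in> K" "\<forall>i\<in>{..<?n}. c' i \<in> K"
      and eq: "(\<Sum>i\<in>{..<?n}. sc (c i) ((e \<circ> h) i)) = (\<Sum>i\<in>{..<?n}. sc (c' i) ((e \<circ> h) i))"
      and i: "i \<in> {..<?n}"
    define r where "r = inv_into {..<?n} h"
    have r: "r (h i) = i" if "i < ?n" for i
      using that h by (simp add: r_def bij_betw_def inv_into_f_f)
    have rn: "\<forall>i\<in>I. r i \<in> {..<?n}" using bij_betwE[OF bij_betw_inv_into[OF h]] by (auto simp: r_def)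
    have re': "(\<Sum>i\<in>{..<?n}. sc (d i) ((e \<circ> h) i)) = (\<Sum>i\<in>I. sc (d (r i)) (e i))" for d
      using re[of "\<lambda>i. sc (d (r i)) (e i)"] by (simp add: r)
    have "c (r (h i)) = c' (r (h i))"
      using free_basis_coeffs_unique[OF e S, of "\<lambda>i. c (r i)" "\<lambda>i. c' (r i)" "h i"] c rn hI i
      by (simp only: re'[symmetric] eq) simp
    then show "c i = c' i" using r i by simp
  qed simp
  then show "\<exists>n e c. free_basis K sc S {..<n::nat} e \<and> (\<forall>i<n. \<forall>j<n. c i j \<in> K) \<and>
      (\<forall>j<n. T (e j) = (\<Sum>i<n. sc (c i j) (e i))) \<and> (\<Sum>i\<in>I. C i i) = (\<Sum>i<n. c i i)"
    using C hI re by (intro exI[of _ ?n] exI[of _ "e \<circ> h"] exI[of _ "\<lambda>i j. C (h i) (h j)"])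
      (auto simp: re[symmetric])
next
  fix t assume "\<exists>n e c. free_basis K sc S {..<n::nat} e \<and> (\<forall>i<n. \<forall>j<n. c i j \<in> K) \<and>
      (\<forall>j<n. T (e j) = (\<Sum>i<n. sc (c i j) (e i))) \<and> t = (\<Sum>i<n. c i i)"
  then obtain n e' c where e': "free_basis K sc S {..<n::nat} e'" "\<forall>i<n. \<forall>j<n. c i j \<in> K"
      "\<forall>j<n. T (e' j) = (\<Sum>i<n. sc (c i j) (e' i))" "t = (\<Sum>i<n. c i i)"
    by blast
  have S: "e i \<in> S" if "i \<in> I" for i
    using e that unfolding free_basis_def by blast
  have S': "e' j \<in> S" if "j \<in> {..<n}" for j
    using e' that unfolding free_basis_def by blast
  show "t = (\<Sum>i\<in>I. C i i)"
    unfolding e'(4)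
    by (rule trace_basis_independent[OF e e'(1) T(1) T(2)[OF S] T(2)[OF S'] C]) (use e' in auto)
qed

end

section \<open>The Courant algebroid over a parallelizable manifold\<close>

lemma fmul_eval: "fmul f T x = f * T x"
  by (simp add: fmul_def)

lemma smul_scalar_action:
  "smul (a + b) x = smul a x + smul b x" "smul a (x + y) = smul a x + smul a y"
  "smul (a * b) x = smul a (smul b x)" "smul 1 x = x"
  by (simp_all add: smul_def fmul_def fun_eq_iff distrib_left distrib_right mult.assoc split_beta prod_eq_iff)

lemma anchor_add [simp]: "anchor (u + w) = anchor u + anchor w"
  and anchor_diff [simp]: "anchor (u - w) = anchor u - anchor w"
  and anchor_0 [simp]: "anchor 0 = 0"
  and anchor_smul [simp]: "anchor (smul f u) = fmul f (anchor u)"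
  by (auto simp: anchor_def smul_def split: prod.splits)

lemma anchor_dorfman: "anchor (dorfman G H F u w) f = anchor u (anchor w f) - anchor w (anchor u f)"
  by (auto simp: anchor_def dorfman_def lie_bracket_def split: prod.splits)

lemma pairing_commute: "pairing u w = pairing w u"
  by (auto simp: pairing_def fun_eq_iff algebra_simps split: prod.splits)

context smooth_manifold
begin

lemma scalar_action_smul: "scalar_action (C_inf G) smul"
  by unfold_locales (auto simp: smul_scalar_action)

lemma one_formsI:
  assumes "\<And>X. X \<notin> vfields G \<Longrightarrow> \<xi> X = 0" "\<And>X. X \<in> vfields G \<Longrightarrow> \<xi> X \<in> C_inf G"
    "\<And>X Y. X \<in> vfields G \<Longrightarrow> Y \<in> vfields G \<Longrightarrow> \<xi> (X + Y) = \<xi> X + \<xi> Y"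
    "\<And>f X. f \<in> C_inf G \<Longrightarrow> X \<in> vfields G \<Longrightarrow> \<xi> (fmul f X) = f * \<xi> X"
  shows "\<xi> \<in> one_forms G"
  using assms by (simp add: one_forms_def)

lemma one_forms_outside: "\<xi> \<in> one_forms G \<Longrightarrow> X \<notin> vfields G \<Longrightarrow> \<xi> X = 0"
  by (simp add: one_forms_def)

lemma one_forms_C_inf [simp]: "\<xi> \<in> one_forms G \<Longrightarrow> \<xi> X \<in> C_inf G"
  using C_inf_0 by (cases "X \<in> vfields G") (auto simp: one_forms_def)

lemma one_forms_add: "\<xi> \<in> one_forms G \<Longrightarrow> X \<in> vfields G \<Longrightarrow> Y \<in> vfields G \<Longrightarrow> \<xi> (X + Y) = \<xi> X + \<xi> Y"
  and one_forms_fmul: "\<xi> \<in> one_forms G \<Longrightarrow> X \<in> vfields G \<Longrightarrow> f \<in> C_inf G \<Longrightarrow> \<xi> (fmul f X) = f * \<xi> X"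
  unfolding one_forms_def by blast+

lemma one_forms_diff:
  assumes "\<xi> \<in> one_forms G" "X \<in> vfields G" "Y \<in> vfields G"
  shows "\<xi> (X - Y) = \<xi> X - \<xi> Y"
  using one_forms_add[of \<xi> "X - Y" Y] assms by (simp add: eq_diff_eq)

lemma one_forms_0: "\<xi> \<in> one_forms G \<Longrightarrow> \<xi> 0 = 0"
  using one_forms_add[of \<xi> 0 0] by simp

lemma one_forms_sum:
  assumes "\<xi> \<in> one_forms G" "\<And>i. i \<in> I \<Longrightarrow> X i \<in> vfields G"
  shows "\<xi> (sum X I) = (\<Sum>i\<in>I. \<xi> (X i))"
  using assms(2)
  by (induction I rule: infinite_finite_induct) (simp_all add: one_forms_0[OF assms(1)] one_forms_add[OF assms(1)] vfields_sum)

lemma one_forms_closed [simp]: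
  "0 \<in> one_forms G" "\<xi> \<in> one_forms G \<Longrightarrow> \<zeta> \<in> one_forms G \<Longrightarrow> \<xi> + \<zeta> \<in> one_forms G"
  "\<xi> \<in> one_forms G \<Longrightarrow> f \<in> C_inf G \<Longrightarrow> fmul f \<xi> \<in> one_forms G"
  "\<xi> \<in> one_forms G \<Longrightarrow> - \<xi> \<in> one_forms G"
  "\<xi> \<in> one_forms G \<Longrightarrow> \<zeta> \<in> one_forms G \<Longrightarrow> \<xi> - \<zeta> \<in> one_forms G"
proof -
  have A: "\<xi> + \<zeta> \<in> one_forms G" if "\<xi> \<in> one_forms G" "\<zeta> \<in> one_forms G" for \<xi> \<zeta>
    using that by (intro one_formsI)
      (simp_all add: one_forms_outside[OF that(1)] one_forms_add[OF that(1)] one_forms_fmul[OF that(1)]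
        one_forms_outside[OF that(2)] one_forms_add[OF that(2)] one_forms_fmul[OF that(2)] distrib_left ac_simps)
  have B: "fmul f \<xi> \<in> one_forms G" if "\<xi> \<in> one_forms G" "f \<in> C_inf G" for f \<xi>
    using that by (intro one_formsI)
      (simp_all add: fmul_eval[of f \<xi>] one_forms_outside[OF that(1)] one_forms_add[OF that(1)]
        one_forms_fmul[OF that(1)] distrib_left ac_simps)
  have C: "- \<xi> \<in> one_forms G" if "\<xi> \<in> one_forms G" for \<xi>
  proof -
    have "fmul (\<lambda>_. -1) \<xi> = - \<xi>" by (simp add: fun_eq_iff)
    then show ?thesis using B[OF that, of "\<lambda>_. -1"] by simp
  qed
  show "0 \<in> one_forms G" by (rule one_formsI) auto
  show "\<xi> \<in> one_forms G \<Longrightarrow> \<zeta> \<in> one_forms G \<Longrightarrow> \<xi> + \<zeta> \<in> one_forms G"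
    "\<xi> \<in> one_forms G \<Longrightarrow> f \<in> C_inf G \<Longrightarrow> fmul f \<xi> \<in> one_forms G"
    "\<xi> \<in> one_forms G \<Longrightarrow> - \<xi> \<in> one_forms G"
    by (fact A B C)+
  show "\<xi> \<in> one_forms G \<Longrightarrow> \<zeta> \<in> one_forms G \<Longrightarrow> \<xi> - \<zeta> \<in> one_forms G"
    using A[of \<xi> "- \<zeta>"] C[of \<zeta>] by simp
qed

lemma two_forms_one_forms [simp]: "F \<in> two_forms G \<Longrightarrow> F X \<in> one_forms G"
  by (cases "X \<in> vfields G") (auto simp: two_forms_def)

lemma two_forms_skew: "F \<in> two_forms G \<Longrightarrow> X \<in> vfields G \<Longrightarrow> Y \<in> vfields G \<Longrightarrow> F X Y = - F Y X"
  unfolding two_forms_def by blast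

lemma two_forms_add:
  assumes F: "F \<in> two_forms G" and X: "X \<in> vfields G" "Y \<in> vfields G"
  shows "F (X + Y) = F X + F Y"
proof
  fix Z show "F (X + Y) Z = (F X + F Y) Z"
  proof (cases "Z \<in> vfields G")
    case True
    then show ?thesis
      using X by (simp add: two_forms_skew[OF F _ True] one_forms_add[OF two_forms_one_forms[OF F]])
  qed (simp add: one_forms_outside[OF two_forms_one_forms[OF F]])
qed

lemma two_forms_fmul:
  assumes F: "F \<in> two_forms G" and X: "X \<in> vfields G" "f \<in> C_inf G"
  shows "F (fmul f X) = fmul f (F X)"
proof
  fix Z show "F (fmul f X) Z = fmul f (F X) Z"
  proof (cases "Z \<in> vfields G")
    case True
    then show ?thesis
      using X by (simp add: two_forms_skew[OF F _ True] one_forms_fmul[OF two_forms_one_forms[OF F]] fmul_eval[of f "F X"])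
  qed (simp add: one_forms_outside[OF two_forms_one_forms[OF F]] fmul_def)
qed

lemma three_forms_two_forms [simp]:
  assumes "H \<in> three_forms G" shows "H X \<in> two_forms G"
proof (cases "X \<in> vfields G")
  case False
  with assms have "H X = 0" unfolding three_forms_def by blast
  then show ?thesis by (simp add: two_forms_def)
next
  case True
  with assms show ?thesis unfolding three_forms_def by blast
qed

lemma three_forms_skew:
  "H \<in> three_forms G \<Longrightarrow> X \<in> vfields G \<Longrightarrow> Y \<in> vfields G \<Longrightarrow> Z \<in> vfields G \<Longrightarrow> H X Y Z = - H Y X Z"
  unfolding three_forms_def by blast

lemma three_forms_add:
  assumes H: "H \<in> three_forms G" and X: "X \<in> vfields G" "Y \<in> vfields G" "Z \<in> vfields G" "W \<in> vfields G"
  shows "H (X + Y) Z W = H X Z W + H Y Z W"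
  using X by (simp add: three_forms_skew[OF H _ X(3,4)] two_forms_add[OF three_forms_two_forms[OF H]])

lemma three_forms_fmul:
  assumes H: "H \<in> three_forms G" and X: "X \<in> vfields G" "f \<in> C_inf G" "Z \<in> vfields G" "W \<in> vfields G"
  shows "H (fmul f X) Z W = f * H X Z W"
  using X by (simp add: three_forms_skew[OF H _ X(3,4)] two_forms_fmul[OF three_forms_two_forms[OF H]] fmul_eval[of f "H Z X"])

lemma lie_bracket_skew: "lie_bracket Y X = - lie_bracket X Y"
  by (simp add: lie_bracket_def fun_eq_iff)

lemma lie_bracket_0: "Y \<in> vfields G \<Longrightarrow> lie_bracket 0 Y = 0"
  using vfields_linear(1)[of Y 0 0] by (simp add: lie_bracket_def fun_eq_iff)

lemma lie_bracket_add_left: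
  assumes "X \<in> vfields G" "X' \<in> vfields G" "Y \<in> vfields G"
  shows "lie_bracket (X + X') Y = lie_bracket X Y + lie_bracket X' Y"
  using assms by (simp add: lie_bracket_def vfields_derivation[OF assms(3)] fun_eq_iff)

lemma lie_bracket_add_right:
  assumes "X \<in> vfields G" "X' \<in> vfields G" "Y \<in> vfields G"
  shows "lie_bracket Y (X + X') = lie_bracket Y X + lie_bracket Y X'"
  using lie_bracket_add_left[OF assms] by (simp add: lie_bracket_skew[of Y])

lemma lie_bracket_fmul_left:
  assumes "X \<in> vfields G" "Y \<in> vfields G" "f \<in> C_inf G"
  shows "lie_bracket (fmul f X) Y = fmul f (lie_bracket X Y) - fmul (Y f) X"
proof
  fix h
  show "lie_bracket (fmul f X) Y h = (fmul f (lie_bracket X Y) - fmul (Y f) X) h"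
    using assms by (simp add: lie_bracket_def fmul_eval vfields_derivation[OF assms(2)] right_diff_distrib)
qed

lemma lie_bracket_fmul_right:
  assumes "X \<in> vfields G" "Y \<in> vfields G" "f \<in> C_inf G"
  shows "lie_bracket X (fmul f Y) = fmul f (lie_bracket X Y) + fmul (X f) Y"
proof
  fix h
  show "lie_bracket X (fmul f Y) h = (fmul f (lie_bracket X Y) + fmul (X f) Y) h"
    using assms by (simp add: lie_bracket_def fmul_eval vfields_derivation[OF assms(1)] right_diff_distrib)
qed

lemma sections_iff: "(X, \<xi>, l) \<in> sections G \<longleftrightarrow> X \<in> vfields G \<and> \<xi> \<in> one_forms G \<and> l \<in> C_inf G"
  by (simp add: sections_def)

lemma anchor_vfields [simp]: "u \<in> sections G \<Longrightarrow> anchor u \<in> vfields G"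
  by (auto simp: sections_def anchor_def)

lemma sections_closed [simp]:
  "0 \<in> sections G" "u \<in> sections G \<Longrightarrow> w \<in> sections G \<Longrightarrow> u + w \<in> sections G"
  "u \<in> sections G \<Longrightarrow> w \<in> sections G \<Longrightarrow> u - w \<in> sections G"
  "u \<in> sections G \<Longrightarrow> - u \<in> sections G"
  "f \<in> C_inf G \<Longrightarrow> u \<in> sections G \<Longrightarrow> smul f u \<in> sections G"
  by (simp_all add: sections_def smul_def zero_prod_def split_beta mem_Times_iff)

lemma sections_sum: "(\<And>i. i \<in> I \<Longrightarrow> u i \<in> sections G) \<Longrightarrow> sum u I \<in> sections G"
  by (induction I rule: infinite_finite_induct) auto

lemma pairing_C_inf [simp]:
  assumes "u \<in> sections G" "w \<in> sections G"
  shows "pairing u w \<in> C_inf G"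
proof -
  obtain X \<xi> l Y \<eta> m where uw: "u = (X, \<xi>, l)" "w = (Y, \<eta>, m)" by (metis prod_cases3)
  have "(\<lambda>_. 1/2) * (\<xi> Y + \<eta> X) + l * m \<in> C_inf G"
    using assms by (simp add: uw sections_iff)
  also have "(\<lambda>_. 1/2) * (\<xi> Y + \<eta> X) + l * m = pairing u w"
    by (simp add: uw pairing_def fun_eq_iff)
  finally show ?thesis .
qed

lemma pairing_add:
  assumes "u \<in> sections G" "u' \<in> sections G" "w \<in> sections G"
  shows "pairing (u + u') w = pairing u w + pairing u' w"
    "pairing w (u + u') = pairing w u + pairing w u'"
proof -
  show "pairing (u + u') w = pairing u w + pairing u' w"
  proof -
    obtain X \<xi> l X' \<xi>' l' Y \<eta> m where uw: "u = (X, \<xi>, l)" "u' = (X', \<xi>', l')" "w = (Y, \<eta>, m)"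
      by (metis prod_cases3)
    then have "\<eta> (X + X') = \<eta> X + \<eta> X'" using assms by (simp add: sections_iff one_forms_add[of \<eta>])
    then show ?thesis by (simp add: uw pairing_def fun_eq_iff distrib_right add_divide_distrib)
  qed
  then show "pairing w (u + u') = pairing w u + pairing w u'"
    by (simp add: pairing_commute[of w])
qed

lemma pairing_smul:
  assumes "f \<in> C_inf G" "u \<in> sections G" "w \<in> sections G"
  shows "pairing (smul f u) w = f * pairing u w"
    "pairing w (smul f u) = f * pairing w u"
proof -
  show "pairing (smul f u) w = f * pairing u w"
  proof -
    obtain X \<xi> l Y \<eta> m where uw: "u = (X, \<xi>, l)" "w = (Y, \<eta>, m)" by (metis prod_cases3)
    then have "\<eta> (fmul f X) = f * \<eta> X" using assms by (simp add: sections_iff one_forms_fmul[of \<eta>])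
    then show ?thesis by (simp add: uw pairing_def smul_def fun_eq_iff distrib_left)
  qed
  then show "pairing w (smul f u) = f * pairing w u"
    by (simp add: pairing_commute[of w])
qed

lemma pairing_0 [simp]: "u \<in> sections G \<Longrightarrow> pairing 0 u = 0" "u \<in> sections G \<Longrightarrow> pairing u 0 = 0"
  using pairing_add[of 0 0 u] by simp_all

lemma pairing_diff:
  assumes "u \<in> sections G" "u' \<in> sections G" "w \<in> sections G"
  shows "pairing (u - u') w = pairing u w - pairing u' w"
    "pairing w (u - u') = pairing w u - pairing w u'"
  using pairing_add[of "u - u'" u' w] assms by (simp_all add: eq_diff_eq)

lemma pairing_sum:
  assumes "\<And>i. i \<in> I \<Longrightarrow> u i \<in> sections G" "w \<in> sections G"
  shows "pairing (sum u I) w = (\<Sum>i\<in>I. pairing (u i) w)"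
  using assms(1)
  by (induction I rule: infinite_finite_induct) (simp_all add: assms(2) pairing_add sections_sum)

text \<open>The factor 2 compensates the factor \<open>1/2\<close> of the scalar product, see \<open>pairing_grad\<close>.\<close>

definition grad :: "('g \<Rightarrow> real) \<Rightarrow> 'g sec" where
  "grad f = (0, fmul 2 (d_fun G f), 0)"

lemma d_fun_one_forms [simp]: "f \<in> C_inf G \<Longrightarrow> d_fun G f \<in> one_forms G"
  by (intro one_formsI) (auto simp: d_fun_def fmul_eval)

lemma d_fun_add:
  assumes "f \<in> C_inf G" "h \<in> C_inf G"
  shows "d_fun G (f + h) = d_fun G f + d_fun G h"
  using assms by (simp add: d_fun_def fun_eq_iff vfields_derivation)

lemma d_fun_mult:
  assumes "f \<in> C_inf G" "h \<in> C_inf G"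
  shows "d_fun G (f * h) = fmul f (d_fun G h) + fmul h (d_fun G f)"
  using assms by (simp add: d_fun_def fun_eq_iff vfields_derivation)

lemma grad_sections [simp]: "f \<in> C_inf G \<Longrightarrow> grad f \<in> sections G"
proof -
  assume f: "f \<in> C_inf G"
  have "(2 :: 'g \<Rightarrow> real) \<in> C_inf G"
    using C_inf_add[OF C_inf_1 C_inf_1] by simp
  then show ?thesis using f by (simp add: grad_def sections_iff)
qed

lemma pairing_grad:
  assumes "f \<in> C_inf G" "u \<in> sections G"
  shows "pairing u (grad f) = anchor u f"
proof -
  obtain X \<xi> l where u: "u = (X, \<xi>, l)" by (metis prod_cases3)
  then have "\<xi> 0 = 0" "X \<in> vfields G" using assms one_forms_0[of \<xi>] by (simp_all add: sections_iff)
  then show ?thesis by (simp add: u pairing_def grad_def anchor_def d_fun_def fun_eq_iff)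
qed

end

text \<open>That the bracket of two vector fields is again one is required on the frame only, where it is clear if
  the frame is left-invariant and spans a Lie algebra; the Leibniz rule extends it to all vector fields.\<close>

locale parallelizable = smooth_manifold G
  for G :: "('g::topological_space, 'e::euclidean_space) lie_struct" +
  fixes I :: "'i set" and v :: "'i \<Rightarrow> 'g vf"
  assumes frame_vfields [simp]: "i \<in> I \<Longrightarrow> v i \<in> vfields G"
    and frame_spans: "X \<in> vfields G \<Longrightarrow> \<exists>c. (\<forall>i\<in>I. c i \<in> C_inf G) \<and> X = (\<Sum>i\<in>I. fmul (c i) (v i))"
    and frame_brackets: "i \<in> I \<Longrightarrow> j \<in> I \<Longrightarrow> lie_bracket (v i) (v j) \<in> vfields G"
begin

lemma lie_bracket_vfields [simp]:
  assumes "X \<in> vfields G" "Y \<in> vfields G"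
  shows "lie_bracket X Y \<in> vfields G"
proof -
  have step: "lie_bracket X Y \<in> vfields G"
    if X: "X \<in> vfields G" and Y: "Y \<in> vfields G" and b: "\<And>i. i \<in> I \<Longrightarrow> lie_bracket (v i) Y \<in> vfields G" for X Y
  proof -
    obtain c where c: "\<forall>i\<in>I. c i \<in> C_inf G" "X = (\<Sum>i\<in>I. fmul (c i) (v i))"
      using frame_spans[OF X] by blast
    have "J \<subseteq> I \<Longrightarrow> lie_bracket (\<Sum>i\<in>J. fmul (c i) (v i)) Y \<in> vfields G" for J
    proof (induction J rule: infinite_finite_induct)
      case (insert i J)
      have "(\<Sum>i\<in>J. fmul (c i) (v i)) \<in> vfields G" using c insert.prems by (intro vfields_sum) auto
      moreover have i: "c i \<in> C_inf G" "v i \<in> vfields G" "lie_bracket (v i) Y \<in> vfields G"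
        using c b insert.prems by auto
      ultimately have eq: "lie_bracket (fmul (c i) (v i) + (\<Sum>i\<in>J. fmul (c i) (v i))) Y
          = lie_bracket (fmul (c i) (v i)) Y + lie_bracket (\<Sum>i\<in>J. fmul (c i) (v i)) Y"
        using Y by (intro lie_bracket_add_left) auto
      moreover have "lie_bracket (fmul (c i) (v i)) Y \<in> vfields G"
        unfolding lie_bracket_fmul_left[OF i(2) Y i(1)] using i Y by (intro vfields_diff vfields_fmul) auto
      ultimately show ?case
        unfolding sum.insert[OF insert.hyps] eq using insert.IH insert.prems by (intro vfields_add) blast+
    qed (simp_all add: lie_bracket_0 Y)
    then show ?thesis using c by simp
  qed
  show ?thesis
    using assms step frame_brackets lie_bracket_skew vfields_uminus frame_vfields
    by (metis (no_types))
qed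

lemma lie_deriv_one_forms [simp]:
  assumes "X \<in> vfields G" "\<xi> \<in> one_forms G"
  shows "lie_deriv G X \<xi> \<in> one_forms G"
  by (rule one_formsI)
    (use assms in \<open>simp_all add: lie_deriv_def one_forms_add[OF assms(2)] one_forms_fmul[OF assms(2)]
      vfields_derivation[OF assms(1)] lie_bracket_add_right lie_bracket_fmul_right algebra_simps\<close>)

lemma d_one_one_forms [simp]:
  assumes "X \<in> vfields G" "\<xi> \<in> one_forms G"
  shows "d_one G \<xi> X \<in> one_forms G"
  by (rule one_formsI)
    (use assms in \<open>simp_all add: d_one_def one_forms_add[OF assms(2)] one_forms_fmul[OF assms(2)] fmul_eval
      vfields_derivation[OF assms(1)] lie_bracket_add_right lie_bracket_fmul_right algebra_simps\<close>)

lemma lie_deriv_add_left: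
  assumes "X \<in> vfields G" "Y \<in> vfields G" "\<xi> \<in> one_forms G"
  shows "lie_deriv G (X + Y) \<xi> = lie_deriv G X \<xi> + lie_deriv G Y \<xi>"
  using assms by (simp add: fun_eq_iff lie_deriv_def lie_bracket_add_left one_forms_add[OF assms(3)])

lemma lie_deriv_add_right:
  assumes "X \<in> vfields G" "\<xi> \<in> one_forms G" "\<zeta> \<in> one_forms G"
  shows "lie_deriv G X (\<xi> + \<zeta>) = lie_deriv G X \<xi> + lie_deriv G X \<zeta>"
  using assms by (simp add: fun_eq_iff lie_deriv_def vfields_derivation[OF assms(1)])

lemma lie_deriv_fmul:
  assumes "X \<in> vfields G" "\<xi> \<in> one_forms G" "f \<in> C_inf G"
  shows "lie_deriv G (fmul f X) \<xi> = fmul f (lie_deriv G X \<xi>) + fmul (\<xi> X) (d_fun G f)"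
    "lie_deriv G X (fmul f \<xi>) = fmul f (lie_deriv G X \<xi>) + fmul (X f) \<xi>"
proof -
  have "lie_deriv G (fmul f X) \<xi> Z = (fmul f (lie_deriv G X \<xi>) + fmul (\<xi> X) (d_fun G f)) Z" for Z
    using assms by (cases "Z \<in> vfields G")
      (simp_all add: lie_deriv_def d_fun_def lie_bracket_fmul_left fmul_eval one_forms_diff[OF assms(2)]
        one_forms_fmul[OF assms(2)] algebra_simps)
  then show "lie_deriv G (fmul f X) \<xi> = fmul f (lie_deriv G X \<xi>) + fmul (\<xi> X) (d_fun G f)" ..
  have "lie_deriv G X (fmul f \<xi>) Z = (fmul f (lie_deriv G X \<xi>) + fmul (X f) \<xi>) Z" for Z
    using assms by (cases "Z \<in> vfields G")
      (simp_all add: lie_deriv_def fmul_eval vfields_derivation[OF assms(1)] one_forms_outside[OF assms(2)]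
        algebra_simps)
  then show "lie_deriv G X (fmul f \<xi>) = fmul f (lie_deriv G X \<xi>) + fmul (X f) \<xi>" ..
qed

lemma d_one_add_right:
  assumes "X \<in> vfields G" "Y \<in> vfields G" "\<xi> \<in> one_forms G"
  shows "d_one G \<xi> (X + Y) = d_one G \<xi> X + d_one G \<xi> Y"
  using assms
  by (simp add: fun_eq_iff d_one_def lie_bracket_add_left one_forms_add[OF assms(3)] vfields_derivation)

lemma d_one_add_left:
  assumes "X \<in> vfields G" "\<xi> \<in> one_forms G" "\<zeta> \<in> one_forms G"
  shows "d_one G (\<xi> + \<zeta>) X = d_one G \<xi> X + d_one G \<zeta> X"
  using assms by (simp add: fun_eq_iff d_one_def vfields_derivation)

lemma d_one_fmul:
  assumes "X \<in> vfields G" "\<xi> \<in> one_forms G" "f \<in> C_inf G"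
  shows "d_one G \<xi> (fmul f X) = fmul f (d_one G \<xi> X)"
    "d_one G (fmul f \<xi>) X = fmul f (d_one G \<xi> X) + fmul (X f) \<xi> - fmul (\<xi> X) (d_fun G f)"
proof -
  have "d_one G \<xi> (fmul f X) Z = fmul f (d_one G \<xi> X) Z" for Z
    using assms vfields_derivation(2)[of Z f "\<xi> X"] by (cases "Z \<in> vfields G")
      (simp_all add: d_one_def lie_bracket_fmul_left fmul_eval one_forms_diff[OF assms(2)]
        one_forms_fmul[OF assms(2)] algebra_simps)
  then show "d_one G \<xi> (fmul f X) = fmul f (d_one G \<xi> X)" ..
  have "d_one G (fmul f \<xi>) X Z = (fmul f (d_one G \<xi> X) + fmul (X f) \<xi> - fmul (\<xi> X) (d_fun G f)) Z" for Z
    using assms vfields_derivation(2)[of Z f "\<xi> X"] by (cases "Z \<in> vfields G")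
      (simp_all add: d_one_def d_fun_def fmul_eval vfields_derivation[OF assms(1)]
        one_forms_outside[OF assms(2)] algebra_simps)
  then show "d_one G (fmul f \<xi>) X = fmul f (d_one G \<xi> X) + fmul (X f) \<xi> - fmul (\<xi> X) (d_fun G f)" ..
qed

end

locale courant_algebroid = parallelizable G I v
  for G :: "('g::topological_space, 'e::euclidean_space) lie_struct" and I :: "'i set" and v +
  fixes H :: "'g form3" and F :: "'g form2"
  assumes H [simp]: "H \<in> three_forms G" and F [simp]: "F \<in> two_forms G"
begin

abbreviation br :: "'g sec \<Rightarrow> 'g sec \<Rightarrow> 'g sec" where
  "br \<equiv> dorfman G H F"

lemma const_2_C_inf [simp]: "(2 :: 'g \<Rightarrow> real) \<in> C_inf G"
  using C_inf_add[OF C_inf_1 C_inf_1] by simp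

lemma dorfman_sections [simp]:
  assumes "u \<in> sections G" "w \<in> sections G"
  shows "br u w \<in> sections G"
  using assms by (cases u; cases w) (simp add: sections_iff dorfman_def)

lemma three_forms_add':
  "X \<in> vfields G \<Longrightarrow> Y \<in> vfields G \<Longrightarrow> Z \<in> vfields G \<Longrightarrow> H (X + Y) Z = H X Z + H Y Z"
  using three_forms_add[OF H] one_forms_outside[OF two_forms_one_forms[OF three_forms_two_forms[OF H]]]
  by (intro ext) (metis add.right_neutral plus_fun_apply)

lemma three_forms_fmul':
  assumes "f \<in> C_inf G" "X \<in> vfields G" "Z \<in> vfields G"
  shows "H (fmul f X) Z = fmul f (H X Z)"
proof
  fix W
  show "H (fmul f X) Z W = fmul f (H X Z) W"
    using assms by (cases "W \<in> vfields G")
      (simp_all add: fmul_eval[of f "H X Z"] three_forms_fmul[OF H]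
        one_forms_outside[OF two_forms_one_forms[OF three_forms_two_forms[OF H]]])
qed

lemma dorfman_add:
  assumes "u \<in> sections G" "u' \<in> sections G" "w \<in> sections G"
  shows "br (u + u') w = br u w + br u' w" "br w (u + u') = br w u + br w u'"
proof -
  obtain X \<xi> l X' \<xi>' l' Y \<eta> m where uw: "u = (X, \<xi>, l)" "u' = (X', \<xi>', l')" "w = (Y, \<eta>, m)"
    by (metis prod_cases3)
  note s = assms[unfolded uw sections_iff]
  have Y: "Y \<in> vfields G" using s by simp
  show "br (u + u') w = br u w + br u' w"
    using s unfolding uw dorfman_def
    by (simp add: lie_bracket_add_left vfields_derivation[OF Y] two_forms_add[OF F] lie_deriv_add_left
        d_one_add_left d_fun_add two_forms_add[OF three_forms_two_forms[OF H]])
      (simp add: fun_eq_iff algebra_simps)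
  show "br w (u + u') = br w u + br w u'"
    using s unfolding uw dorfman_def
    by (simp add: lie_bracket_add_right vfields_derivation[OF Y] two_forms_add[OF F] lie_deriv_add_right
        d_one_add_right d_fun_add three_forms_add' one_forms_add[OF two_forms_one_forms[OF F]])
      (simp add: fun_eq_iff algebra_simps)
qed

text \<open>The bracket is a derivation in its second argument. In the first one there is the additional term
  \<open>\<langle>u, w\<rangle> grad f\<close>, which disappears for orthogonal \<open>u\<close> and \<open>w\<close>; therefore the curvature is
  a tensor on pairs of sections from \<open>E\<^sub>-\<close> and \<open>E\<^sub>+\<close>.\<close>

lemma dorfman_smul:
  assumes "f \<in> C_inf G" "u \<in> sections G" "w \<in> sections G"
  shows "br u (smul f w) = smul f (br u w) + smul (anchor u f) w"
    "br (smul f u) w = smul f (br u w) - smul (anchor w f) u + smul (pairing u w) (grad f)"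
proof -
  obtain X \<xi> l Y \<eta> m where uw: "u = (X, \<xi>, l)" "w = (Y, \<eta>, m)"
    by (metis prod_cases3)
  note s = assms(2,3)[unfolded uw sections_iff]
  have X: "X \<in> vfields G" and Y: "Y \<in> vfields G" using s by simp_all
  show "br u (smul f w) = smul f (br u w) + smul (anchor u f) w"
    using s assms(1) unfolding uw dorfman_def smul_def anchor_def
    by (simp add: lie_bracket_fmul_right vfields_derivation[OF X] lie_deriv_fmul d_one_fmul
        three_forms_fmul' two_forms_fmul[OF F] one_forms_fmul[OF two_forms_one_forms[OF F]])
      (simp add: fun_eq_iff algebra_simps)
  show "br (smul f u) w = smul f (br u w) - smul (anchor w f) u + smul (pairing u w) (grad f)"
    using s assms(1) unfolding uw dorfman_def smul_def anchor_def grad_def pairing_def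
    by (simp add: lie_bracket_fmul_left vfields_derivation[OF Y] lie_deriv_fmul d_one_fmul d_fun_mult
        two_forms_fmul[OF three_forms_two_forms[OF H]] two_forms_fmul[OF F])
      (simp add: fun_eq_iff algebra_simps add_divide_distrib)
qed

end

section \<open>Orthonormal frames and traces\<close>

lemma sum_fun_apply: "(\<Sum>i\<in>I. f i) p = (\<Sum>i\<in>I. f i p)"
  by (induction I rule: infinite_finite_induct) auto

context smooth_manifold
begin

lemma anchor_fun_add: "u \<in> sections G \<Longrightarrow> f \<in> C_inf G \<Longrightarrow> h \<in> C_inf G \<Longrightarrow> anchor u (f + h) = anchor u f + anchor u h"
  and anchor_fun_mult: "u \<in> sections G \<Longrightarrow> f \<in> C_inf G \<Longrightarrow> h \<in> C_inf G \<Longrightarrow> anchor u (f * h) = anchor u f * h + f * anchor u h"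
  and anchor_fun_const: "u \<in> sections G \<Longrightarrow> anchor u (\<lambda>_. c) = 0"
  and anchor_fun_zero: "u \<in> sections G \<Longrightarrow> anchor u 0 = 0"
  using vfields_derivation[OF anchor_vfields] vfields_const[OF anchor_vfields]
  by (auto simp: zero_fun_def)

lemma anchor_fun_cmult: "u \<in> sections G \<Longrightarrow> f \<in> C_inf G \<Longrightarrow> anchor u ((\<lambda>_. c) * f) = (\<lambda>_. c) * anchor u f"
  by (simp add: anchor_fun_mult anchor_fun_const)

lemma anchor_fun_sum:
  assumes "u \<in> sections G" "\<And>i. i \<in> I \<Longrightarrow> f i \<in> C_inf G"
  shows "anchor u (\<Sum>i\<in>I. f i) = (\<Sum>i\<in>I. anchor u (f i))"
  using assms(2)
  by (induction I rule: infinite_finite_induct)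
    (simp_all add: anchor_fun_zero[OF assms(1)] anchor_fun_add[OF assms(1)] C_inf_sum)

end

text \<open>The frame \<open>e\<close> is indexed by the union of \<open>P\<close> for \<open>E\<^sub>+\<close> and \<open>N\<close> for \<open>E\<^sub>-\<close>. Two properties of the frame
  are stated through the scalar product: \<open>complete\<close> says that it spans, given that it is orthonormal,
  and \<open>E_minus_iff\<close> that \<open>E\<^sub>-\<close> is the orthogonal complement of the \<open>e A\<close> with \<open>A \<in> P\<close>.\<close>

locale orthonormal_courant_algebroid = courant_algebroid G I v H F
  for G :: "('g::topological_space, 'e::euclidean_space) lie_struct" and I :: "'i set" and v H F +
  fixes g :: "'g form2" and P N :: "'k set" and e :: "'k \<Rightarrow> 'g sec" and \<kappa> :: "'k \<Rightarrow> real"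
    and b :: "'k \<Rightarrow> 'k \<Rightarrow> 'k \<Rightarrow> real"
  assumes fin: "finite P" "finite N" and disj: "P \<inter> N = {}"
    and e_sections [simp]: "A \<in> P \<union> N \<Longrightarrow> e A \<in> sections G"
    and orth: "A \<in> P \<union> N \<Longrightarrow> C \<in> P \<union> N \<Longrightarrow> pairing (e A) (e C) = (\<lambda>_. if A = C then \<kappa> A else 0)"
    and \<kappa>_sq: "A \<in> P \<union> N \<Longrightarrow> \<kappa> A * \<kappa> A = 1"
    and complete: "u \<in> sections G \<Longrightarrow> (\<And>A. A \<in> P \<union> N \<Longrightarrow> pairing u (e A) = 0) \<Longrightarrow> u = 0"
    and E_minus_iff: "E_minus G g = {u \<in> sections G. \<forall>A\<in>P. pairing u (e A) = 0}"
    and structure_constants: "A \<in> P \<union> N \<Longrightarrow> B \<in> P \<union> N \<Longrightarrow> C \<in> P \<union> N \<Longrightarrow>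
      pairing (dorfman G H F (e A) (e B)) (e C) = (\<lambda>_. b A B C)"
    and b_skew: "b A B C = - b B A C" "b A B C = - b A C B"
begin

definition K :: "'k set" where "K = P \<union> N"

lemma finite_K: "finite K" and PK: "P \<subseteq> K" and NK: "N \<subseteq> K" and K_diff: "K - P = N" "K - N = P"
  using fin disj by (auto simp: K_def)

lemmas eK [simp] = e_sections[folded K_def]
lemmas orthK = orth[folded K_def]
lemmas \<kappa>K = \<kappa>_sq[folded K_def]
lemmas bK = structure_constants[folded K_def]

text \<open>By orthonormality, these are the sections of the span of the \<open>e A\<close> with \<open>A \<in> Q\<close>.\<close>

definition sub :: "'k set \<Rightarrow> 'g sec set" where
  "sub Q = {u \<in> sections G. \<forall>A\<in>K - Q. pairing u (e A) = 0}"

definition coef :: "'k \<Rightarrow> 'g sec \<Rightarrow> 'g \<Rightarrow> real" where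
  "coef A u = (\<lambda>_. \<kappa> A) * pairing u (e A)"

lemma coef_C_inf [simp]: "A \<in> K \<Longrightarrow> u \<in> sections G \<Longrightarrow> coef A u \<in> C_inf G"
  by (simp add: coef_def)

lemma sub_sections: "u \<in> sub Q \<Longrightarrow> u \<in> sections G"
  by (simp add: sub_def)

lemma sub_K: "sub K = sections G"
  by (simp add: sub_def)

lemma sub_closed:
  "u \<in> sub Q \<Longrightarrow> w \<in> sub Q \<Longrightarrow> u + w \<in> sub Q"
  "u \<in> sub Q \<Longrightarrow> w \<in> sub Q \<Longrightarrow> u - w \<in> sub Q"
  "f \<in> C_inf G \<Longrightarrow> u \<in> sub Q \<Longrightarrow> smul f u \<in> sub Q"
  by (simp_all add: sub_def pairing_add pairing_diff pairing_smul)

lemma sub_sum: "(\<And>i. i \<in> J \<Longrightarrow> u i \<in> sub Q) \<Longrightarrow> sum u J \<in> sub Q"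
  by (induction J rule: infinite_finite_induct) (auto simp: sub_closed, auto simp: sub_def)

lemma e_sub: "A \<in> Q \<Longrightarrow> Q \<subseteq> K \<Longrightarrow> e A \<in> sub Q"
  by (auto simp: sub_def orthK subset_iff fun_eq_iff)

lemma pairing_frame_sum:
  assumes "Q \<subseteq> K" "C \<in> K" "\<And>A. A \<in> Q \<Longrightarrow> f A \<in> C_inf G"
  shows "pairing (\<Sum>A\<in>Q. smul (f A) (e A)) (e C) = (if C \<in> Q then (\<lambda>_. \<kappa> C) * f C else 0)"
proof -
  have fin: "finite Q" using assms(1) finite_K finite_subset by blast
  have "pairing (\<Sum>A\<in>Q. smul (f A) (e A)) (e C) = (\<Sum>A\<in>Q. f A * pairing (e A) (e C))"
    using assms by (subst pairing_sum) (auto intro!: sum.cong simp: pairing_smul subset_iff)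
  also have "\<dots> = (\<Sum>A\<in>Q. if A = C then (\<lambda>_. \<kappa> C) * f C else 0)"
    using assms by (intro sum.cong) (auto simp: orthK subset_iff fun_eq_iff)
  finally show ?thesis using fin by simp
qed

lemma sections_eqI:
  assumes "u \<in> sections G" "w \<in> sections G" "\<And>A. A \<in> K \<Longrightarrow> pairing u (e A) = pairing w (e A)"
  shows "u = w"
  using complete[of "u - w"] assms by (simp add: pairing_diff K_def)

lemma frame_sum_sections: 
  "Q \<subseteq> K \<Longrightarrow> (\<And>A. A \<in> Q \<Longrightarrow> f A \<in> C_inf G) \<Longrightarrow> (\<Sum>A\<in>Q. smul (f A) (e A)) \<in> sections G"
  by (intro sections_sum) auto

lemma frame_expansion:
  assumes "u \<in> sub Q" "Q \<subseteq> K"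
  shows "u = (\<Sum>A\<in>Q. smul (coef A u) (e A))"
proof (rule sections_eqI)
  have u: "u \<in> sections G" using assms(1) by (rule sub_sections)
  have c: "coef A u \<in> C_inf G" if "A \<in> Q" for A using that u assms(2) by auto
  show "(\<Sum>A\<in>Q. smul (coef A u) (e A)) \<in> sections G" by (rule frame_sum_sections[OF assms(2) c])
  fix C assume C: "C \<in> K"
  have "pairing u (e C) = (if C \<in> Q then (\<lambda>_. \<kappa> C) * coef C u else 0)"
    using assms C \<kappa>K[OF C] by (auto simp: coef_def fun_eq_iff mult.assoc[symmetric] sub_def)
  also have "\<dots> = pairing (\<Sum>A\<in>Q. smul (coef A u) (e A)) (e C)"
    by (rule pairing_frame_sum[OF assms(2) C c, symmetric])
  finally show "pairing u (e C) = pairing (\<Sum>A\<in>Q. smul (coef A u) (e A)) (e C)" .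
qed (use assms sub_sections in auto)

definition tensorial :: "'g sec set \<Rightarrow> ('g sec \<Rightarrow> 'g \<Rightarrow> real) \<Rightarrow> bool" where
  "tensorial S q \<longleftrightarrow> (\<forall>u\<in>S. \<forall>w\<in>S. q (u + w) = q u + q w) \<and>
     (\<forall>f\<in>C_inf G. \<forall>u\<in>S. q (smul f u) = f * q u)"

lemma tensorialI:
  "(\<And>u w. u \<in> S \<Longrightarrow> w \<in> S \<Longrightarrow> q (u + w) = q u + q w) \<Longrightarrow>
   (\<And>f u. f \<in> C_inf G \<Longrightarrow> u \<in> S \<Longrightarrow> q (smul f u) = f * q u) \<Longrightarrow> tensorial S q"
  by (simp add: tensorial_def)

lemma tensorial_frame_sum:
  assumes q: "tensorial (sub Q) q" and Q: "Q \<subseteq> K" "J \<subseteq> Q" and f: "\<And>A. A \<in> J \<Longrightarrow> f A \<in> C_inf G"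
  shows "q (\<Sum>A\<in>J. smul (f A) (e A)) = (\<Sum>A\<in>J. f A * q (e A))"
proof -
  have "finite J" using Q finite_K by (meson finite_subset)
  then show ?thesis
    using Q(2) f
  proof (induction J)
    case empty
    have "0 \<in> sub Q" by (simp add: sub_def)
    then have "q (0 + 0) = q 0 + q 0" using q unfolding tensorial_def by blast
    then show ?case by simp
  next
    case (insert A J)
    have "(\<Sum>A\<in>J. smul (f A) (e A)) \<in> sub Q"
      using insert.prems e_sub[OF _ Q(1)] by (intro sub_sum sub_closed(3)) auto
    moreover have "e A \<in> sub Q" "f A \<in> C_inf G" using e_sub[OF _ Q(1)] insert.prems by auto
    moreover from this have "smul (f A) (e A) \<in> sub Q" by (simp add: sub_closed)
    ultimately have "q (smul (f A) (e A) + (\<Sum>A\<in>J. smul (f A) (e A))) = f A * q (e A) + q (\<Sum>A\<in>J. smul (f A) (e A))"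
      using q unfolding tensorial_def by simp
    moreover have "q (\<Sum>A\<in>J. smul (f A) (e A)) = (\<Sum>A\<in>J. f A * q (e A))"
      using insert.IH insert.prems by blast
    ultimately show ?case by (simp only: sum.insert[OF insert.hyps])
  qed
qed

text \<open>By the expansion of \<open>u\<close> in the frame. Metricity, torsion, divergence and Ricci tensors are all reduced to
  the structure constants in this way.\<close>

lemma tensorial_vanishing:
  assumes "tensorial (sub Q) q" "Q \<subseteq> K" "\<And>A. A \<in> Q \<Longrightarrow> q (e A) = 0" "u \<in> sub Q"
  shows "q u = 0"
proof -
  have "q (\<Sum>A\<in>Q. smul (coef A u) (e A)) = 0"
    using assms sub_sections[OF assms(4)]
    by (subst tensorial_frame_sum[OF assms(1,2) subset_refl]) auto
  then show ?thesis using frame_expansion[OF assms(4,2)] by simp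
qed

lemma sub_orthogonal:
  assumes "u \<in> sub (K - Q)" "w \<in> sub Q" "Q \<subseteq> K"
  shows "pairing u w = 0"
proof (rule tensorial_vanishing[OF _ assms(3) _ assms(2)])
  show "tensorial (sub Q) (pairing u)"
    using sub_sections assms(1) by (intro tensorialI) (auto simp: pairing_add pairing_smul)
  show "pairing u (e A) = 0" if "A \<in> Q" for A
    using assms that by (auto simp: sub_def)
qed

lemma E_minus_sub: "E_minus G g = sub N"
  by (simp add: E_minus_iff sub_def K_diff)

lemma E_plus_sub: "E_plus G g = sub P"
proof
  show "E_plus G g \<subseteq> sub P"
    using e_sub[of _ N] NK by (auto simp: E_plus_def E_minus_sub sub_def[of P] K_diff)
  show "sub P \<subseteq> E_plus G g"
    using sub_orthogonal[of _ N] NK sub_sections by (auto simp: E_plus_def E_minus_sub K_diff)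
qed

lemma free_basis_sub: 
  assumes Q: "Q \<subseteq> K"
  shows "free_basis (C_inf G) smul (sub Q) Q e"
proof -
  interpret scalar_action "C_inf G" smul by (rule scalar_action_smul)
  show ?thesis
  proof (rule free_basisI)
    show "finite Q" using Q finite_K finite_subset by blast
    show "e ` Q \<subseteq> sub Q" using e_sub[OF _ Q] by blast
    show "\<exists>c. (\<forall>i\<in>Q. c i \<in> C_inf G) \<and> s = (\<Sum>i\<in>Q. smul (c i) (e i))" if s: "s \<in> sub Q" for s
      using frame_expansion[OF s Q] sub_sections[OF s] Q
      by (intro exI[of _ "\<lambda>A. coef A s"] conjI) auto
    fix c c' i
    assume c: "\<forall>i\<in>Q. c i \<in> C_inf G" "\<forall>i\<in>Q. c' i \<in> C_inf G"
      "(\<Sum>i\<in>Q. smul (c i) (e i)) = (\<Sum>i\<in>Q. smul (c' i) (e i))" and i: "i \<in> Q"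
    have iK: "i \<in> K" using i Q by blast
    have "(\<lambda>_. \<kappa> i) * c i = (\<lambda>_. \<kappa> i) * c' i"
      using pairing_frame_sum[OF Q iK, of c] pairing_frame_sum[OF Q iK, of c'] c i by simp
    then have "((\<lambda>_. \<kappa> i) * c i) p = ((\<lambda>_. \<kappa> i) * c' i) p" for p by simp
    moreover have "\<kappa> i \<noteq> 0" using \<kappa>K[OF iK] by auto
    ultimately show "c i = c' i" by (simp add: fun_eq_iff)
  qed
qed

lemma trace_sub:
  assumes Q: "Q \<subseteq> K" and T: "\<And>u. u \<in> sub Q \<Longrightarrow> T u \<in> sub Q"
    "\<And>u w. u \<in> sub Q \<Longrightarrow> w \<in> sub Q \<Longrightarrow> T (u + w) = T u + T w"
    "\<And>f u. f \<in> C_inf G \<Longrightarrow> u \<in> sub Q \<Longrightarrow> T (smul f u) = smul f (T u)"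
  shows "module_trace (C_inf G) smul (sub Q) T = (\<Sum>A\<in>Q. coef A (T (e A)))"
proof -
  interpret scalar_action "C_inf G" smul by (rule scalar_action_smul)
  have fin: "finite Q" using Q finite_K finite_subset by blast
  show ?thesis
  proof (rule module_trace_eq[where C = "\<lambda>i j. coef i (T (e j))", OF free_basis_sub[OF Q] _ T(1)])
    fix a :: "'k \<Rightarrow> 'g \<Rightarrow> real" assume a: "\<forall>i\<in>Q. a i \<in> C_inf G"
    have "J \<subseteq> Q \<Longrightarrow> (\<Sum>i\<in>J. smul (a i) (e i)) \<in> sub Q \<and>
        T (\<Sum>i\<in>J. smul (a i) (e i)) = (\<Sum>i\<in>J. smul (a i) (T (e i)))" if "finite J" for J
      using that
    proof (induction J)
      case empty
      have 0: "0 \<in> sub Q" by (simp add: sub_def)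
      from T(2)[OF 0 0] 0 show ?case by simp
    next
      case (insert i J)
      have i: "e i \<in> sub Q" "a i \<in> C_inf G" using insert.prems a e_sub[OF _ Q] by auto
      then show ?case
        using insert T(2)[OF sub_closed(3)[OF i(2,1)], of "\<Sum>i\<in>J. smul (a i) (e i)"] T(3)[OF i(2,1)]
          sub_closed(1)[OF sub_closed(3)[OF i(2,1)], of "\<Sum>i\<in>J. smul (a i) (e i)"]
        unfolding sum.insert[OF insert.hyps] by auto
    qed
    then show "T (\<Sum>i\<in>Q. smul (a i) (e i)) = (\<Sum>i\<in>Q. smul (a i) (T (e i)))"
      using fin by blast
  next
    show "\<forall>i\<in>Q. \<forall>j\<in>Q. coef i (T (e j)) \<in> C_inf G"
      using Q sub_sections[OF T(1)[OF e_sub[OF _ Q]]] by auto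
    show "\<forall>j\<in>Q. T (e j) = (\<Sum>i\<in>Q. smul (coef i (T (e j))) (e i))"
      using frame_expansion[OF T(1)[OF e_sub[OF _ Q]] Q] by blast
  qed
qed

end

section \<open>Torsion-free connections and their Ricci tensors\<close>

lemma smul_diff: "smul f (x - y) = smul f x - smul f y"
  using smul_scalar_action(2)[of f "x - y" y] by (simp add: eq_diff_eq)

lemma smul_diff_left: "smul (f - h) x = smul f x - smul h x"
  using smul_scalar_action(1)[of "f - h" h x] by (simp add: eq_diff_eq)

text \<open>The Ricci tensor of the subbundle with index set \<open>Q\<close> on the frame, for a divergence with the values \<open>d\<close>;
  \<open>i\<close> is an index from the other subbundle, and \<open>a\<close> one from \<open>Q\<close>. It is the trace of the
  curvature by \<open>curvature_trace_frame\<close>.\<close>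

definition (in orthonormal_courant_algebroid) ric :: "'k set \<Rightarrow> ('k \<Rightarrow> real) \<Rightarrow> 'k \<Rightarrow> 'k \<Rightarrow> real" where
  "ric Q d i a = (\<Sum>c\<in>Q. \<kappa> c * d c * b i a c)
     - (\<Sum>c\<in>Q. \<Sum>j\<in>K - Q. \<kappa> c * \<kappa> j * b c i j * b j a c)"

locale generalized_connection = orthonormal_courant_algebroid G I v H F g P N e \<kappa> b
  for G :: "('g::topological_space, 'e::euclidean_space) lie_struct" and I :: "'i set" and v H F g
    and P N :: "'k set" and e \<kappa> b +
  fixes D :: "'g conn"
  assumes D: "gen_connection G D"
begin

lemma D_sections [simp]: "u \<in> sections G \<Longrightarrow> w \<in> sections G \<Longrightarrow> D u w \<in> sections G"
  and D_add_left: "u \<in> sections G \<Longrightarrow> u' \<in> sections G \<Longrightarrow> w \<in> sections G \<Longrightarrow> D (u + u') w = D u w + D u' w"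
  and D_smul_left: "f \<in> C_inf G \<Longrightarrow> u \<in> sections G \<Longrightarrow> w \<in> sections G \<Longrightarrow> D (smul f u) w = smul f (D u w)"
  and D_add_right: "u \<in> sections G \<Longrightarrow> w \<in> sections G \<Longrightarrow> w' \<in> sections G \<Longrightarrow> D u (w + w') = D u w + D u w'"
  and D_smul_right: "f \<in> C_inf G \<Longrightarrow> u \<in> sections G \<Longrightarrow> w \<in> sections G \<Longrightarrow>
    D u (smul f w) = smul (anchor u f) w + smul f (D u w)"
  and D_metric: "u \<in> sections G \<Longrightarrow> w \<in> sections G \<Longrightarrow> w' \<in> sections G \<Longrightarrow>
    anchor u (pairing w w') = pairing (D u w) w' + pairing w (D u w')"
  using D unfolding gen_connection_def by blast+

lemma D_diff_left: "u \<in> sections G \<Longrightarrow> u' \<in> sections G \<Longrightarrow> w \<in> sections G \<Longrightarrow> D (u - u') w = D u w - D u' w"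
  using D_add_left[of "u - u'" u' w] by (simp add: eq_diff_eq)

lemma D_csmul_right: "u \<in> sections G \<Longrightarrow> w \<in> sections G \<Longrightarrow> D u (smul (\<lambda>_. c) w) = smul (\<lambda>_. c) (D u w)"
  using D_smul_right[OF C_inf_const, of u w c] scalar_action.sc_0(1)[OF scalar_action_smul, of w]
  by (simp add: anchor_fun_const)

lemma D_frame_sum_right:
  assumes u: "u \<in> sections G" and J: "J \<subseteq> K"
  shows "D u (\<Sum>A\<in>J. smul (\<lambda>_. c A) (e A)) = (\<Sum>A\<in>J. smul (\<lambda>_. c A) (D u (e A)))"
  using J
proof (induction J rule: infinite_finite_induct)
  case (insert A J)
  have "(\<Sum>A\<in>J. smul (\<lambda>_. c A) (e A)) \<in> sections G"
    using insert.prems by (intro frame_sum_sections) auto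
  then show ?case
    using insert u unfolding sum.insert[OF insert.hyps]
    by (simp add: D_add_right D_csmul_right)
qed (use D_add_right[OF u sections_closed(1,1)] in auto)

lemma D_frame_sum_left:
  assumes u: "u \<in> sections G" and J: "J \<subseteq> K"
  shows "D (\<Sum>A\<in>J. smul (\<lambda>_. c A) (e A)) u = (\<Sum>A\<in>J. smul (\<lambda>_. c A) (D (e A) u))"
  using J
proof (induction J rule: infinite_finite_induct)
  case (insert A J)
  have "(\<Sum>A\<in>J. smul (\<lambda>_. c A) (e A)) \<in> sections G"
    using insert.prems by (intro frame_sum_sections) auto
  then show ?case
    using insert u unfolding sum.insert[OF insert.hyps]
    by (simp add: D_add_left D_smul_left)
qed (use D_add_left[OF sections_closed(1,1) u] in auto)

text \<open>Each Leibniz defect of the Dorfman bracket is cancelled by one of the connection.\<close>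

lemma torsion_tensorial:
  assumes "u \<in> sections G" "w \<in> sections G" "x \<in> sections G"
  shows "tensorial (sub K) (\<lambda>u. torsion G H F D u w x)"
    "tensorial (sub K) (\<lambda>w. torsion G H F D u w x)"
    "tensorial (sub K) (\<lambda>x. torsion G H F D u w x)"
proof -
  show "tensorial (sub K) (\<lambda>u. torsion G H F D u w x)" unfolding sub_K
  proof (rule tensorialI)
    fix f u assume f: "f \<in> C_inf G" and u: "u \<in> sections G"
    show "torsion G H F D (smul f u) w x = f * torsion G H F D u w x"
      using f u assms
      by (simp add: torsion_def D_smul_left D_smul_right dorfman_smul pairing_add pairing_diff
          pairing_smul pairing_commute[of "grad f"] pairing_grad)
        (simp add: pairing_commute[of w u] algebra_simps)
  qed (use assms in \<open>simp add: torsion_def D_add_left D_add_right dorfman_add pairing_add pairing_diff\<close>)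
  show "tensorial (sub K) (\<lambda>w. torsion G H F D u w x)" unfolding sub_K
  proof (rule tensorialI)
    fix f w assume f: "f \<in> C_inf G" and w: "w \<in> sections G"
    show "torsion G H F D u (smul f w) x = f * torsion G H F D u w x"
      using f w assms
      by (simp add: torsion_def D_smul_left D_smul_right dorfman_smul pairing_add pairing_diff pairing_smul)
        (simp add: algebra_simps)
  qed (use assms in \<open>simp add: torsion_def D_add_left D_add_right dorfman_add pairing_add pairing_diff\<close>)
  show "tensorial (sub K) (\<lambda>x. torsion G H F D u w x)" unfolding sub_K
    by (rule tensorialI)
      (use assms in \<open>simp_all add: torsion_def D_add_left D_smul_left pairing_add pairing_diff pairing_smul
        distrib_left\<close>)
qed

end

text \<open>The two subbundles enter the curvature traces in the same way, so both are treated at once: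
  \<open>Q\<close> indexes one of them and \<open>K - Q\<close> the other.\<close>

locale split_connection = generalized_connection G I v H F g P N e \<kappa> b D
  for G :: "('g::topological_space, 'e::euclidean_space) lie_struct" and I :: "'i set" and v H F g
    and P N :: "'k set" and e \<kappa> b D +
  fixes Q :: "'k set"
  assumes Q: "Q \<subseteq> K"
    and D_sub: "u \<in> sections G \<Longrightarrow> w \<in> sub Q \<Longrightarrow> D u w \<in> sub Q"
    and D_sub': "u \<in> sections G \<Longrightarrow> w \<in> sub (K - Q) \<Longrightarrow> D u w \<in> sub (K - Q)"
    and torsion_free: "u \<in> sections G \<Longrightarrow> w \<in> sections G \<Longrightarrow> x \<in> sections G \<Longrightarrow> torsion G H F D u w x = 0"
begin

abbreviation R where "R \<equiv> curvature G H F D"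

lemma curvature_sub:
  assumes "w \<in> sections G" "u \<in> sections G" "x \<in> sub Q"
  shows "R w u x \<in> sub Q"
  using assms by (simp add: curvature_def sub_closed D_sub)

lemma curvature_add1:
  assumes "w \<in> sections G" "w' \<in> sections G" "u \<in> sections G" "x \<in> sections G"
  shows "R (w + w') u x = R w u x + R w' u x"
  using assms by (simp add: curvature_def D_add_left D_add_right dorfman_add algebra_simps)

text \<open>The term \<open>\<langle>w, u\<rangle> grad f\<close> in the Leibniz rule for the first argument of the bracket vanishes, because the
  two subbundles are orthogonal.\<close>

lemma curvature_smul1:
  assumes w: "w \<in> sub Q" "u \<in> sub (K - Q)" "x \<in> sections G" "f \<in> C_inf G"
  shows "R (smul f w) u x = smul f (R w u x)"
proof -
  have s: "w \<in> sections G" "u \<in> sections G" using w sub_sections by auto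
  have "pairing w u = 0" using sub_orthogonal[OF w(2,1) Q] by (simp add: pairing_commute)
  then have br: "br (smul f w) u = smul f (br w u) - smul (anchor u f) w"
    using s w by (simp add: dorfman_smul scalar_action.sc_0[OF scalar_action_smul])
  show ?thesis
    using s w unfolding curvature_def br
    by (simp add: D_smul_left D_smul_right D_diff_left smul_diff smul_scalar_action(2) algebra_simps)
qed

lemma curvature_tensorial2:
  assumes "w \<in> sections G" "x \<in> sections G" "y \<in> sections G"
  shows "tensorial (sub (K - Q)) (\<lambda>u. pairing (R w u x) y)"
proof (rule tensorialI)
  fix u u' assume "u \<in> sub (K - Q)" "u' \<in> sub (K - Q)"
  then have u: "u \<in> sections G" "u' \<in> sections G" using sub_sections by auto
  then have "R w (u + u') x = R w u x + R w u' x"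
    using assms by (simp add: curvature_def D_add_left D_add_right dorfman_add algebra_simps)
  then show "pairing (R w (u + u') x) y = pairing (R w u x) y + pairing (R w u' x) y"
    using u assms by (simp add: pairing_add curvature_def)
next
  fix f u assume f: "f \<in> C_inf G" and "u \<in> sub (K - Q)"
  then have u: "u \<in> sections G" using sub_sections by auto
  then have "R w (smul f u) x = smul f (R w u x)"
    using f assms
    by (simp add: curvature_def D_smul_left D_smul_right D_add_left dorfman_smul smul_diff
        smul_scalar_action(2) algebra_simps)
  then show "pairing (R w (smul f u) x) y = f * pairing (R w u x) y"
    using u f assms by (simp add: pairing_smul curvature_def)
qed

lemma curvature_tensorial3:
  assumes "w \<in> sections G" "u \<in> sections G" "y \<in> sections G"
  shows "tensorial (sub Q) (\<lambda>x. pairing (R w u x) y)"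
proof (rule tensorialI)
  fix x x' assume "x \<in> sub Q" "x' \<in> sub Q"
  then have x: "x \<in> sections G" "x' \<in> sections G" using sub_sections by auto
  then have "R w u (x + x') = R w u x + R w u x'"
    using assms by (simp add: curvature_def D_add_left D_add_right dorfman_add algebra_simps)
  then show "pairing (R w u (x + x')) y = pairing (R w u x) y + pairing (R w u x') y"
    using x assms by (simp add: pairing_add curvature_def)
next
  fix f x assume f: "f \<in> C_inf G" and "x \<in> sub Q"
  then have x: "x \<in> sections G" using sub_sections by auto
  have "smul (anchor (br w u) f) x = smul (anchor w (anchor u f)) x - smul (anchor u (anchor w f)) x"
    by (simp add: anchor_dorfman smul_diff_left)
  then have "R w u (smul f x) = smul f (R w u x)"
    using f x assms
    by (simp add: curvature_def D_smul_left D_smul_right D_add_left D_add_right smul_diff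
        smul_scalar_action(2) algebra_simps)
  then show "pairing (R w u (smul f x)) y = f * pairing (R w u x) y"
    using x f assms by (simp add: pairing_smul curvature_def)
qed

lemma curvature_trace:
  assumes u: "u \<in> sub (K - Q)" and x: "x \<in> sub Q"
  shows "module_trace (C_inf G) smul (sub Q) (\<lambda>w. R w u x) = (\<Sum>c\<in>Q. coef c (R (e c) u x))"
  using sub_sections[OF u] sub_sections[OF x] sub_sections
  by (intro trace_sub[OF Q]) (simp_all add: curvature_sub x curvature_add1 curvature_smul1[OF _ u])

text \<open>By tensoriality, such a Ricci tensor vanishes if it does so on the frame.\<close>

lemma curvature_trace_vanishing_iff:
  "(\<forall>u\<in>sub (K - Q). \<forall>x\<in>sub Q. module_trace (C_inf G) smul (sub Q) (\<lambda>w. R w u x) = 0) \<longleftrightarrow>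
   (\<forall>i\<in>K - Q. \<forall>a\<in>Q. (\<Sum>c\<in>Q. coef c (R (e c) (e i) (e a))) = 0)" (is "?L \<longleftrightarrow> ?R")
proof
  assume ?L
  then show ?R
    using e_sub[of _ Q] e_sub[of _ "K - Q"] Q by (auto simp: curvature_trace[symmetric])
next
  assume r: ?R
  let ?q = "\<lambda>u x. \<Sum>c\<in>Q. coef c (R (e c) u x)"
  have eQ: "e c \<in> sections G" if "c \<in> Q" for c using that Q by auto
  have t2: "tensorial (sub (K - Q)) (\<lambda>u. ?q u x)" if x: "x \<in> sections G" for x
    using curvature_tensorial2[OF eQ x eQ] unfolding tensorial_def coef_def
    by (auto simp: sum.distrib sum_distrib_left distrib_left mult.left_commute)
  have t3: "tensorial (sub Q) (?q u)" if u: "u \<in> sections G" for u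
    using curvature_tensorial3[OF eQ u eQ] unfolding tensorial_def coef_def
    by (auto simp: sum.distrib sum_distrib_left distrib_left mult.left_commute)
  have "?q (e i) x = 0" if i: "i \<in> K - Q" and x: "x \<in> sub Q" for i x
    by (rule tensorial_vanishing[OF t3 Q _ x]) (use r i in auto)
  then have "?q u x = 0" if u: "u \<in> sub (K - Q)" and x: "x \<in> sub Q" for u x
    by (intro tensorial_vanishing[OF t2 _ _ u]) (use x sub_sections in auto)
  then show ?L using curvature_trace by simp
qed

text \<open>The other terms of the torsion, \<open>\<langle>D w u, x\<rangle>\<close> and \<open>\<langle>w, D x u\<rangle>\<close>, are products of orthogonal sections, because
  \<open>D\<close> preserves both subbundles.\<close>

lemma mixed_component:
  assumes u: "u \<in> sub (K - Q)" and w: "w \<in> sub Q" and x: "x \<in> sub Q"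
  shows "pairing (D u w) x = pairing (br u w) x"
proof -
  have s: "u \<in> sections G" "w \<in> sections G" "x \<in> sections G" using u w x sub_sections by auto
  have "pairing (D w u) x = 0" "pairing w (D x u) = 0"
    using sub_orthogonal[OF D_sub'[OF s(2) u] x Q] sub_orthogonal[OF D_sub'[OF s(3) u] w Q]
    by (simp_all add: pairing_commute[of w])
  then show ?thesis
    using torsion_free[OF s] s by (simp add: torsion_def pairing_diff)
qed

lemma mixed_frame:
  assumes i: "i \<in> K - Q" and a: "a \<in> Q"
  shows "D (e i) (e a) = (\<Sum>c\<in>Q. smul (\<lambda>_. \<kappa> c * b i a c) (e c))"
proof -
  have K: "i \<in> K" "a \<in> K" using i a Q by auto
  have s: "D (e i) (e a) \<in> sub Q" using D_sub[OF _ e_sub[OF a Q]] K by simp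
  have "coef c (D (e i) (e a)) = (\<lambda>_. \<kappa> c * b i a c)" if c: "c \<in> Q" for c
    using mixed_component[OF e_sub[OF i] e_sub[OF a Q] e_sub[OF c Q]] K c Q
    by (auto simp: coef_def bK fun_eq_iff)
  then show ?thesis using frame_expansion[OF s Q] by simp
qed

lemma bracket_frame:
  assumes K: "A \<in> K" "B \<in> K"
  shows "br (e A) (e B) = (\<Sum>C\<in>K. smul (\<lambda>_. \<kappa> C * b A B C) (e C))"
proof -
  have "coef C (br (e A) (e B)) = (\<lambda>_. \<kappa> C * b A B C)" if "C \<in> K" for C
    using bK[OF K that] by (simp add: coef_def fun_eq_iff)
  then show ?thesis
    using frame_expansion[of "br (e A) (e B)" K] K by (simp add: sub_K)
qed

lemma pairing_const_sum:
  assumes "\<And>A. A \<in> J \<Longrightarrow> x A \<in> sections G" "y \<in> sections G"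
  shows "pairing (\<Sum>A\<in>J. smul (\<lambda>_. k A) (x A)) y p = (\<Sum>A\<in>J. k A * pairing (x A) y p)"
proof -
  have "pairing (\<Sum>A\<in>J. smul (\<lambda>_. k A) (x A)) y = (\<Sum>A\<in>J. (\<lambda>_. k A) * pairing (x A) y)"
    using assms by (subst pairing_sum) (auto intro!: sum.cong simp: pairing_smul)
  then show ?thesis by (simp add: sum_fun_apply)
qed

text \<open>The Christoffel symbols inside \<open>Q\<close> are not determined by the algebroid. In the trace of
  \<open>w \<mapsto> D w (D (e i) (e a))\<close> they form the divergence of \<open>D (e i) (e a)\<close>, which is the first sum
  of \<open>ric\<close>. The other two terms of the curvature contain the derivative of the divergence of \<open>e a\<close>, which
  is constant, and the commutator of \<open>w \<mapsto> D w (e a)\<close> with the \<open>Q\<close>-component of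
  \<open>w \<mapsto> [e i, w]\<close>, which has trace 0. The part of \<open>[e c, e i]\<close> outside \<open>Q\<close> contributes the second sum
  of \<open>ric\<close>.\<close>

lemma curvature_trace_frame:
  assumes div: "\<And>a. a \<in> Q \<Longrightarrow> (\<Sum>c\<in>Q. coef c (D (e c) (e a))) = (\<lambda>_. d a)"
    and i: "i \<in> K - Q" and a: "a \<in> Q"
  shows "(\<Sum>c\<in>Q. coef c (R (e c) (e i) (e a))) = (\<lambda>_. ric Q d i a)"
proof
  fix p
  define \<gamma> where "\<gamma> A B C = pairing (D (e A) (e B)) (e C) p" for A B C
  have iK: "i \<in> K" and aK: "a \<in> K" and QK: "\<And>c. c \<in> Q \<Longrightarrow> c \<in> K" using i a Q by auto
  have [simp]: "finite Q" "finite (K - Q)" using Q finite_K finite_subset by auto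
  have term1: "pairing (D (e c) (D (e i) (e a))) (e c) p = (\<Sum>x\<in>Q. \<kappa> x * b i a x * \<gamma> c x c)" if c: "c \<in> Q" for c
    unfolding mixed_frame[OF i a] \<gamma>_def using c QK Q by (simp add: D_frame_sum_right pairing_const_sum)
  have term2: "pairing (D (e i) (D (e c) (e a))) (e c) p
      = anchor (e i) (pairing (D (e c) (e a)) (e c)) p - (\<Sum>x\<in>Q. \<kappa> x * b i c x * \<gamma> c a x)" if c: "c \<in> Q" for c
  proof -
    have "pairing (D (e c) (e a)) (D (e i) (e c)) p = (\<Sum>x\<in>Q. \<kappa> x * b i c x * \<gamma> c a x)"
      unfolding mixed_frame[OF i c] \<gamma>_def using c QK aK
      by (simp add: pairing_commute[of "D (e c) (e a)"] pairing_const_sum)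
    then show ?thesis
      using D_metric[of "e i" "D (e c) (e a)" "e c"] c QK aK iK by (simp add: fun_eq_iff)
  qed
  have term3: "pairing (D (br (e c) (e i)) (e a)) (e c) p
      = (\<Sum>x\<in>Q. \<kappa> x * b c i x * \<gamma> x a c) + (\<Sum>j\<in>K - Q. \<kappa> j * b c i j * b j a c)" if c: "c \<in> Q" for c
  proof -
    have "pairing (D (br (e c) (e i)) (e a)) (e c) p = (\<Sum>x\<in>K. \<kappa> x * b c i x * \<gamma> x a c)"
      unfolding bracket_frame[OF QK[OF c] iK] \<gamma>_def using c QK aK
      by (simp add: D_frame_sum_left pairing_const_sum)
    also have "\<dots> = (\<Sum>x\<in>Q. \<kappa> x * b c i x * \<gamma> x a c) + (\<Sum>j\<in>K - Q. \<kappa> j * b c i j * \<gamma> j a c)"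
      using Q finite_K by (subst add.commute) (rule sum.subset_diff)
    also have "(\<Sum>j\<in>K - Q. \<kappa> j * b c i j * \<gamma> j a c) = (\<Sum>j\<in>K - Q. \<kappa> j * b c i j * b j a c)"
    proof (intro sum.cong refl)
      fix j assume j: "j \<in> K - Q"
      have "\<gamma> j a c = b j a c"
        using mixed_component[OF e_sub[OF j Diff_subset] e_sub[OF a Q] e_sub[OF c Q]] bK[of j a c] j aK QK[OF c]
        by (simp add: \<gamma>_def)
      then show "\<kappa> j * b c i j * \<gamma> j a c = \<kappa> j * b c i j * b j a c" by simp
    qed
    finally show ?thesis .
  qed
  have div': "(\<Sum>c\<in>Q. \<kappa> c * \<gamma> c x c) = d x" if "x \<in> Q" for x
    using fun_cong[OF div[OF that], of p] by (simp add: coef_def sum_fun_apply \<gamma>_def)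
  have "anchor (e i) (\<Sum>c\<in>Q. coef c (D (e c) (e a))) = 0"
    using div[OF a] iK by (simp add: anchor_fun_const)
  then have "(\<Sum>c\<in>Q. (\<lambda>_. \<kappa> c) * anchor (e i) (pairing (D (e c) (e a)) (e c))) = 0"
    using iK aK QK by (simp add: anchor_fun_sum anchor_fun_cmult coef_def)
  from fun_cong[OF this, of p]
  have anchor: "(\<Sum>c\<in>Q. \<kappa> c * anchor (e i) (pairing (D (e c) (e a)) (e c)) p) = 0"
    by (simp add: sum_fun_apply)
  \<comment> \<open>The two products of the commutator have the same trace.\<close>
  have swap: "(\<Sum>c\<in>Q. \<Sum>x\<in>Q. \<kappa> c * (\<kappa> x * b c i x * \<gamma> x a c)) = (\<Sum>c\<in>Q. \<Sum>x\<in>Q. \<kappa> c * (\<kappa> x * b i c x * \<gamma> c a x))"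
  proof (subst sum.swap, intro sum.cong refl)
    fix c x
    have "b x i c = b i c x" using b_skew[of x i c] b_skew[of i x c] by simp
    then show "\<kappa> x * (\<kappa> c * b x i c * \<gamma> c a x) = \<kappa> c * (\<kappa> x * b i c x * \<gamma> c a x)" by simp
  qed
  have "(\<Sum>c\<in>Q. coef c (R (e c) (e i) (e a))) p = (\<Sum>c\<in>Q. \<kappa> c * pairing (R (e c) (e i) (e a)) (e c) p)"
    by (simp add: sum_fun_apply coef_def)
  also have "\<dots> = (\<Sum>c\<in>Q. (\<Sum>x\<in>Q. \<kappa> c * (\<kappa> x * b i a x * \<gamma> c x c))
      - \<kappa> c * anchor (e i) (pairing (D (e c) (e a)) (e c)) p
      + (\<Sum>x\<in>Q. \<kappa> c * (\<kappa> x * b i c x * \<gamma> c a x)) - (\<Sum>x\<in>Q. \<kappa> c * (\<kappa> x * b c i x * \<gamma> x a c))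
      - (\<Sum>j\<in>K - Q. \<kappa> c * (\<kappa> j * b c i j * b j a c)))"
    using QK iK aK
    by (intro sum.cong refl) (simp add: curvature_def pairing_diff pairing_add term1 term2 term3 algebra_simps sum_distrib_left)
  also have "\<dots> = (\<Sum>c\<in>Q. \<Sum>x\<in>Q. \<kappa> c * (\<kappa> x * b i a x * \<gamma> c x c)) - (\<Sum>c\<in>Q. \<Sum>j\<in>K - Q. \<kappa> c * (\<kappa> j * b c i j * b j a c))"
    using anchor swap by (simp add: sum.distrib sum_subtractf)
  also have "(\<Sum>c\<in>Q. \<Sum>x\<in>Q. \<kappa> c * (\<kappa> x * b i a x * \<gamma> c x c)) = (\<Sum>x\<in>Q. \<kappa> x * b i a x * (\<Sum>c\<in>Q. \<kappa> c * \<gamma> c x c))"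
    by (subst sum.swap) (simp add: sum_distrib_left ac_simps)
  also have "\<dots> = (\<Sum>x\<in>Q. \<kappa> x * d x * b i a x)"
    by (intro sum.cong refl) (simp add: div')
  finally show "(\<Sum>c\<in>Q. coef c (R (e c) (e i) (e a))) p = ric Q d i a"
    by (simp add: ric_def mult.assoc)
qed

end

section \<open>Existence of Levi-Civita generalized connections\<close>

lemma anchor_sum: "anchor (\<Sum>i\<in>I. u i) f = (\<Sum>i\<in>I. anchor (u i) f)"
  by (induction I rule: infinite_finite_induct) auto

context orthonormal_courant_algebroid
begin

lemma coef_simps:
  assumes "A \<in> K"
  shows "u \<in> sections G \<Longrightarrow> w \<in> sections G \<Longrightarrow> coef A (u + w) = coef A u + coef A w"
    "f \<in> C_inf G \<Longrightarrow> u \<in> sections G \<Longrightarrow> coef A (smul f u) = f * coef A u"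
    "B \<in> K \<Longrightarrow> coef A (e B) = (\<lambda>_. if A = B then 1 else 0)"
  using assms \<kappa>K[OF assms]
  by (auto simp: coef_def pairing_add pairing_smul orthK distrib_left fun_eq_iff)

text \<open>Metricity is skew-symmetry in the last two indices, the preservation of the subbundles is vanishing for
  \<open>B\<close> and \<open>C\<close> from different ones, and the absence of torsion means that the cyclic sum of the symbols
  is \<open>b\<close>. The symbols whose indices are not all from one subbundle are thereby determined. Inside a subbundle of rank \<open>n\<close>,
  \<open>b / 3\<close> has the required cyclic sum but trace 0; adding \<open>[A = B] \<kappa>\<^sub>A x\<^sub>C - [A = C] \<kappa>\<^sub>A x\<^sub>B\<close>, which has
  cyclic sum 0 and trace \<open>(1 - n) x\<^sub>B\<close>, realizes the prescribed divergence if \<open>n \<noteq> 1\<close>.\<close>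

definition christoffel :: "('k \<Rightarrow> real) \<Rightarrow> 'k \<Rightarrow> 'k \<Rightarrow> 'k \<Rightarrow> real" where
  "christoffel d A B C =
     (if (B \<in> P) = (C \<in> P) then
        if (A \<in> P) = (B \<in> P) then
          b A B C / 3 + (let n = real (card (if B \<in> P then P else N)) in
            (if A = B then \<kappa> A * (d C / (1 - n)) else 0) - (if A = C then \<kappa> A * (d B / (1 - n)) else 0))
        else b A B C
      else 0)"

lemma christoffel_skew: "christoffel d A B C = - christoffel d A C B"
  using b_skew(2)[of A B C] by (auto simp: christoffel_def Let_def)

lemma b_cyclic: "b B C A = b A B C" "b C A B = b A B C"
  using b_skew(1)[of B C A] b_skew(2)[of C B A] b_skew(1)[of C A B] b_skew(2)[of A C B] b_skew(1)[of C B A]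
    b_skew(2)[of B C A] b_skew(1)[of B A C]
  by simp_all

lemma b_zero: "b A B B = 0" "b A A B = 0" "b A B A = 0"
  using b_skew(2)[of A B B] b_skew(1)[of A A B] b_cyclic(1)[of A B A] by simp_all

lemma christoffel_cyclic: "christoffel d A B C + christoffel d B C A + christoffel d C A B = b A B C"
  using b_cyclic[of B C A]
  by (cases "A \<in> P"; cases "B \<in> P"; cases "C \<in> P") (auto simp: christoffel_def Let_def)

lemma christoffel_divergence:
  assumes card: "card P \<noteq> 1" "card N \<noteq> 1" and B: "B \<in> K"
  shows "(\<Sum>A\<in>K. \<kappa> A * christoffel d A B A) = d B"
proof -
  define Q where "Q = (if B \<in> P then P else N)"
  have Q: "Q \<subseteq> K" "B \<in> Q" "finite Q" "card Q \<noteq> 1"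
    using B card PK NK fin by (auto simp: Q_def K_def)
  have n: "1 - real (card Q) \<noteq> 0" using Q(4) by simp
  have other: "christoffel d A B A = 0" if "A \<in> K - Q" for A
    using that disj by (auto simp: christoffel_def Q_def K_def)
  have same: "\<kappa> A * christoffel d A B A = (if A = B then d B / (1 - real (card Q)) else 0) - d B / (1 - real (card Q))"
    if A: "A \<in> Q" for A
  proof -
    have "(A \<in> P) = (B \<in> P)" using A disj B by (auto simp: Q_def K_def)
    moreover have "\<kappa> A * (\<kappa> A * x) = x" for x
      using \<kappa>K[of A] A Q(1) by (metis mult.assoc mult_1 subsetD)
    ultimately show ?thesis
      by (simp add: christoffel_def Let_def b_zero Q_def[symmetric] right_diff_distrib)
  qed
  have "(\<Sum>A\<in>K. \<kappa> A * christoffel d A B A) = (\<Sum>A\<in>Q. \<kappa> A * christoffel d A B A)"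
    using Q(1) finite_K other by (intro sum.mono_neutral_right) auto
  also have "\<dots> = d B / (1 - real (card Q)) - real (card Q) * (d B / (1 - real (card Q)))"
    using Q by (simp add: same sum_subtractf)
  also have "\<dots> = (1 - real (card Q)) * (d B / (1 - real (card Q)))"
    by (simp only: left_diff_distrib mult_1)
  also have "\<dots> = d B" using n by simp
  finally show ?thesis .
qed

text \<open>\<open>connection d\<close> is the flat connection of the frame plus the tensor with the components
  \<open>christoffel d\<close>; the latter is \<open>symbol_part d C\<close>, up to the sign \<open>\<kappa> C\<close>.\<close>

definition symbol_part :: "('k \<Rightarrow> real) \<Rightarrow> 'k \<Rightarrow> 'g sec \<Rightarrow> 'g sec \<Rightarrow> 'g \<Rightarrow> real" where
  "symbol_part d C u w = (\<Sum>A\<in>K. \<Sum>B\<in>K. (\<lambda>_. christoffel d A B C) * (coef A u * coef B w))"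

definition connection :: "('k \<Rightarrow> real) \<Rightarrow> 'g conn" where
  "connection d u w = (\<Sum>C\<in>K. smul ((\<lambda>_. \<kappa> C) * (anchor u (pairing w (e C)) + symbol_part d C u w)) (e C))"

lemma symbol_part_C_inf [simp]:
  "u \<in> sections G \<Longrightarrow> w \<in> sections G \<Longrightarrow> symbol_part d C u w \<in> C_inf G"
  unfolding symbol_part_def by (intro C_inf_sum C_inf_mult) auto

lemma symbol_part_add_left:
  "u \<in> sections G \<Longrightarrow> u' \<in> sections G \<Longrightarrow> symbol_part d C (u + u') w = symbol_part d C u w + symbol_part d C u' w"
  unfolding symbol_part_def sum.distrib[symmetric]
  by (intro sum.cong refl) (simp add: coef_simps distrib_left distrib_right)

lemma symbol_part_add_right:
  "w \<in> sections G \<Longrightarrow> w' \<in> sections G \<Longrightarrow> symbol_part d C u (w + w') = symbol_part d C u w + symbol_part d C u w'"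
  unfolding symbol_part_def sum.distrib[symmetric]
  by (intro sum.cong refl) (simp add: coef_simps distrib_left distrib_right)

lemma symbol_part_smul_left:
  "f \<in> C_inf G \<Longrightarrow> u \<in> sections G \<Longrightarrow> symbol_part d C (smul f u) w = f * symbol_part d C u w"
  unfolding symbol_part_def sum_distrib_left
  by (intro sum.cong refl) (simp add: coef_simps ac_simps)

lemma symbol_part_smul_right:
  "f \<in> C_inf G \<Longrightarrow> w \<in> sections G \<Longrightarrow> symbol_part d C u (smul f w) = f * symbol_part d C u w"
  unfolding symbol_part_def sum_distrib_left
  by (intro sum.cong refl) (simp add: coef_simps ac_simps)

lemma symbol_part_frame_right:
  assumes "u \<in> sections G" "B \<in> K"
  shows "symbol_part d C u (e B) = (\<Sum>A\<in>K. (\<lambda>_. christoffel d A B C) * coef A u)"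
proof -
  have "(\<Sum>B'\<in>K. (\<lambda>_. christoffel d A B' C) * (coef A u * coef B' (e B)))
      = (\<lambda>_. christoffel d A B C) * coef A u" for A
  proof -
    have "(\<Sum>B'\<in>K. (\<lambda>_. christoffel d A B' C) * (coef A u * coef B' (e B)))
        = (\<Sum>B'\<in>K. if B' = B then (\<lambda>_. christoffel d A B C) * coef A u else 0)"
      using assms by (intro sum.cong) (auto simp: coef_simps fun_eq_iff)
    then show ?thesis using assms finite_K by simp
  qed
  then show ?thesis by (simp add: symbol_part_def)
qed

lemma symbol_part_frame:
  assumes "A \<in> K" "B \<in> K"
  shows "symbol_part d C (e A) (e B) = (\<lambda>_. christoffel d A B C)"
proof -
  have "symbol_part d C (e A) (e B) = (\<Sum>A'\<in>K. (\<lambda>_. christoffel d A' B C) * coef A' (e A))"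
    using assms by (simp add: symbol_part_frame_right)
  also have "\<dots> = (\<Sum>A'\<in>K. if A' = A then (\<lambda>_. christoffel d A B C) else 0)"
    using assms by (intro sum.cong refl) (simp add: coef_simps fun_eq_iff)
  finally show ?thesis using assms finite_K by simp
qed

lemma connection_sections:
  "u \<in> sections G \<Longrightarrow> w \<in> sections G \<Longrightarrow> connection d u w \<in> sections G"
  unfolding connection_def by (intro frame_sum_sections) auto

lemma pairing_connection:
  assumes "u \<in> sections G" "w \<in> sections G" "C \<in> K"
  shows "pairing (connection d u w) (e C) = anchor u (pairing w (e C)) + symbol_part d C u w"
proof -
  have "pairing (connection d u w) (e C)
      = (\<lambda>_. \<kappa> C) * ((\<lambda>_. \<kappa> C) * (anchor u (pairing w (e C)) + symbol_part d C u w))"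
    unfolding connection_def using assms by (subst pairing_frame_sum) auto
  then show ?thesis
    using \<kappa>K[OF assms(3)] by (simp add: fun_eq_iff mult.assoc[symmetric])
qed

lemma connection_add_left:
  assumes s: "u \<in> sections G" "u' \<in> sections G" "w \<in> sections G"
  shows "connection d (u + u') w = connection d u w + connection d u' w"
  by (rule sections_eqI)
    (use s in \<open>simp_all add: connection_sections pairing_connection pairing_add symbol_part_add_left\<close>)

lemma connection_smul_left:
  assumes s: "f \<in> C_inf G" "u \<in> sections G" "w \<in> sections G"
  shows "connection d (smul f u) w = smul f (connection d u w)"
  by (rule sections_eqI)
    (use s in \<open>simp_all add: connection_sections pairing_connection pairing_smul symbol_part_smul_left fmul_eval
      distrib_left\<close>)

lemma connection_add_right:
  assumes s: "u \<in> sections G" "w \<in> sections G" "w' \<in> sections G"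
  shows "connection d u (w + w') = connection d u w + connection d u w'"
  by (rule sections_eqI)
    (use s in \<open>simp_all add: connection_sections pairing_connection pairing_add symbol_part_add_right
      anchor_fun_add\<close>)

lemma connection_smul_right:
  assumes s: "f \<in> C_inf G" "u \<in> sections G" "w \<in> sections G"
  shows "connection d u (smul f w) = smul (anchor u f) w + smul f (connection d u w)"
  by (rule sections_eqI)
    (use s in \<open>simp_all add: connection_sections pairing_connection pairing_add pairing_smul
      symbol_part_smul_right anchor_fun_mult distrib_left\<close>)

lemmas connection_linear = connection_add_left connection_smul_left connection_add_right connection_smul_right

text \<open>The defect \<open>q\<close> is symmetric and tensorial, and on the frame it vanishes by \<open>christoffel_skew\<close>.\<close>

lemma connection_metric:
  assumes u: "u \<in> sections G" and w: "w \<in> sections G" "w' \<in> sections G"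
  shows "anchor u (pairing w w') = pairing (connection d u w) w' + pairing w (connection d u w')"
proof -
  define q where "q w w' = pairing (connection d u w) w' + pairing w (connection d u w') - anchor u (pairing w w')" for w w'
  note rules = connection_sections connection_linear anchor_fun_add anchor_fun_mult pairing_add pairing_smul
  have sym: "q w w' = q w' w" for w w'
    by (simp add: q_def pairing_commute[of w] pairing_commute[of _ w'] add.commute)
  have q: "tensorial (sub K) (q w)" if w: "w \<in> sections G" for w
    unfolding sub_K
  proof (rule tensorialI)
    fix x x' assume "x \<in> sections G" "x' \<in> sections G"
    then show "q w (x + x') = q w x + q w x'"
      using u w unfolding q_def by (simp add: rules)
  next
    fix f x assume "f \<in> C_inf G" "x \<in> sections G"
    then show "q w (smul f x) = f * q w x"
      using u w unfolding q_def by (simp add: rules algebra_simps)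
  qed
  have "q (e A) (e B) = 0" if AB: "A \<in> K" "B \<in> K" for A B
  proof -
    have "symbol_part d B u (e A) + symbol_part d A u (e B) = 0"
    proof -
      have "symbol_part d B u (e A) p + symbol_part d A u (e B) p = 0" for p
        using christoffel_skew[of d _ A B] AB u
        by (simp add: symbol_part_frame_right sum_fun_apply sum.distrib[symmetric] distrib_right[symmetric])
      then show ?thesis by (simp add: fun_eq_iff)
    qed
    then show ?thesis
      using u AB unfolding q_def
      by (simp add: pairing_commute[of "e A" "connection d u (e B)"] pairing_connection orthK anchor_fun_const)
  qed
  then have "q x (e B) = 0" if "B \<in> K" "x \<in> sections G" for B x
    using tensorial_vanishing[OF q[of "e B"] subset_refl, of x] that by (simp add: sub_K sym[of _ "e B"])
  then have "q w w' = 0"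
    using tensorial_vanishing[OF q[OF w(1)] subset_refl, of w'] w by (simp add: sub_K)
  then show ?thesis by (simp add: q_def)
qed

lemma gen_connection_connection: "gen_connection G (connection d)"
  unfolding gen_connection_def
proof (intro conjI ballI allI)
  fix c :: real and u w assume s: "u \<in> sections G" "w \<in> sections G"
  have "connection d u (smul (\<lambda>_. c) w) = smul (anchor u (\<lambda>_. c)) w + smul (\<lambda>_. c) (connection d u w)"
    by (rule connection_smul_right[OF C_inf_const s])
  then show "connection d u (smul (\<lambda>_. c) w) = smul (\<lambda>_. c) (connection d u w)"
    using s by (simp add: anchor_fun_const scalar_action.sc_0[OF scalar_action_smul])
qed (rule connection_sections connection_linear connection_metric; assumption)+

text \<open>The torsion is a tensor and is given on the frame by the cyclic sum of the Christoffel symbols. As these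
  have no components from one subbundle to the other, \<open>E\<^sub>-\<close> is preserved.\<close>

lemma levi_civita_connection:
  "levi_civita G H F g (connection d)"
proof -
  interpret D: generalized_connection G I v H F g P N e \<kappa> b "connection d"
    by unfold_locales (rule gen_connection_connection)
  have frame: "torsion G H F (connection d) (e A) (e B) (e C) = 0" if "A \<in> K" "B \<in> K" "C \<in> K" for A B C
  proof -
    have "christoffel d A B C - christoffel d B A C - b A B C + christoffel d C A B = 0"
      using christoffel_cyclic[of d A B C] christoffel_skew[of d B A C] by simp
    then show ?thesis
      using that
      by (simp add: torsion_def pairing_diff connection_sections pairing_commute[of "e B"] pairing_connection
          orthK anchor_fun_const symbol_part_frame bK fun_eq_iff)
  qed
  have K: "u \<in> sub K \<longleftrightarrow> u \<in> sections G" for u by (simp add: sub_K)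
  have 1: "torsion G H F (connection d) (e A) (e B) x = 0" if "A \<in> K" "B \<in> K" "x \<in> sections G" for A B x
    by (rule tensorial_vanishing[OF D.torsion_tensorial(3) subset_refl]) (use that frame K in auto)
  have 2: "torsion G H F (connection d) (e A) w x = 0" if "A \<in> K" "w \<in> sections G" "x \<in> sections G" for A w x
    by (rule tensorial_vanishing[OF D.torsion_tensorial(2) subset_refl]) (use that 1 K in auto)
  have 3: "torsion G H F (connection d) u w x = 0" if "u \<in> sections G" "w \<in> sections G" "x \<in> sections G" for u w x
    by (rule tensorial_vanishing[OF D.torsion_tensorial(1) subset_refl]) (use that 2 K in auto)
  have pres: "connection d u w \<in> sub N" if u: "u \<in> sections G" and w: "w \<in> sub N" for u w
  proof -
    have "pairing (connection d u w) (e C) = 0" if C: "C \<in> P" for C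
    proof (rule tensorial_vanishing[OF _ NK _ w])
      have CK: "C \<in> K" using C PK by blast
      show "tensorial (sub N) (\<lambda>w. pairing (connection d u w) (e C))"
      proof (rule tensorialI)
        fix x x' assume "x \<in> sub N" "x' \<in> sub N"
        then have "x \<in> sections G" "x' \<in> sections G" using sub_sections by auto
        then show "pairing (connection d u (x + x')) (e C) = pairing (connection d u x) (e C) + pairing (connection d u x') (e C)"
          using u CK by (simp add: connection_linear connection_sections pairing_add)
      next
        fix f x assume f: "f \<in> C_inf G" and x: "x \<in> sub N"
        have "pairing x (e C) = 0" using x C by (simp add: sub_def K_diff)
        then show "pairing (connection d u (smul f x)) (e C) = f * pairing (connection d u x) (e C)"
          using f sub_sections[OF x] u CK
          by (simp add: connection_linear connection_sections pairing_add pairing_smul)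
      qed
      fix A assume A: "A \<in> N"
      then have "A \<noteq> C" "A \<in> K" "christoffel d B A C = 0" for B
        using C disj by (auto simp: christoffel_def K_def)
      then show "pairing (connection d u (e A)) (e C) = 0"
        using CK u by (simp add: pairing_connection orthK anchor_fun_const symbol_part_frame_right fun_eq_iff
            sum_fun_apply)
    qed
    then show ?thesis
      using connection_sections[OF u sub_sections[OF w]] by (simp add: sub_def K_diff)
  qed
  show ?thesis
    unfolding levi_civita_def E_minus_sub using gen_connection_connection 3 pres by blast
qed

lemma div_of_eq:
  assumes D: "gen_connection G D" and u: "u \<in> sections G"
  shows "div_of G D u = (\<Sum>A\<in>K. coef A (D (e A) u))"
proof -
  interpret D: generalized_connection G I v H F g P N e \<kappa> b D
    by unfold_locales (rule D)
  show ?thesis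
    unfolding div_of_def sub_K[symmetric]
    by (rule trace_sub[OF subset_refl]) (use u in \<open>simp_all add: sub_K D.D_add_left D.D_smul_left\<close>)
qed

text \<open>Two divergence operators differ by a tensor, so it suffices to compare them on the frame.\<close>

lemma div_of_connection:
  assumes card: "card P \<noteq> 1" "card N \<noteq> 1" and \<delta>: "divergence_op G \<delta>" "\<And>A. A \<in> K \<Longrightarrow> \<delta> (e A) = (\<lambda>_. d A)"
    and u: "u \<in> sections G"
  shows "div_of G (connection d) u = \<delta> u"
proof -
  interpret D: generalized_connection G I v H F g P N e \<kappa> b "connection d"
    by unfold_locales (rule gen_connection_connection)
  note add = \<delta>(1)[unfolded divergence_op_def, THEN conjunct2, THEN conjunct1, rule_format]
  note smul = \<delta>(1)[unfolded divergence_op_def, THEN conjunct2, THEN conjunct2, rule_format]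
  let ?t = "\<lambda>u. (\<Sum>A\<in>K. coef A (connection d (e A) u))"
  have "tensorial (sub K) (\<lambda>u. ?t u - \<delta> u)" unfolding sub_K
  proof (rule tensorialI)
    fix x x' assume s: "x \<in> sections G" "x' \<in> sections G"
    then have "?t (x + x') = ?t x + ?t x'"
      by (simp add: D.D_add_right coef_simps sum.distrib)
    then show "?t (x + x') - \<delta> (x + x') = (?t x - \<delta> x) + (?t x' - \<delta> x')"
      using add[OF s] by simp
  next
    fix f x assume f: "f \<in> C_inf G" and x: "x \<in> sections G"
    have "anchor x f = anchor (\<Sum>A\<in>K. smul (coef A x) (e A)) f"
      using frame_expansion[of x K] x by (simp add: sub_K)
    also have "\<dots> = (\<Sum>A\<in>K. anchor (e A) f * coef A x)"
      by (simp add: anchor_sum fmul_eval mult.commute)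
    finally have "anchor x f = (\<Sum>A\<in>K. anchor (e A) f * coef A x)" .
    moreover have "?t (smul f x) = (\<Sum>A\<in>K. anchor (e A) f * coef A x) + f * ?t x"
      using f x by (simp add: D.D_smul_right coef_simps sum.distrib sum_distrib_left)
    ultimately show "?t (smul f x) - \<delta> (smul f x) = f * (?t x - \<delta> x)"
      using smul[OF f x] by (simp add: right_diff_distrib)
  qed
  moreover have "?t (e B) - \<delta> (e B) = 0" if B: "B \<in> K" for B
  proof -
    have "coef A (connection d (e A) (e B)) = (\<lambda>_. \<kappa> A * christoffel d A B A)" if "A \<in> K" for A
      using that B by (simp add: coef_def pairing_connection orthK anchor_fun_const symbol_part_frame fun_eq_iff)
    then have "?t (e B) = \<delta> (e B)"
      using christoffel_divergence[OF card B, of d] \<delta>(2)[OF B] by (simp add: fun_eq_iff sum_fun_apply)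
    then show ?thesis by simp
  qed
  ultimately have "?t u - \<delta> u = 0"
    using tensorial_vanishing[of K "\<lambda>u. ?t u - \<delta> u" u] u by (simp add: sub_K)
  then show ?thesis using div_of_eq[OF gen_connection_connection u] by simp
qed

text \<open>The existential quantifier over connections in the definition disappears: some Levi-Civita connection
  with divergence \<open>\<delta>\<close> exists, and the Ricci tensors are given by the same formula for all of them.\<close>

theorem gen_einstein_iff:
  assumes card: "card P \<noteq> 1" "card N \<noteq> 1" and \<delta>: "divergence_op G \<delta>" "\<And>A. A \<in> K \<Longrightarrow> \<delta> (e A) = (\<lambda>_. d A)"
  shows "gen_einstein G H F g \<delta> \<longleftrightarrow> (\<forall>i\<in>N. \<forall>a\<in>P. ric P d i a = 0 \<and> ric N d a i = 0)"
proof -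
  have key: "((\<forall>u\<in>E_minus G g. \<forall>v\<in>E_plus G g. ric_plus G H F g D u v = 0) \<and>
        (\<forall>u\<in>E_plus G g. \<forall>v\<in>E_minus G g. ric_minus G H F g D u v = 0)) \<longleftrightarrow>
      (\<forall>i\<in>N. \<forall>a\<in>P. ric P d i a = 0 \<and> ric N d a i = 0)"
    if D: "levi_civita G H F g D" and div: "\<forall>u\<in>sections G. div_of G D u = \<delta> u" for D
  proof -
    interpret D: generalized_connection G I v H F g P N e \<kappa> b D
      using D by unfold_locales (simp add: levi_civita_def)
    have N: "D u w \<in> sub N" if "u \<in> sections G" "w \<in> sub N" for u w
      using D that unfolding levi_civita_def E_minus_sub by blast
    have P: "D u w \<in> sub P" if u: "u \<in> sections G" and w: "w \<in> sub P" for u w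
    proof -
      have "pairing (D u w) (e j) = 0" if j: "j \<in> N" for j
      proof -
        have eN: "e j \<in> sub N" "e j \<in> sections G" using j e_sub[OF j NK] sub_sections by auto
        have "pairing w (e j) = 0" "pairing w (D u (e j)) = 0"
          using sub_orthogonal[of w N] w eN N[OF u eN(1)] NK by (simp_all add: K_diff)
        then show ?thesis
          using D.D_metric[OF u sub_sections[OF w] eN(2)] u by (simp add: anchor_fun_zero)
      qed
      then show ?thesis using D.D_sections[OF u sub_sections[OF w]] by (simp add: sub_def K_diff)
    qed
    have T: "torsion G H F D u w x = 0" if "u \<in> sections G" "w \<in> sections G" "x \<in> sections G" for u w x
      using D that unfolding levi_civita_def by blast
    interpret P: split_connection G I v H F g P N e \<kappa> b D P
      by unfold_locales (use PK K_diff P N T in auto)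
    interpret N: split_connection G I v H F g P N e \<kappa> b D N
      by unfold_locales (use NK K_diff P N T in auto)
    have div': "(\<Sum>c\<in>Q. coef c (D (e c) (e a))) = (\<lambda>_. d a)"
      if Q: "Q \<subseteq> K" "\<And>u w. u \<in> sections G \<Longrightarrow> w \<in> sub Q \<Longrightarrow> D u w \<in> sub Q" and a: "a \<in> Q" for Q a
    proof -
      have aK: "a \<in> K" using Q a by blast
      have "coef c (D (e c) (e a)) = 0" if "c \<in> K - Q" for c
        using Q(2)[of "e c" "e a"] e_sub[OF a Q(1)] that by (simp add: coef_def sub_def)
      then have "(\<Sum>c\<in>Q. coef c (D (e c) (e a))) = (\<Sum>c\<in>K. coef c (D (e c) (e a)))"
        using Q(1) finite_K by (intro sum.mono_neutral_left) auto
      then show ?thesis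
        using div_of_eq[OF D.D, of "e a"] div \<delta>(2)[OF aK] aK by simp
    qed
    have c: "(\<lambda>_ :: 'g. r) = 0 \<longleftrightarrow> r = 0" for r :: real by (simp add: fun_eq_iff)
    have "(\<forall>u\<in>E_minus G g. \<forall>v\<in>E_plus G g. ric_plus G H F g D u v = 0) \<longleftrightarrow> (\<forall>i\<in>N. \<forall>a\<in>P. ric P d i a = 0)"
      using P.curvature_trace_vanishing_iff P.curvature_trace_frame[OF div'[OF PK P]]
      by (simp add: ric_plus_def E_minus_sub E_plus_sub K_diff c)
    moreover have "(\<forall>u\<in>E_plus G g. \<forall>v\<in>E_minus G g. ric_minus G H F g D u v = 0) \<longleftrightarrow> (\<forall>a\<in>P. \<forall>i\<in>N. ric N d a i = 0)"
      using N.curvature_trace_vanishing_iff N.curvature_trace_frame[OF div'[OF NK N]]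
      by (simp add: ric_minus_def E_minus_sub E_plus_sub K_diff c)
    ultimately show ?thesis by blast
  qed
  show ?thesis
  proof
    assume "gen_einstein G H F g \<delta>"
    then obtain D where "levi_civita G H F g D" "\<forall>u\<in>sections G. div_of G D u = \<delta> u"
      "(\<forall>u\<in>E_minus G g. \<forall>v\<in>E_plus G g. ric_plus G H F g D u v = 0) \<and>
        (\<forall>u\<in>E_plus G g. \<forall>v\<in>E_minus G g. ric_minus G H F g D u v = 0)"
      unfolding gen_einstein_def by blast
    then show "\<forall>i\<in>N. \<forall>a\<in>P. ric P d i a = 0 \<and> ric N d a i = 0" using key[of D] by simp
  next
    assume r: "\<forall>i\<in>N. \<forall>a\<in>P. ric P d i a = 0 \<and> ric N d a i = 0"
    have div: "\<forall>u\<in>sections G. div_of G (connection d) u = \<delta> u"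
      using div_of_connection[OF card \<delta>] by blast
    show "gen_einstein G H F g \<delta>"
      unfolding gen_einstein_def
      using levi_civita_connection div key[OF levi_civita_connection div, THEN iffD2, OF r] by blast
  qed
qed

end

section \<open>Structure constants in dimension three\<close>

text \<open>The alternating symbol on the indices \<open>1, 2, 3\<close>, where the Vandermonde product is \<open>0\<close> or \<open>\<plusminus> 2\<close>,
  extended by zero to the index \<open>0\<close>.\<close>

definition alt3 :: "nat \<Rightarrow> nat \<Rightarrow> nat \<Rightarrow> real" where
  "alt3 i j k = (if i = 0 \<or> j = 0 \<or> k = 0 then 0
     else (real i - real j) * (real j - real k) * (real k - real i) / 2)"

lemma alt3_skew: "alt3 j i k = - alt3 i j k" "alt3 i k j = - alt3 i j k"
  by (simp_all add: alt3_def field_simps)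

text \<open>The basis section \<open>e A\<close> is \<open>(v i, s g(v i), l)\<close> for the following \<open>i\<close>, \<open>s\<close>, \<open>l\<close>, where
  \<open>v 0\<close> stands for the zero field.\<close>

definition pos :: "nat \<Rightarrow> nat" where "pos A = (if A \<le> 3 then A else A - 3)"
definition side :: "nat \<Rightarrow> real" where "side A = (if A \<le> 3 then 1 else - 1)"
definition unit_part :: "nat \<Rightarrow> real" where "unit_part A = (if A = 0 then 1 else 0)"

text \<open>The constants \<open>g([v i, v j], v k)\<close> and \<open>F(v i, v j)\<close>.\<close>

definition c_const :: "(nat \<Rightarrow> real) \<Rightarrow> (nat \<Rightarrow> nat \<Rightarrow> real) \<Rightarrow> nat \<Rightarrow> nat \<Rightarrow> nat \<Rightarrow> real" where
  "c_const \<epsilon> L i j k = (if k = 0 then 0 else \<epsilon> k * (\<Sum>l\<in>{1..3}. alt3 i j l * \<epsilon> l * L k l))"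

definition f_const :: "(nat \<Rightarrow> nat \<Rightarrow> real) \<Rightarrow> nat \<Rightarrow> nat \<Rightarrow> real" where
  "f_const f i j = alt3 i j 1 * f 2 3 - alt3 i j 2 * f 1 3 + alt3 i j 3 * f 1 2"

definition metric_const :: "(nat \<Rightarrow> real) \<Rightarrow> nat \<Rightarrow> real" where
  "metric_const \<epsilon> A = (if A = 0 then 1 else side A * \<epsilon> (pos A))"

text \<open>The structure constants \<open>\<langle>[e A, e B], e C\<rangle>\<close>, as computed in \<open>pairing_e_basis_dorfman\<close>. The formula is
  written without case distinction between \<open>E\<^sub>+\<close> and \<open>E\<^sub>-\<close>, which makes the skew-symmetry visible.\<close>

definition courant_const :: "(nat \<Rightarrow> real) \<Rightarrow> (nat \<Rightarrow> nat \<Rightarrow> real) \<Rightarrow> real \<Rightarrow> (nat \<Rightarrow> nat \<Rightarrow> real) \<Rightarrow>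
    nat \<Rightarrow> nat \<Rightarrow> nat \<Rightarrow> real" where
  "courant_const \<epsilon> L h f A B C = (let i = pos A; j = pos B; k = pos C in
     (side C * c_const \<epsilon> L i j k + side A * c_const \<epsilon> L j k i + side B * c_const \<epsilon> L k i j - h * alt3 i j k) / 2
     + unit_part A * f_const f j k + unit_part B * f_const f k i + unit_part C * f_const f i j)"

lemma f_const_skew: "f_const f j i = - f_const f i j"
  by (simp add: f_const_def alt3_skew(1)[of j i])

lemma c_const_skew: "c_const \<epsilon> L j i k = - c_const \<epsilon> L i j k"
  by (simp add: c_const_def alt3_skew(1)[of j i] sum_negf)

lemma courant_const_skew:
  "courant_const \<epsilon> L h f A B C = - courant_const \<epsilon> L h f B A C"
  "courant_const \<epsilon> L h f A B C = - courant_const \<epsilon> L h f A C B"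
proof -
  show "courant_const \<epsilon> L h f A B C = - courant_const \<epsilon> L h f B A C"
    using c_const_skew[of \<epsilon> L "pos B" "pos A" "pos C"] c_const_skew[of \<epsilon> L "pos C" "pos B" "pos A"]
      c_const_skew[of \<epsilon> L "pos C" "pos A" "pos B"] f_const_skew[of f "pos B" "pos A"]
      f_const_skew[of f "pos C" "pos B"] f_const_skew[of f "pos C" "pos A"] alt3_skew(1)[of "pos B" "pos A" "pos C"]
    by (simp add: courant_const_def Let_def field_simps)
  show "courant_const \<epsilon> L h f A B C = - courant_const \<epsilon> L h f A C B"
    using c_const_skew[of \<epsilon> L "pos B" "pos A" "pos C"] c_const_skew[of \<epsilon> L "pos C" "pos B" "pos A"]
      c_const_skew[of \<epsilon> L "pos C" "pos A" "pos B"] f_const_skew[of f "pos B" "pos A"]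
      f_const_skew[of f "pos C" "pos B"] f_const_skew[of f "pos C" "pos A"] alt3_skew(2)[of "pos A" "pos C" "pos B"]
    by (simp add: courant_const_def Let_def field_simps)
qed

context courant_algebroid
begin

text \<open>All derivatives of functions in the bracket drop out, since the functions are constant.\<close>

lemma pairing_dorfman_constant:
  assumes X: "X \<in> vfields G" "Y \<in> vfields G" "Z \<in> vfields G"
    and const: "\<eta> X = (\<lambda>_. c1)" "\<eta> Z = (\<lambda>_. c2)" "\<xi> Y = (\<lambda>_. c3)" "\<xi> Z = (\<lambda>_. c4)"
  shows "pairing (br (X, \<xi>, \<lambda>_. l) (Y, \<eta>, \<lambda>_. m)) (Z, \<zeta>, \<lambda>_. n) p =
    (\<zeta> (lie_bracket X Y) p + \<xi> (lie_bracket Y Z) p - \<eta> (lie_bracket X Z) p + H Y X Z p) / 2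
    + l * F Y Z p - m * F X Z p + n * F X Y p"
  using X const
  by (simp add: dorfman_def pairing_def lie_deriv_def d_one_def d_fun_def fmul_eval vfields_const field_simps)

end

lemma nat_atMost_3_cases:
  assumes "i \<le> (3::nat)" obtains "i = 0" | "i = 1" | "i = 2" | "i = 3"
  using assms by linarith

lemma alt3_zero [simp]: "alt3 0 j k = 0" "alt3 i 0 k = 0" "alt3 i i k = 0"
  by (auto simp: alt3_def)

lemma alternating_eq_alt3:
  fixes T :: "nat \<Rightarrow> nat \<Rightarrow> nat \<Rightarrow> real"
  assumes s1: "\<And>i j k. i \<le> 3 \<Longrightarrow> j \<le> 3 \<Longrightarrow> k \<le> 3 \<Longrightarrow> T i j k = - T j i k"
    and s2: "\<And>i j k. i \<le> 3 \<Longrightarrow> j \<le> 3 \<Longrightarrow> k \<le> 3 \<Longrightarrow> T i j k = - T i k j"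
    and z: "\<And>j k. j \<le> 3 \<Longrightarrow> k \<le> 3 \<Longrightarrow> T 0 j k = 0"
    and le: "i \<le> 3" "j \<le> 3" "k \<le> 3"
  shows "T i j k = T 1 2 3 * alt3 i j k"
proof -
  have 213: "T 2 1 3 = - T 1 2 3" using s1[of 2 1 3] by simp
  have 132: "T 1 3 2 = - T 1 2 3" using s2[of 1 3 2] by simp
  have 231: "T 2 3 1 = T 1 2 3" using s2[of 2 3 1] 213 by simp
  have 312: "T 3 1 2 = T 1 2 3" using s1[of 3 1 2] 132 by simp
  have 321: "T 3 2 1 = - T 1 2 3" using s2[of 3 2 1] 312 by simp
  have d1: "T i i k = 0" if "i \<le> 3" "k \<le> 3" for i k using s1[OF that(1,1,2)] by simp
  have d2: "T i k k = 0" if "i \<le> 3" "k \<le> 3" for i k using s2[OF that(1,2,2)] by simp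
  have d3: "T i k i = 0" if "i \<le> 3" "k \<le> 3" for i k using s2[OF that(1,2,1)] d1[OF that] by simp
  have z1: "T 0 j k = 0" if "j \<le> 3" "k \<le> 3" for j k using z[OF that] .
  have z2: "T j 0 k = 0" if "j \<le> 3" "k \<le> 3" for j k using s1[of j 0 k] z1[OF that] that by simp
  have z3: "T j k 0 = 0" if "j \<le> 3" "k \<le> 3" for j k using s2[of j k 0] z2[OF that] that by simp
  show ?thesis
    using le
    by (cases rule: nat_atMost_3_cases[OF le(1)]; cases rule: nat_atMost_3_cases[OF le(2)];
        cases rule: nat_atMost_3_cases[OF le(3)])
      (simp_all add: 213 132 231 312 321 d1 d2 d3 z1 z2 z3 alt3_def del: One_nat_def)
qed

locale orthonormal_frame_3 = courant_algebroid G "{1..3::nat}" v H F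
  for G :: "('g::topological_space, 'e::euclidean_space) lie_struct" and v H F +
  fixes g :: "'g form2" and \<epsilon> :: "nat \<Rightarrow> real" and L :: "nat \<Rightarrow> nat \<Rightarrow> real" and h :: real
    and f :: "nat \<Rightarrow> nat \<Rightarrow> real"
  assumes g_one_forms [simp]: "X \<in> vfields G \<Longrightarrow> g X \<in> one_forms G"
    and g_sym: "X \<in> vfields G \<Longrightarrow> Y \<in> vfields G \<Longrightarrow> g X Y = g Y X"
    and orthonormal: "a \<in> {1..3} \<Longrightarrow> c \<in> {1..3} \<Longrightarrow> g (v a) (v c) = (\<lambda>_. if a = c then \<epsilon> a else 0)"
    and \<epsilon>_sq: "a \<in> {1..3} \<Longrightarrow> \<epsilon> a * \<epsilon> a = 1"
    and brackets: "lie_bracket (v 1) (v 2) = cscale (\<epsilon> 3) (apply_mat L v 3)"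
      "lie_bracket (v 2) (v 3) = cscale (\<epsilon> 1) (apply_mat L v 1)"
      "lie_bracket (v 3) (v 1) = cscale (\<epsilon> 2) (apply_mat L v 2)"
    and H_123: "H (v 1) (v 2) (v 3) = (\<lambda>_. h)"
    and F_frame: "a \<in> {1..3} \<Longrightarrow> c \<in> {1..3} \<Longrightarrow> F (v a) (v c) = (\<lambda>_. f a c)"
begin

definition V :: "nat \<Rightarrow> 'g vf" where "V i = (if i = 0 then 0 else v i)"

lemma V_vfields [simp]: "i \<le> 3 \<Longrightarrow> V i \<in> vfields G"
  by (simp add: V_def)

lemma g_0: "g 0 = 0"
proof
  fix X show "g 0 X = 0 X"
    using g_sym[of 0 X] one_forms_0[of "g X"] one_forms_outside[of "g 0" X] by (cases "X \<in> vfields G") simp_all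
qed

lemma F_0: "F 0 = 0"
proof -
  have "F (0 + 0) = F 0 + F 0" by (rule two_forms_add[OF F]) simp_all
  then show ?thesis by simp
qed

lemma H_0: "H 0 X Y = 0" if "X \<in> vfields G" "Y \<in> vfields G"
  using three_forms_add[OF H vfields_0 vfields_0 that] by simp

lemma metric_V: "i \<le> 3 \<Longrightarrow> j \<le> 3 \<Longrightarrow> g (V i) (V j) = (\<lambda>_. if i = j \<and> i \<noteq> 0 then \<epsilon> i else 0)"
  by (auto simp: V_def g_0 one_forms_0 orthonormal fun_eq_iff)

lemma e_basis_V: "A \<le> 6 \<Longrightarrow>
  e_basis g v A = (V (pos A), fmul (\<lambda>_. side A) (g (V (pos A))), \<lambda>_. unit_part A)"
  by (auto simp: e_basis_def V_def pos_def side_def unit_part_def g_0 fun_eq_iff)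

lemma F_V: "i \<le> 3 \<Longrightarrow> j \<le> 3 \<Longrightarrow> F (V i) (V j) = (\<lambda>_. f_const f i j)"
proof -
  have f: "f a c = - f c a" if "a \<in> {1..3}" "c \<in> {1..3}" for a c
    using two_forms_skew[OF F, of "v a" "v c"] F_frame that by (simp add: fun_eq_iff)
  have f0: "f a a = 0" if "a \<in> {1..3}" for a using f[OF that that] by simp
  have one: "F X 0 = 0" for X using one_forms_0[OF two_forms_one_forms[OF F]] .
  show "F (V i) (V j) = (\<lambda>_. f_const f i j)" if "i \<le> 3" "j \<le> 3"
    using that one f[of 2 1] f[of 3 1] f[of 3 2] f0
    by (cases rule: nat_atMost_3_cases[OF that(1)]; cases rule: nat_atMost_3_cases[OF that(2)])
      (simp_all add: V_def F_0 F_frame f_const_def alt3_def fun_eq_iff)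
qed

lemma H_V:
  assumes "i \<le> 3" "j \<le> 3" "k \<le> 3"
  shows "H (V i) (V j) (V k) = (\<lambda>_. h * alt3 i j k)"
proof
  fix p
  have "H (V i) (V j) (V k) p = H (V 1) (V 2) (V 3) p * alt3 i j k"
  proof (rule alternating_eq_alt3[OF _ _ _ assms, where T = "\<lambda>i j k. H (V i) (V j) (V k) p"])
    fix i j k :: nat assume le: "i \<le> 3" "j \<le> 3" "k \<le> 3"
    show "H (V i) (V j) (V k) p = - H (V j) (V i) (V k) p"
      using fun_cong[OF three_forms_skew[OF H V_vfields[OF le(1)] V_vfields[OF le(2)] V_vfields[OF le(3)]], of p]
      by simp
    show "H (V i) (V j) (V k) p = - H (V i) (V k) (V j) p"
      using fun_cong[OF two_forms_skew[OF three_forms_two_forms[OF H] V_vfields[OF le(2)] V_vfields[OF le(3)]], of "V i" p]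
      by simp
  next
    fix j k :: nat assume le: "j \<le> 3" "k \<le> 3"
    show "H (V 0) (V j) (V k) p = 0"
      using fun_cong[OF H_0[OF V_vfields[OF le(1)] V_vfields[OF le(2)]], of p] by (simp add: V_def)
  qed
  then show "H (V i) (V j) (V k) p = h * alt3 i j k"
    using fun_cong[OF H_123, of p] by (simp add: V_def)
qed

lemma bracket_V:
  assumes "i \<le> 3" "j \<le> 3"
  shows "lie_bracket (V i) (V j) = (\<Sum>k\<in>{1..3}. cscale (\<Sum>l\<in>{1..3}. alt3 i j l * \<epsilon> l * L k l) (v k))"
proof -
  have z: "lie_bracket 0 (V j) = 0" "lie_bracket (V j) 0 = 0" if "j \<le> 3" for j
    using that lie_bracket_0[of "V j"] lie_bracket_skew[of "V j" 0] by simp_all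
  have s: "lie_bracket (v 2) (v 1) = - lie_bracket (v 1) (v 2)" "lie_bracket (v 3) (v 2) = - lie_bracket (v 2) (v 3)"
    "lie_bracket (v 1) (v 3) = - lie_bracket (v 3) (v 1)"
    by (rule lie_bracket_skew)+
  have d: "lie_bracket X X = 0" for X :: "'g vf" by (simp add: lie_bracket_def fun_eq_iff)
  show ?thesis
    by (cases rule: nat_atMost_3_cases[OF assms(1)]; cases rule: nat_atMost_3_cases[OF assms(2)])
      (use z[of 0] z[of 1] z[of 2] z[of 3] in \<open>simp_all add: V_def d s brackets apply_mat_def sum_1_3 alt3_def
        fun_eq_iff cscale_def algebra_simps del: One_nat_def\<close>)
qed

lemma g_bracket_V:
  assumes "i \<le> 3" "j \<le> 3" "k \<le> 3"
  shows "g (V k) (lie_bracket (V i) (V j)) = (\<lambda>_. c_const \<epsilon> L i j k)"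
proof -
  have "g (V k) (lie_bracket (V i) (V j))
      = (\<Sum>k'\<in>{1..3}. g (V k) (cscale (\<Sum>l\<in>{1..3}. alt3 i j l * \<epsilon> l * L k' l) (v k')))"
    unfolding bracket_V[OF assms(1,2)] using assms by (intro one_forms_sum) auto
  also have "\<dots> = (\<Sum>k'\<in>{1..3}. (\<lambda>_. \<Sum>l\<in>{1..3}. alt3 i j l * \<epsilon> l * L k' l) * g (V k) (V k'))"
  proof (intro sum.cong refl)
    fix k' :: nat assume k': "k' \<in> {1..3}"
    then have "v k' = V k'" by (simp add: V_def)
    then show "g (V k) (cscale (\<Sum>l\<in>{1..3}. alt3 i j l * \<epsilon> l * L k' l) (v k'))
        = (\<lambda>_. \<Sum>l\<in>{1..3}. alt3 i j l * \<epsilon> l * L k' l) * g (V k) (V k')"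
      using one_forms_fmul[OF g_one_forms[OF V_vfields[OF assms(3)]], of "V k'"] k'
      by (simp add: cscale_def)
  qed
  also have "\<dots> = (\<Sum>k'\<in>{1..3}. if k' = k then (\<lambda>_. c_const \<epsilon> L i j k) else 0)"
    using assms by (intro sum.cong refl) (auto simp: metric_V c_const_def fun_eq_iff)
  also have "\<dots> = (\<lambda>_. c_const \<epsilon> L i j k)"
    using assms by (cases "k = 0") (auto simp: c_const_def fun_eq_iff)
  finally show ?thesis .
qed

lemma pos_le [simp]: "A \<le> 6 \<Longrightarrow> pos A \<le> 3"
  by (cases "A \<le> 3") (auto simp: pos_def)

lemma e_basis_sections: "A \<le> 6 \<Longrightarrow> e_basis g v A \<in> sections G"
  by (simp add: e_basis_V sections_iff)

lemma pairing_e_basis: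
  assumes "A \<le> 6" "B \<le> 6"
  shows "pairing (e_basis g v A) (e_basis g v B) = (\<lambda>_. if A = B then metric_const \<epsilon> A else 0)"
  using assms
  by (auto simp: e_basis_V pairing_def fmul_eval metric_V metric_const_def pos_def side_def unit_part_def fun_eq_iff)

lemma pairing_e_basis_dorfman:
  assumes "A \<le> 6" "B \<le> 6" "C \<le> 6"
  shows "pairing (br (e_basis g v A) (e_basis g v B)) (e_basis g v C) = (\<lambda>_. courant_const \<epsilon> L h f A B C)"
proof
  fix p
  have le: "pos A \<le> 3" "pos B \<le> 3" "pos C \<le> 3" using assms by simp_all
  let ?g = "\<lambda>A. fmul (\<lambda>_. side A) (g (V (pos A)))"
  have const: "\<exists>c. ?g A (V j) = (\<lambda>_. c)" if "A \<le> 6" "j \<le> 3" for A j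
    using that by (simp add: fmul_eval metric_V fun_eq_iff)
  obtain c1 where c1: "?g B (V (pos A)) = (\<lambda>_. c1)" using const[OF assms(2) le(1)] by (rule exE)
  obtain c2 where c2: "?g B (V (pos C)) = (\<lambda>_. c2)" using const[OF assms(2) le(3)] by (rule exE)
  obtain c3 where c3: "?g A (V (pos B)) = (\<lambda>_. c3)" using const[OF assms(1) le(2)] by (rule exE)
  obtain c4 where c4: "?g A (V (pos C)) = (\<lambda>_. c4)" using const[OF assms(1) le(3)] by (rule exE)
  note * = pairing_dorfman_constant[where \<xi> = "?g A" and \<eta> = "?g B", OF V_vfields[OF le(1)] V_vfields[OF le(2)] V_vfields[OF le(3)] c1 c2 c3 c4]
  show "pairing (br (e_basis g v A) (e_basis g v B)) (e_basis g v C) p = courant_const \<epsilon> L h f A B C"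
    unfolding e_basis_V[OF assms(1)] e_basis_V[OF assms(2)] e_basis_V[OF assms(3)] * fmul_apply
      g_bracket_V[OF le(1,2,3)] g_bracket_V[OF le(2,3,1)] g_bracket_V[OF le(1,3,2)]
      H_V[OF le(2,1,3)] F_V[OF le(2,3)] F_V[OF le(1,3)] F_V[OF le(1,2)]
      c_const_skew[of \<epsilon> L "pos A" "pos C" "pos B"] f_const_skew[of f "pos A" "pos C"]
      alt3_skew(1)[of "pos B" "pos A" "pos C"] courant_const_def Let_def
    by simp
qed

lemma V_coordinates:
  assumes X: "X \<in> vfields G" and 0: "\<And>a. a \<in> {1..3} \<Longrightarrow> g (v a) X = 0"
  shows "X = 0"
proof -
  obtain c where c: "\<forall>i\<in>{1..3}. c i \<in> C_inf G" "X = (\<Sum>i\<in>{1..3}. fmul (c i) (v i))"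
    using frame_spans[OF X] by blast
  have f: "fmul (c i) (v i) \<in> vfields G" if "i \<in> {1..3}" for i
    using c(1) that by (intro vfields_fmul) auto
  have "c a = 0" if a: "a \<in> {1..3}" for a
  proof -
    have "g (v a) X = (\<Sum>i\<in>{1..3}. g (v a) (fmul (c i) (v i)))"
      unfolding c(2) using a by (intro one_forms_sum g_one_forms frame_vfields f)
    also have "\<dots> = (\<Sum>i\<in>{1..3}. if i = a then c a * (\<lambda>_. \<epsilon> a) else 0)"
      using a c(1) by (intro sum.cong refl)
        (auto simp: one_forms_fmul[of "g (v a)"] orthonormal fun_eq_iff)
    finally have eq: "c a * (\<lambda>_. \<epsilon> a) = 0" using 0[OF a] a by simp
    have "c a p * \<epsilon> a = 0" for p using fun_cong[OF eq, of p] by simp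
    moreover have "\<epsilon> a \<noteq> 0" using \<epsilon>_sq[OF a] by auto
    ultimately show ?thesis by (simp add: fun_eq_iff)
  qed
  then have "fmul (c i) (v i) = 0" if "i \<in> {1..3}" for i using that by (simp add: fun_eq_iff)
  then show ?thesis unfolding c(2) by (rule sum.neutral[rule_format])
qed

lemma one_form_coordinates:
  assumes \<xi>: "\<xi> \<in> one_forms G" and 0: "\<And>a. a \<in> {1..3} \<Longrightarrow> \<xi> (v a) = 0"
  shows "\<xi> = 0"
proof
  fix X show "\<xi> X = 0 X"
  proof (cases "X \<in> vfields G")
    case True
    obtain c where c: "\<forall>i\<in>{1..3}. c i \<in> C_inf G" "X = (\<Sum>i\<in>{1..3}. fmul (c i) (v i))"
      using frame_spans[OF True] by blast
    have f: "fmul (c i) (v i) \<in> vfields G" if "i \<in> {1..3}" for i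
      using c(1) that by (intro vfields_fmul) auto
    have "\<xi> X = (\<Sum>i\<in>{1..3}. \<xi> (fmul (c i) (v i)))"
      unfolding c(2) by (rule one_forms_sum[OF \<xi> f])
    also have "\<dots> = 0" using c(1) 0 by (intro sum.neutral) (auto simp: one_forms_fmul[OF \<xi>])
    finally show ?thesis by simp
  qed (simp add: one_forms_outside[OF \<xi>])
qed

lemma pairing_e_basis_components:
  assumes u: "(X, \<xi>, l) \<in> sections G"
  shows "pairing (X, \<xi>, l) (e_basis g v 0) = l"
    "a \<in> {1..3} \<Longrightarrow> pairing (X, \<xi>, l) (e_basis g v a) = (\<lambda>p. (\<xi> (v a) p + g (v a) X p) / 2)"
    "a \<in> {1..3} \<Longrightarrow> pairing (X, \<xi>, l) (e_basis g v (a + 3)) = (\<lambda>p. (\<xi> (v a) p - g (v a) X p) / 2)"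
proof -
  have "\<xi> 0 = 0" using u one_forms_0[of \<xi>] by (simp add: sections_iff)
  then show "pairing (X, \<xi>, l) (e_basis g v 0) = l"
    by (intro ext) (simp add: e_basis_def pairing_def)
  show "pairing (X, \<xi>, l) (e_basis g v a) = (\<lambda>p. (\<xi> (v a) p + g (v a) X p) / 2)" if "a \<in> {1..3}"
    using that by (intro ext) (simp add: e_basis_def pairing_def)
  show "pairing (X, \<xi>, l) (e_basis g v (a + 3)) = (\<lambda>p. (\<xi> (v a) p - g (v a) X p) / 2)" if "a \<in> {1..3}"
    using that by (intro ext) (simp add: e_basis_def pairing_def)
qed

lemma E_minus_e_basis: "E_minus G g = {u \<in> sections G. \<forall>A\<in>{0..3}. pairing u (e_basis g v A) = 0}"
proof (intro set_eqI iffI)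
  fix u assume "u \<in> E_minus G g"
  then obtain X where u: "u = (X, - g X, 0)" and X: "X \<in> vfields G" by (auto simp: E_minus_def)
  have s: "u \<in> sections G" using X by (simp add: u sections_iff)
  moreover have "pairing u (e_basis g v A) = 0" if "A \<in> {0..3}" for A
  proof (cases "A = 0")
    case True
    then show ?thesis using pairing_e_basis_components(1)[OF s[unfolded u]] by (simp add: u)
  next
    case False
    then have "A \<in> {1..3}" using that by auto
    then show ?thesis
      using pairing_e_basis_components(2)[OF s[unfolded u], of A] g_sym[OF X, of "v A"]
      by (simp add: u fun_eq_iff)
  qed
  ultimately show "u \<in> {u \<in> sections G. \<forall>A\<in>{0..3}. pairing u (e_basis g v A) = 0}" by blast
next
  fix u assume "u \<in> {u \<in> sections G. \<forall>A\<in>{0..3}. pairing u (e_basis g v A) = 0}"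
  then obtain X \<xi> l where u: "u = (X, \<xi>, l)" and s: "(X, \<xi>, l) \<in> sections G"
    and 0: "\<And>A. A \<in> {0..3} \<Longrightarrow> pairing (X, \<xi>, l) (e_basis g v A) = 0"
    by (cases u) auto
  have l: "l = 0" using pairing_e_basis_components(1)[OF s] 0[of 0] by simp
  have X: "X \<in> vfields G" "\<xi> \<in> one_forms G" using s by (simp_all add: sections_iff)
  have "(\<xi> + g X) (v a) = 0" if a: "a \<in> {1..3}" for a
    using pairing_e_basis_components(2)[OF s a] 0[of a] a g_sym[OF X(1), of "v a"]
    by (simp add: fun_eq_iff)
  then have "\<xi> + g X = 0" using X by (intro one_form_coordinates) auto
  then show "u \<in> E_minus G g"
    using X l by (auto simp: E_minus_def u eq_neg_iff_add_eq_0)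
qed

lemma e_basis_complete:
  assumes u: "u \<in> sections G" and 0: "\<And>A. A \<in> {0..3} \<union> {4..6} \<Longrightarrow> pairing u (e_basis g v A) = 0"
  shows "u = 0"
proof -
  obtain X \<xi> l where ue: "u = (X, \<xi>, l)" by (metis prod_cases3)
  note s = u[unfolded ue]
  have X: "X \<in> vfields G" "\<xi> \<in> one_forms G" using s by (simp_all add: sections_iff)
  have l: "l = 0" using pairing_e_basis_components(1)[OF s] 0[of 0] by (simp add: ue)
  have *: "\<xi> (v a) p = 0 \<and> g (v a) X p = 0" if a: "a \<in> {1..3}" for a p
    using pairing_e_basis_components(2,3)[OF s a] 0[of a] 0[of "a + 3"] a
    by (simp add: ue fun_eq_iff)
  have "X = 0" by (rule V_coordinates[OF X(1)]) (use * in \<open>simp add: fun_eq_iff\<close>)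
  moreover have "\<xi> = 0" by (rule one_form_coordinates[OF X(2)]) (use * in \<open>simp add: fun_eq_iff\<close>)
  ultimately show ?thesis by (simp add: ue l zero_prod_def)
qed

lemma F_frame_nonzero:
  assumes "F \<noteq> 0"
  shows "f 1 2 \<noteq> 0 \<or> f 1 3 \<noteq> 0 \<or> f 2 3 \<noteq> 0"
proof (rule ccontr)
  assume "\<not> ?thesis"
  then have f0: "f_const f i j = 0" for i j by (simp add: f_const_def)
  have frame: "F (v i) = 0" if i: "i \<in> {1..3}" for i
  proof (rule one_form_coordinates[OF two_forms_one_forms[OF F]])
    fix j :: nat assume "j \<in> {1..3}"
    then show "F (v i) (v j) = 0" using F_V[of i j] i by (simp add: V_def f0 fun_eq_iff)
  qed
  have "F X = 0" for X
  proof (cases "X \<in> vfields G")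
    case True
    show ?thesis
    proof (rule one_form_coordinates[OF two_forms_one_forms[OF F]])
      fix j :: nat assume j: "j \<in> {1..3}"
      show "F X (v j) = 0"
        using two_forms_skew[OF F True frame_vfields[OF j]] frame[OF j] by (simp add: fun_eq_iff)
    qed
  next
    case False
    then show ?thesis using F unfolding two_forms_def by blast
  qed
  then have "F = 0" by (simp add: fun_eq_iff)
  then show False using assms by blast
qed

lemma metric_const_sq:
  assumes "A \<le> 6" shows "metric_const \<epsilon> A * metric_const \<epsilon> A = 1"
proof (cases "A \<le> 3")
  case True
  then show ?thesis using \<epsilon>_sq[of A] by (simp add: metric_const_def side_def pos_def)
next
  case False
  then have "A - 3 \<in> {1..3}" using assms by auto
  then show ?thesis using \<epsilon>_sq[of "A - 3"] False by (simp add: metric_const_def side_def pos_def)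
qed

sublocale orthonormal_courant_algebroid G "{1..3}" v H F g "{0..3}" "{4..6}" "e_basis g v"
  "metric_const \<epsilon>" "courant_const \<epsilon> L h f"
proof unfold_locales
  have le: "A \<le> 6" if "A \<in> {0..3} \<union> {4..6}" for A :: nat using that by auto
  show "finite {0..3::nat}" "finite {4..6::nat}" "{0..3::nat} \<inter> {4..6} = {}" by auto
  show "E_minus G g = {u \<in> sections G. \<forall>A\<in>{0..3}. pairing u (e_basis g v A) = 0}"
    by (rule E_minus_e_basis)
  show "u = 0" if "u \<in> sections G" "\<And>A. A \<in> {0..3} \<union> {4..6} \<Longrightarrow> pairing u (e_basis g v A) = 0" for u
    by (rule e_basis_complete[OF that])
  show "courant_const \<epsilon> L h f A B C = - courant_const \<epsilon> L h f B A C"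
    "courant_const \<epsilon> L h f A B C = - courant_const \<epsilon> L h f A C B" for A B C
    by (rule courant_const_skew)+
  fix A B C :: nat assume A: "A \<in> {0..3} \<union> {4..6}"
  show "e_basis g v A \<in> sections G" by (rule e_basis_sections[OF le[OF A]])
  show "metric_const \<epsilon> A * metric_const \<epsilon> A = 1" by (rule metric_const_sq[OF le[OF A]])
  assume B: "B \<in> {0..3} \<union> {4..6}"
  show "pairing (e_basis g v A) (e_basis g v B) = (\<lambda>_. if A = B then metric_const \<epsilon> A else 0)"
    by (rule pairing_e_basis[OF le[OF A] le[OF B]])
  assume C: "C \<in> {0..3} \<union> {4..6}"
  show "pairing (br (e_basis g v A) (e_basis g v B)) (e_basis g v C) = (\<lambda>_. courant_const \<epsilon> L h f A B C)"
    by (rule pairing_e_basis_dorfman[OF le[OF A] le[OF B] le[OF C]])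
qed

end

section \<open>The Einstein equations\<close>

lemma range_P: "{0..3::nat} = {0, 1, 2, 3}" and range_N: "{4..6::nat} = {4, 5, 6}"
  by auto

lemma pos_values: "pos 0 = 0" "pos 1 = 1" "pos 2 = 2" "pos 3 = 3" "pos 4 = 1" "pos 5 = 2" "pos 6 = 3"
  by (simp_all add: pos_def)

lemma alt3_values: "alt3 1 2 3 = 1" "alt3 2 3 1 = 1" "alt3 3 1 2 = 1" "alt3 2 1 3 = - 1" "alt3 3 2 1 = - 1"
    "alt3 1 3 2 = - 1" "alt3 i k k = 0" "alt3 i k i = 0" "alt3 i k 0 = 0"
  by (simp_all add: alt3_def)

lemma L3_values: "L3 \<eta> \<alpha> \<beta> 1 1 = \<beta>" "L3 \<eta> \<alpha> \<beta> 1 2 = 0" "L3 \<eta> \<alpha> \<beta> 1 3 = 0"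
    "L3 \<eta> \<alpha> \<beta> 2 1 = 0" "L3 \<eta> \<alpha> \<beta> 2 2 = \<eta> / 2 + \<alpha>" "L3 \<eta> \<alpha> \<beta> 2 3 = \<eta> / 2"
    "L3 \<eta> \<alpha> \<beta> 3 1 = 0" "L3 \<eta> \<alpha> \<beta> 3 2 = - \<eta> / 2" "L3 \<eta> \<alpha> \<beta> 3 3 = - \<eta> / 2 + \<alpha>"
  by (simp_all add: L3_def)

locale frame_3_L3 = orthonormal_frame_3 G v H F g \<epsilon> "L3 \<eta> \<alpha> \<beta>" h f
  for G :: "('g::topological_space, 'e::euclidean_space) lie_struct" and v H F g \<epsilon> \<eta> \<alpha> \<beta> h f +
  fixes s :: real
  assumes \<epsilon>: "\<epsilon> 1 = s" "\<epsilon> 2 = s" "\<epsilon> 3 = - s" and s: "s = 1 \<or> s = -1" and \<eta>: "\<eta> = 1 \<or> \<eta> = -1"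
begin

abbreviation b :: "nat \<Rightarrow> nat \<Rightarrow> nat \<Rightarrow> real" where
  "b \<equiv> courant_const \<epsilon> (L3 \<eta> \<alpha> \<beta>) h f"

lemma metric_squares: "s * s = 1" "s * (s * x) = x"
  using s by auto

lemma metric_values:
  "metric_const \<epsilon> 0 = 1" "metric_const \<epsilon> 1 = s" "metric_const \<epsilon> 2 = s" "metric_const \<epsilon> 3 = - s"
  "metric_const \<epsilon> 4 = - s" "metric_const \<epsilon> 5 = - s" "metric_const \<epsilon> 6 = s"
  using \<epsilon> by (simp_all add: metric_const_def side_def pos_def)

lemma courant_values:
  "b 4 0 1 = 0" "b 4 0 2 = - f 1 2" "b 4 0 3 = - f 1 3" "b 4 1 2 = 0" "b 4 1 3 = 0"
  "b 4 2 3 = \<alpha> - \<beta> / 2 - h / 2" "b 5 0 1 = f 1 2" "b 5 0 2 = 0" "b 5 0 3 = - f 2 3"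
  "b 5 1 2 = \<eta> / 2" "b 5 1 3 = \<eta> / 2 - \<beta> / 2 + h / 2" "b 5 2 3 = 0" "b 6 0 1 = f 1 3"
  "b 6 0 2 = f 2 3" "b 6 0 3 = 0" "b 6 1 2 = \<eta> / 2 + \<beta> / 2 - h / 2" "b 6 1 3 = \<eta> / 2" "b 6 2 3 = 0"
  "b 0 4 5 = f 1 2" "b 0 4 6 = f 1 3" "b 0 5 6 = f 2 3" "b 1 4 5 = 0" "b 1 4 6 = 0"
  "b 1 5 6 = - \<alpha> + \<beta> / 2 - h / 2" "b 2 4 5 = - \<eta> / 2"
  "b 2 4 6 = - \<eta> / 2 + \<beta> / 2 + h / 2" "b 2 5 6 = 0" "b 3 4 5 = - \<eta> / 2 - \<beta> / 2 - h / 2"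
  "b 3 4 6 = - \<eta> / 2" "b 3 5 6 = 0"
  by (simp_all add: courant_const_def Let_def pos_values alt3_values side_def unit_part_def c_const_def f_const_def
      sum_1_3 \<epsilon> L3_values metric_squares algebra_simps add_divide_distrib diff_divide_distrib del: One_nat_def)

lemma b_swap: "b A B C = x \<Longrightarrow> b A C B = - x"
  using courant_const_skew(2)[of \<epsilon> "L3 \<eta> \<alpha> \<beta>" h f A B C] by simp

text \<open>The values are doubled so that no denominators occur.\<close>

lemma ric_values:
  "2 * ric {0..3} d 4 0 = - 2 * s * f 1 2 * d 2 + 2 * s * f 1 3 * d 3 - 2 * \<beta> * f 2 3 - 2 * h * f 2 3"
  "2 * ric {4..6} d 0 4 = - 2 * s * f 1 2 * d 5 + 2 * s * f 1 3 * d 6 - 2 * \<beta> * f 2 3 - 2 * h * f 2 3"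
  "2 * ric {0..3} d 4 1 = - 2 * s * (f 1 2)\<^sup>2 + 2 * s * (f 1 3)\<^sup>2 - (\<beta>)\<^sup>2 + (h)\<^sup>2"
  "2 * ric {4..6} d 1 4 = - 2 * s * (f 1 2)\<^sup>2 + 2 * s * (f 1 3)\<^sup>2 - (\<beta>)\<^sup>2 + (h)\<^sup>2"
  "2 * ric {0..3} d 4 2 = - 2 * s * \<alpha> * d 3 + s * \<beta> * d 3 + s * h * d 3 + 2 * s * f 1 3 * f 2 3 + 2 * f 1 2 * d 0"
  "2 * ric {4..6} d 2 4 = s * \<eta> * d 5 - s * \<eta> * d 6 + s * \<beta> * d 6 + s * h * d 6 + 2 * s * f 1 3 * f 2 3"
  "2 * ric {0..3} d 4 3 = - 2 * s * \<alpha> * d 2 + s * \<beta> * d 2 + s * h * d 2 + 2 * s * f 1 2 * f 2 3 + 2 * f 1 3 * d 0"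
  "2 * ric {4..6} d 3 4 = s * \<eta> * d 5 - s * \<eta> * d 6 + s * \<beta> * d 5 + s * h * d 5 + 2 * s * f 1 2 * f 2 3"
  "2 * ric {0..3} d 5 0 = 2 * s * f 1 2 * d 1 + 2 * s * f 2 3 * d 3 - \<eta> * f 1 2 + \<eta> * f 1 3 + 2 * \<alpha> * f 1 3 + 2 * h * f 1 3"
  "2 * ric {4..6} d 0 5 = 2 * s * f 1 2 * d 4 + 2 * s * f 2 3 * d 6 - \<eta> * f 1 2 + \<eta> * f 1 3 + 2 * \<alpha> * f 1 3 + 2 * h * f 1 3"
  "2 * ric {0..3} d 5 1 = s * \<eta> * d 2 - s * \<eta> * d 3 + s * \<beta> * d 3 - s * h * d 3 + 2 * s * f 1 3 * f 2 3 - 2 * f 1 2 * d 0"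
  "2 * ric {4..6} d 1 5 = - 2 * s * \<alpha> * d 6 + s * \<beta> * d 6 - s * h * d 6 + 2 * s * f 1 3 * f 2 3"
  "2 * ric {0..3} d 5 2 = - s * \<eta> * d 1 - 2 * s * (f 1 2)\<^sup>2 + 2 * s * (f 2 3)\<^sup>2 - 2 * \<eta> * \<alpha> + \<eta> * \<beta> - 2 * \<alpha> * \<beta> + (\<beta>)\<^sup>2 + (h)\<^sup>2"
  "2 * ric {4..6} d 2 5 = - s * \<eta> * d 4 - 2 * s * (f 1 2)\<^sup>2 + 2 * s * (f 2 3)\<^sup>2 - 2 * \<eta> * \<alpha> + \<eta> * \<beta> - 2 * \<alpha> * \<beta> + (\<beta>)\<^sup>2 + (h)\<^sup>2"
  "2 * ric {0..3} d 5 3 = - s * \<eta> * d 1 + s * \<beta> * d 1 - s * h * d 1 - 2 * s * f 1 2 * f 1 3 - 2 * \<eta> * \<alpha> + \<eta> * \<beta> + 2 * f 2 3 * d 0"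
  "2 * ric {4..6} d 3 5 = - s * \<eta> * d 4 - s * \<beta> * d 4 - s * h * d 4 - 2 * s * f 1 2 * f 1 3 - 2 * \<eta> * \<alpha> + \<eta> * \<beta>"
  "2 * ric {0..3} d 6 0 = 2 * s * f 1 3 * d 1 + 2 * s * f 2 3 * d 2 - \<eta> * f 1 2 + \<eta> * f 1 3 + 2 * \<alpha> * f 1 2 + 2 * h * f 1 2"
  "2 * ric {4..6} d 0 6 = 2 * s * f 1 3 * d 4 + 2 * s * f 2 3 * d 5 - \<eta> * f 1 2 + \<eta> * f 1 3 + 2 * \<alpha> * f 1 2 + 2 * h * f 1 2"
  "2 * ric {0..3} d 6 1 = s * \<eta> * d 2 - s * \<eta> * d 3 + s * \<beta> * d 2 - s * h * d 2 + 2 * s * f 1 2 * f 2 3 - 2 * f 1 3 * d 0"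
  "2 * ric {4..6} d 1 6 = - 2 * s * \<alpha> * d 5 + s * \<beta> * d 5 - s * h * d 5 + 2 * s * f 1 2 * f 2 3"
  "2 * ric {0..3} d 6 2 = - s * \<eta> * d 1 - s * \<beta> * d 1 + s * h * d 1 - 2 * s * f 1 2 * f 1 3 - 2 * \<eta> * \<alpha> + \<eta> * \<beta> - 2 * f 2 3 * d 0"
  "2 * ric {4..6} d 2 6 = - s * \<eta> * d 4 + s * \<beta> * d 4 + s * h * d 4 - 2 * s * f 1 2 * f 1 3 - 2 * \<eta> * \<alpha> + \<eta> * \<beta>"
  "2 * ric {0..3} d 6 3 = - s * \<eta> * d 1 - 2 * s * (f 1 3)\<^sup>2 - 2 * s * (f 2 3)\<^sup>2 - 2 * \<eta> * \<alpha> + \<eta> * \<beta> + 2 * \<alpha> * \<beta> - (\<beta>)\<^sup>2 - (h)\<^sup>2"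
  "2 * ric {4..6} d 3 6 = - s * \<eta> * d 4 - 2 * s * (f 1 3)\<^sup>2 - 2 * s * (f 2 3)\<^sup>2 - 2 * \<eta> * \<alpha> + \<eta> * \<beta> + 2 * \<alpha> * \<beta> - (\<beta>)\<^sup>2 - (h)\<^sup>2"
  unfolding ric_def K_diff unfolding range_P range_N
  by (simp_all add: courant_values courant_values[THEN b_swap] b_zero metric_values metric_squares
      power2_eq_square field_simps del: One_nat_def)

text \<open>In the comments below, \<open>Ric\<^sub>A\<^sub>B\<close> is the trace over the subbundle that contains \<open>e\<^sub>B\<close>.\<close>

lemma equations_imp_classes:
  assumes nonzero: "f 1 2 \<noteq> 0 \<or> f 1 3 \<noteq> 0 \<or> f 2 3 \<noteq> 0"
    and ric: "\<And>i a. i \<in> {4..6} \<Longrightarrow> a \<in> {0..3} \<Longrightarrow> ric {0..3} d i a = 0 \<and> ric {4..6} d a i = 0"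
  shows "class1 \<alpha> \<beta> \<epsilon> h f d \<or> class2 \<alpha> \<beta> \<epsilon> h f d \<or> class3 \<eta> \<alpha> \<beta> \<epsilon> h f d \<or> class4 \<eta> \<alpha> \<beta> \<epsilon> h f d"
proof -
  define x y z where "x = f 1 2" and "y = f 1 3" and "z = f 2 3"
  note xyz = x_def[symmetric] y_def[symmetric] z_def[symmetric]
  have r: "ric {0..3} d 4 0 = 0" "ric {4..6} d 0 4 = 0" "ric {0..3} d 4 1 = 0" "ric {4..6} d 1 4 = 0"
    "ric {0..3} d 4 2 = 0" "ric {4..6} d 2 4 = 0" "ric {0..3} d 4 3 = 0" "ric {4..6} d 3 4 = 0"
    "ric {0..3} d 5 0 = 0" "ric {4..6} d 0 5 = 0" "ric {0..3} d 5 1 = 0" "ric {4..6} d 1 5 = 0"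
    "ric {0..3} d 5 2 = 0" "ric {4..6} d 2 5 = 0" "ric {0..3} d 5 3 = 0" "ric {4..6} d 3 5 = 0"
    "ric {0..3} d 6 0 = 0" "ric {4..6} d 0 6 = 0" "ric {0..3} d 6 1 = 0" "ric {4..6} d 1 6 = 0"
    "ric {0..3} d 6 2 = 0" "ric {4..6} d 2 6 = 0" "ric {0..3} d 6 3 = 0" "ric {4..6} d 3 6 = 0"
    by (rule ric[THEN conjunct1] ric[THEN conjunct2]; simp)+
  have double: "2 * q = 0" if "q = 0" for q :: real using that by simp
  note nz = nonzero[unfolded xyz]
  note E = r[THEN double, unfolded ric_values xyz]
  have ss: "s * s = 1" and nn: "\<eta> * \<eta> = 1" using s \<eta> by auto
  have s0: "s \<noteq> 0" using s by auto
  \<comment> \<open>\<open>Ric\<^sub>2\<^sub>5\<close>, \<open>Ric\<^sub>3\<^sub>6\<close> minus the off-diagonal \<open>Ric\<^sub>3\<^sub>5\<close>, \<open>Ric\<^sub>2\<^sub>6\<close>: everything but \<open>F\<close> cancels.\<close>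
  have "s * (x - y)^2 = 0"
    using E(14) E(16) E(22) E(24) by algebra
  then have yx: "y = x" using s0 by simp
  have hh: "h^2 = \<beta>^2" using E(3) yx by algebra
  have d4: "(\<beta> + h) * d 4 = 0" using E(16) E(22) ss yx by algebra
  \<comment> \<open>For \<open>h = \<beta> \<noteq> 0\<close>, the equations force first \<open>z = 0\<close> and then \<open>x = 0\<close>, so \<open>F = 0\<close>.\<close>
  have h: "h = - \<beta>"
  proof (rule ccontr)
    assume n: "h \<noteq> - \<beta>"
    then have hb: "h = \<beta>" using hh by (simp add: power2_eq_iff)
    then have b0: "\<beta> \<noteq> 0" using n by auto
    have d40: "d 4 = 0" using d4 hb b0 by simp
    have "z * (d 6 - d 5) = 0" using E(10) E(18) yx ss by algebra
    moreover have zx: "s * x * (d 6 - d 5) = 2 * \<beta> * z" using E(2) yx hb by algebra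
    ultimately have z0: "z = 0" using b0 by auto
    then have x0: "x \<noteq> 0" using nz yx by simp
    have "\<beta> * (\<beta> - \<alpha>) = 0" using E(14) E(16) yx z0 hb d40 by algebra
    then have "\<beta> = \<alpha>" using b0 by simp
    moreover have "2 * \<alpha> * x = 0" using E(10) yx z0 hb d40 calculation by algebra
    ultimately show False using x0 b0 by simp
  qed
  \<comment> \<open>As \<open>x\<close> and \<open>z\<close> are not both 0, they can be cancelled in these products.\<close>
  have d23: "x * (d 3 - d 2) = 0" "z * (d 3 - d 2) = 0" and d56: "x * (d 6 - d 5) = 0" "z * (d 6 - d 5) = 0"
    using E(1) E(2) E(9) E(10) E(17) E(18) yx h ss by algebra+
  have xz: "x \<noteq> 0 \<or> z \<noteq> 0" using nz yx by auto
  then have d3: "d 3 = d 2" and d6: "d 6 = d 5" using d23 d56 by auto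
  \<comment> \<open>By \<open>Ric\<^sub>2\<^sub>4\<close>, whose terms in \<open>\<delta>\<close> have become 0.\<close>
  have "x * z = 0" using E(6) yx h d6 ss by algebra
  then consider "x = 0" "z \<noteq> 0" | "z = 0" "x \<noteq> 0" using xz by auto
  then show ?thesis
  proof cases
    case 1
    have d2: "d 2 = 0" "d 5 = 0" using E(9) E(10) yx 1 d3 d6 ss by (algebra, algebra)
    have d4: "d 4 = s * (\<beta> - 2 * \<alpha>)" using E(16) yx 1 h ss nn by algebra
    have zz: "z^2 = s * \<beta> * (\<alpha> - \<beta>)" using E(14) E(16) yx 1 h ss by algebra
    have "2 * d 1 = 2 * s * (\<beta> - 2 * \<alpha>)" using E(15) E(21) yx 1 h ss nn by algebra
    then have d1: "d 1 = s * (\<beta> - 2 * \<alpha>)" by simp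
    have zd: "z * d 0 = \<beta> * (2 * \<alpha> - \<beta>)" using E(15) E(21) yx 1 h ss nn d1 by algebra
    have pos: "s * \<beta> * (\<alpha> - \<beta>) > 0" using zz 1 by (metis zero_less_power2)
    then have b0: "\<beta> \<noteq> 0" by auto
    have all: "d A = 0" if "A \<in> {0..6} - {0, 1, 4}" for A
    proof -
      have "A = 2 \<or> A = 3 \<or> A = 5 \<or> A = 6" using that by auto
      then show ?thesis using d2 d3 d6 by auto
    qed
    show ?thesis
    proof (cases "\<beta> = 2 * \<alpha>")
      case True
      have d0: "d 0 = 0" using zd True 1 by simp
      have "s * \<alpha>^2 < 0" using pos True by (simp add: power2_eq_square ac_simps)
      then have s1: "s = -1" using s by auto
      have "z^2 = (sqrt 2 * \<alpha>)^2" using zz True s1 by (simp add: power_mult_distrib) (simp add: power2_eq_square)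
      then have "z = sqrt 2 * \<alpha> \<or> z = - (sqrt 2 * \<alpha>)" by (simp add: power2_eq_iff)
      then have "\<exists>t\<in>{1, -1}. z = t * sqrt 2 * \<alpha>" by auto
      moreover have "d A = 0" if "A \<in> {0..6}" for A
        using all[of A] d0 d1 d4 True that by (cases "A \<in> {0, 1, 4}") auto
      ultimately have "class1 \<alpha> \<beta> \<epsilon> h f d"
        using True b0 h yx 1 s1 \<epsilon> by (simp add: class1_def xyz del: One_nat_def)
      then show ?thesis by blast
    next
      case False
      have d0: "d 0 \<noteq> 0" using zd b0 False by auto
      have "f 2 3 = \<beta> * (2 * \<alpha> - \<beta>) / d 0" using zd d0 by (simp add: z_def[symmetric] field_simps)
      moreover have "(d 0)^2 = s * \<beta> * (2 * \<alpha> - \<beta>)^2 / (\<alpha> - \<beta>)"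
      proof -
        have "(s * \<beta> * (\<alpha> - \<beta>)) * (d 0)^2 = \<beta>^2 * (2 * \<alpha> - \<beta>)^2" using zd zz by algebra
        then have "s * (s * \<beta> * (\<alpha> - \<beta>)) * (d 0)^2 = s * (\<beta>^2 * (2 * \<alpha> - \<beta>)^2)" by simp
        then have "\<beta> * ((\<alpha> - \<beta>) * (d 0)^2) = \<beta> * (s * \<beta> * (2 * \<alpha> - \<beta>)^2)" using ss by algebra
        then have "(\<alpha> - \<beta>) * (d 0)^2 = s * \<beta> * (2 * \<alpha> - \<beta>)^2" using b0 by simp
        moreover have "\<alpha> - \<beta> \<noteq> 0" using pos by auto
        ultimately show ?thesis by (simp add: field_simps)
      qed
      ultimately have "class2 \<alpha> \<beta> \<epsilon> h f d"
        using False pos h yx 1 d1 d4 all \<epsilon> by (simp add: class2_def xyz del: One_nat_def)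
      then show ?thesis by blast
    qed
  next
    case 2
    have "\<beta> * (\<beta> - \<alpha>) = 0" using E(14) E(16) yx 2 h ss by algebra
    then have cases: "\<beta> = 0 \<or> \<beta> = \<alpha>" by auto
    have "x * (s * d 4 - (\<beta> - \<alpha>)) = 0" using E(10) yx 2 h by algebra
    then have "s * d 4 = \<beta> - \<alpha>" using 2 by simp
    then have d4: "d 4 = s * (\<beta> - \<alpha>)" using ss by algebra
    have "x * (s * d 1 - (\<beta> - \<alpha>)) = 0" using E(9) yx 2 h by algebra
    then have "s * d 1 = \<beta> - \<alpha>" using 2 by simp
    then have d1: "d 1 = s * (\<beta> - \<alpha>)" using ss by algebra
    have xx: "x^2 = - (s * \<alpha> * \<eta> / 2)" using E(16) yx 2 h d4 ss by algebra
    have "x^2 > 0" using 2 by simp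
    then have neg: "s * \<alpha> * \<eta> < 0" using xx by simp
    from cases show ?thesis
    proof
      assume b: "\<beta> = 0"
      have a0: "\<alpha> \<noteq> 0" using neg by auto
      have "x * d 0 = 0" using E(11) yx 2 h b d3 ss by algebra
      then have d0: "d 0 = 0" using 2 by simp
      have d2: "d 2 = 0" using E(5) yx 2 h b d3 d0 a0 s0 by auto
      have d5: "d 5 = 0" using E(12) yx 2 h b d6 a0 s0 by auto
      have all: "d A = 0" if "A \<in> {0..6} - {1, 4}" for A
      proof -
        have "A = 0 \<or> A = 2 \<or> A = 3 \<or> A = 5 \<or> A = 6" using that by auto
        then show ?thesis using d0 d2 d5 d3 d6 by auto
      qed
      then have "class3 \<eta> \<alpha> \<beta> \<epsilon> h f d"
        using b h yx 2 xx neg d1 d4 \<epsilon> by (simp add: class3_def xyz del: One_nat_def)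
      then show ?thesis by blast
    next
      assume b: "\<beta> = \<alpha>"
      have "d 0 * x = s * \<alpha> * d 2" using E(5) yx 2 h b d3 by algebra
      then have "class4 \<eta> \<alpha> \<beta> \<epsilon> h f d"
        using b h yx 2 xx neg d1 d4 d3 d6 \<epsilon> by (simp add: class4_def xyz del: One_nat_def)
      then show ?thesis by blast
    qed
  qed
qed

lemma ball_4_6_0_3:
  "(\<forall>i\<in>{4..6::nat}. \<forall>j\<in>{0..3::nat}. Q i j) \<longleftrightarrow>
     Q 4 0 \<and> Q 4 1 \<and> Q 4 2 \<and> Q 4 3 \<and> Q 5 0 \<and> Q 5 1 \<and> Q 5 2 \<and> Q 5 3 \<and> Q 6 0 \<and> Q 6 1 \<and> Q 6 2 \<and> Q 6 3"
  unfolding range_P range_N by (simp only: ball_simps conj_assoc simp_thms)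

text \<open>The three families of solutions; the first one contains the classes 1 and 2.\<close>

lemma equations_family1:
  assumes S: "h = - \<beta>" "f 1 2 = 0" "f 1 3 = 0" "d 2 = 0" "d 3 = 0" "d 5 = 0" "d 6 = 0"
      "d 1 = s * (\<beta> - 2 * \<alpha>)" "d 4 = s * (\<beta> - 2 * \<alpha>)"
    and E: "(f 2 3)^2 = s * \<beta> * (\<alpha> - \<beta>)" "d 0 * f 2 3 = \<beta> * (2 * \<alpha> - \<beta>)"
  shows "\<forall>i\<in>{4..6}. \<forall>j\<in>{0..3}. ric {0..3} d i j = 0 \<and> ric {4..6} d j i = 0"
proof -
  have half: "q = 0" if "2 * q = 0" for q :: real using that by simp
  have "d 0 * (x * f 2 3) = x * (\<beta> * (2 * \<alpha> - \<beta>))" for x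
    using E(2) by (simp add: mult.left_commute)
  note EE = E[unfolded power2_eq_square] this
  show ?thesis
    unfolding ball_4_6_0_3
    by (intro conjI; rule half; simp only: ric_values;
        simp add: S EE metric_squares algebra_simps power2_eq_square del: One_nat_def)
qed

lemma equations_family2:
  assumes S: "h = 0" "\<beta> = 0" "f 1 3 = f 1 2" "f 2 3 = 0" "d 0 = 0" "d 2 = 0" "d 3 = 0" "d 5 = 0" "d 6 = 0"
      "d 1 = - s * \<alpha>" "d 4 = - s * \<alpha>"
    and E: "(f 1 2)^2 = - (s * \<alpha> * \<eta> / 2)"
  shows "\<forall>i\<in>{4..6}. \<forall>j\<in>{0..3}. ric {0..3} d i j = 0 \<and> ric {4..6} d j i = 0"
proof -
  have half: "q = 0" if "2 * q = 0" for q :: real using that by simp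
  note EE = E[unfolded power2_eq_square]
  show ?thesis
    unfolding ball_4_6_0_3
    by (intro conjI; rule half; simp only: ric_values;
        simp add: S EE metric_squares algebra_simps power2_eq_square del: One_nat_def)
qed

lemma equations_family3:
  assumes S: "h = - \<alpha>" "\<beta> = \<alpha>" "f 1 3 = f 1 2" "f 2 3 = 0" "d 3 = d 2" "d 6 = d 5" "d 1 = 0" "d 4 = 0"
    and E: "(f 1 2)^2 = - (s * \<alpha> * \<eta> / 2)" "d 0 * f 1 2 = s * \<alpha> * d 2"
  shows "\<forall>i\<in>{4..6}. \<forall>j\<in>{0..3}. ric {0..3} d i j = 0 \<and> ric {4..6} d j i = 0"
proof -
  have half: "q = 0" if "2 * q = 0" for q :: real using that by simp
  note EE = E[unfolded power2_eq_square]
  show ?thesis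
    unfolding ball_4_6_0_3
    by (intro conjI; rule half; simp only: ric_values;
        simp add: S EE metric_squares algebra_simps power2_eq_square del: One_nat_def)
qed

lemma classes_imp_equations:
  assumes cl: "class1 \<alpha> \<beta> \<epsilon> h f d \<or> class2 \<alpha> \<beta> \<epsilon> h f d \<or> class3 \<eta> \<alpha> \<beta> \<epsilon> h f d \<or> class4 \<eta> \<alpha> \<beta> \<epsilon> h f d"
  shows "\<forall>i\<in>{4..6}. \<forall>j\<in>{0..3}. ric {0..3} d i j = 0 \<and> ric {4..6} d j i = 0"
  using cl
proof (elim disjE)
  assume c: "class1 \<alpha> \<beta> \<epsilon> h f d"
  then have "(f 2 3)^2 = 2 * \<alpha>^2" by (auto simp: class1_def power_mult_distrib)
  then show ?thesis
    using c \<epsilon> by (intro equations_family1) (simp_all add: class1_def power2_eq_square del: One_nat_def)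
next
  assume c: "class2 \<alpha> \<beta> \<epsilon> h f d"
  then have pos: "s * \<beta> * (\<alpha> - \<beta>) > 0" and d0: "(d 0)^2 = s * \<beta> * (2 * \<alpha> - \<beta>)^2 / (\<alpha> - \<beta>)"
    and z: "f 2 3 = \<beta> * (2 * \<alpha> - \<beta>) / d 0" and n: "2 * \<alpha> - \<beta> \<noteq> 0"
    using \<epsilon> by (simp_all add: class2_def del: One_nat_def)
  have ss: "s * s = 1" using s by auto
  have nz: "\<alpha> - \<beta> \<noteq> 0" "\<beta> \<noteq> 0" "s \<noteq> 0" using pos by auto
  have d00: "d 0 \<noteq> 0" using d0 nz n by auto
  have zd: "d 0 * f 2 3 = \<beta> * (2 * \<alpha> - \<beta>)" using z d00 by simp
  have "(d 0)^2 * (\<alpha> - \<beta>) = s * \<beta> * (2 * \<alpha> - \<beta>)^2" using d0 nz by (simp add: field_simps)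
  then have "(d 0)^2 * ((f 2 3)^2 - s * \<beta> * (\<alpha> - \<beta>)) = 0" using zd ss by algebra
  then have "(f 2 3)^2 = s * \<beta> * (\<alpha> - \<beta>)" using d00 by simp
  then show ?thesis
    using c zd \<epsilon> by (intro equations_family1) (simp_all add: class2_def del: One_nat_def)
next
  assume c: "class3 \<eta> \<alpha> \<beta> \<epsilon> h f d"
  have "f 1 3 = f 1 2" using c by (simp add: class3_def)
  moreover have "(f 1 2)\<^sup>2 = - (s * \<alpha> * \<eta> / 2)" using c \<epsilon> by (auto simp: class3_def simp del: One_nat_def)
  ultimately show ?thesis
    using c \<epsilon> by (intro equations_family2) (simp_all add: class3_def del: One_nat_def)
next
  assume c: "class4 \<eta> \<alpha> \<beta> \<epsilon> h f d"
  have "f 1 3 = f 1 2" using c by (simp add: class4_def)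
  moreover have "(f 1 2)\<^sup>2 = - (s * \<alpha> * \<eta> / 2)" "d 0 * f 1 2 = s * \<alpha> * d 2"
    using c \<epsilon> by (auto simp: class4_def simp del: One_nat_def)
  ultimately show ?thesis
    using c \<epsilon> by (intro equations_family3) (simp_all add: class4_def del: One_nat_def)
qed

end

section \<open>The isomorphism type of the Lie algebra\<close>

locale lie_frame_3 = smooth_manifold G
  for G :: "('g::topological_space, 'e::euclidean_space) lie_struct" +
  fixes v :: "nat \<Rightarrow> 'g vf" and \<epsilon> :: "nat \<Rightarrow> real" and L :: "nat \<Rightarrow> nat \<Rightarrow> real"
  assumes basis: "free_basis UNIV cscale (lie_alg G) {1..3} v"
    and brackets: "lie_bracket (v 1) (v 2) = cscale (\<epsilon> 3) (apply_mat L v 3)"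
      "lie_bracket (v 2) (v 3) = cscale (\<epsilon> 1) (apply_mat L v 1)"
      "lie_bracket (v 3) (v 1) = cscale (\<epsilon> 2) (apply_mat L v 2)"
begin

definition comb :: "(nat \<Rightarrow> real) \<Rightarrow> 'g vf" where
  "comb k = (\<Sum>i\<in>{1..3}. cscale (k i) (v i))"

definition bracket_coeff :: "(nat \<Rightarrow> real) \<Rightarrow> (nat \<Rightarrow> real) \<Rightarrow> nat \<Rightarrow> real" where
  "bracket_coeff k l m = (k 1 * l 2 - k 2 * l 1) * \<epsilon> 3 * L m 3
     + (k 2 * l 3 - k 3 * l 2) * \<epsilon> 1 * L m 1 + (k 3 * l 1 - k 1 * l 3) * \<epsilon> 2 * L m 2"

lemma v_lie_alg: "i \<in> {1..3} \<Longrightarrow> v i \<in> lie_alg G"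
  using basis unfolding free_basis_def by blast

lemma comb_lie_alg: "comb k \<in> lie_alg G"
  unfolding comb_def sum_1_3
  using lie_alg_closed[OF smooth_manifold_axioms] v_lie_alg[of 1] v_lie_alg[of 2] v_lie_alg[of 3] by simp

lemma lie_alg_comb: "X \<in> lie_alg G \<Longrightarrow> \<exists>k. X = comb k"
  using basis unfolding free_basis_def comb_def by blast

lemma comb_inj:
  assumes "comb k = comb l" "i \<in> {1..3}"
  shows "k i = l i"
proof -
  have "(\<Sum>i\<in>{1..3}. cscale (k i - l i) (v i)) = comb k - comb l"
    by (simp add: comb_def sum_1_3 cscale_def fun_eq_iff algebra_simps del: One_nat_def)
  then have "(\<Sum>i\<in>{1..3}. cscale (k i - l i) (v i)) = 0" using assms(1) by simp
  from free_basis_indep[OF smooth_manifold_axioms basis this assms(2)] show ?thesis by simp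
qed

lemma comb_add: "comb k + comb l = comb (\<lambda>i. k i + l i)"
  and comb_scale: "cscale c (comb k) = comb (\<lambda>i. c * k i)"
  by (auto simp: comb_def sum_1_3 cscale_def fun_eq_iff algebra_simps simp del: One_nat_def)

lemma lie_bracket_comb: "lie_bracket (comb k) (comb l) = comb (bracket_coeff k l)"
proof
  fix f
  note vf = lie_alg_vfields[OF v_lie_alg]
  have X: "v 1 \<in> vfields G" "v 2 \<in> vfields G" "v 3 \<in> vfields G" by (rule vf; simp)+
  have comb: "comb k h = (\<lambda>_. k 1) * v 1 h + ((\<lambda>_. k 2) * v 2 h + (\<lambda>_. k 3) * v 3 h)" for k h
    by (simp add: comb_def sum_1_3 cscale_def fmul_eval fun_eq_iff del: One_nat_def)
  have lin: "W (comb k f) = (\<lambda>_. k 1) * W (v 1 f) + ((\<lambda>_. k 2) * W (v 2 f) + (\<lambda>_. k 3) * W (v 3 f))"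
    if W: "W \<in> vfields G" for W k
    unfolding comb using X
    by (simp add: vfields_derivation(1)[OF W] vfields_linear(4)[OF W C_inf_0] vfields_linear(4)[OF W _ C_inf_0]
        del: One_nat_def)
  have b: "v 1 (v 2 f) p - v 2 (v 1 f) p = \<epsilon> 3 * (L 1 3 * v 1 f p + L 2 3 * v 2 f p + L 3 3 * v 3 f p)"
    "v 2 (v 3 f) p - v 3 (v 2 f) p = \<epsilon> 1 * (L 1 1 * v 1 f p + L 2 1 * v 2 f p + L 3 1 * v 3 f p)"
    "v 3 (v 1 f) p - v 1 (v 3 f) p = \<epsilon> 2 * (L 1 2 * v 1 f p + L 2 2 * v 2 f p + L 3 2 * v 3 f p)" for p
    using fun_cong[OF fun_cong[OF brackets(1)], of f p] fun_cong[OF fun_cong[OF brackets(2)], of f p]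
      fun_cong[OF fun_cong[OF brackets(3)], of f p]
    by (simp_all add: lie_bracket_def apply_mat_def sum_1_3 cscale_def del: One_nat_def)
  show "lie_bracket (comb k) (comb l) f = comb (bracket_coeff k l) f"
  proof
    fix p
    have "lie_bracket (comb k) (comb l) f p
      = (k 1 * l 2 - k 2 * l 1) * (v 1 (v 2 f) p - v 2 (v 1 f) p)
      + (k 2 * l 3 - k 3 * l 2) * (v 2 (v 3 f) p - v 3 (v 2 f) p)
      + (k 3 * l 1 - k 1 * l 3) * (v 3 (v 1 f) p - v 1 (v 3 f) p)"
      unfolding lie_bracket_def minus_apply comb[of _ "comb _ f"] lin[OF X(1)] lin[OF X(2)] lin[OF X(3)]
      by (simp add: algebra_simps del: One_nat_def)
    also have "\<dots> = comb (bracket_coeff k l) f p"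
      unfolding b comb by (simp add: bracket_coeff_def algebra_simps del: One_nat_def)
    finally show "lie_bracket (comb k) (comb l) f p = comb (bracket_coeff k l) f p" .
  qed
qed

lemma lie_bracket_lie_alg:
  assumes "X \<in> lie_alg G" "Y \<in> lie_alg G"
  shows "lie_bracket X Y \<in> lie_alg G"
  using lie_alg_comb[OF assms(1)] lie_alg_comb[OF assms(2)] comb_lie_alg by (auto simp: lie_bracket_comb)

text \<open>As \<open>comb\<close> identifies triples of coordinates with left-invariant fields, an isomorphism may be given on
  coordinates. These are functions on all natural numbers, whence the form of \<open>inj\<close>.\<close>

lemma lie_isoI:
  fixes \<phi> :: "(nat \<Rightarrow> real) \<Rightarrow> 'b::real_vector"
  assumes onto: "\<And>y. y \<in> C \<longleftrightarrow> (\<exists>k. y = \<phi> k)"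
    and inj: "\<And>k l. \<phi> k = \<phi> l \<longleftrightarrow> (\<forall>i\<in>{1..3}. k i = l i)"
    and lin: "\<And>k l. \<phi> (\<lambda>i. k i + l i) = \<phi> k + \<phi> l" "\<And>c k. \<phi> (\<lambda>i. c * k i) = c *\<^sub>R \<phi> k"
    and br: "\<And>k l. \<phi> (bracket_coeff k l) = br (\<phi> k) (\<phi> l)"
  shows "lie_iso (lie_alg G) cscale lie_bracket C scaleR br"
proof -
  define \<Phi> where "\<Phi> X = \<phi> (SOME k. X = comb k)" for X
  have \<Phi>: "\<Phi> (comb k) = \<phi> k" for k
  proof -
    have "comb k = comb (SOME l. comb k = comb l)" by (rule someI[of "\<lambda>l. comb k = comb l" k]) (rule refl)
    then have "\<forall>i\<in>{1..3}. (SOME l. comb k = comb l) i = k i" using comb_inj by metis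
    then show ?thesis unfolding \<Phi>_def inj .
  qed
  have "bij_betw \<Phi> (lie_alg G) C"
  proof (rule bij_betwI')
    fix X Y assume "X \<in> lie_alg G" "Y \<in> lie_alg G"
    then obtain k l where kl: "X = comb k" "Y = comb l" using lie_alg_comb[of X] lie_alg_comb[of Y] by blast
    have "comb k = comb l" if "\<forall>i\<in>{1..3}. k i = l i"
      unfolding comb_def using that by (intro sum.cong) auto
    then show "(\<Phi> X = \<Phi> Y) = (X = Y)" unfolding kl \<Phi> inj using comb_inj by blast
  next
    fix X assume "X \<in> lie_alg G"
    then show "\<Phi> X \<in> C" using lie_alg_comb \<Phi> onto by metis
  next
    fix y assume "y \<in> C"
    then show "\<exists>X\<in>lie_alg G. y = \<Phi> X" using \<Phi> onto comb_lie_alg by metis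
  qed
  moreover have "\<Phi> (X + Y) = \<Phi> X + \<Phi> Y \<and> \<Phi> (lie_bracket X Y) = br (\<Phi> X) (\<Phi> Y) \<and> \<Phi> (cscale c X) = c *\<^sub>R \<Phi> X"
    if X: "X \<in> lie_alg G" and Y: "Y \<in> lie_alg G" for X Y c
  proof -
    obtain k l where kl: "X = comb k" "Y = comb l"
      using lie_alg_comb[OF X] lie_alg_comb[OF Y] by blast
    show ?thesis unfolding kl comb_add comb_scale lie_bracket_comb \<Phi> lin br by blast
  qed
  ultimately show ?thesis unfolding lie_iso_def by blast
qed

end

text \<open>\<open>[K, X] = X\<close>, \<open>[K, Y] = - Y\<close>, \<open>[X, Y] = - 2 K\<close> in \<open>so(2,1)\<close>, and the combination
  \<open>a K + b X + c Y\<close> is the following matrix.\<close>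

definition so21_elem :: "real \<Rightarrow> real \<Rightarrow> real \<Rightarrow> real^3^3" where
  "so21_elem a b c = vector [vector [0, - b - c, a], vector [b + c, 0, c - b], vector [a, c - b, 0]]"

lemma so21_iff: "A \<in> so_of J21 \<longleftrightarrow> (\<exists>a b c. A = so21_elem a b c)"
proof
  assume "A \<in> so_of J21"
  then have "A = so21_elem (A $ 1 $ 3) ((A $ 2 $ 1 - A $ 2 $ 3) / 2) ((A $ 2 $ 1 + A $ 2 $ 3) / 2)"
    by (auto simp: so_of_def J21_def so21_elem_def vec_eq_iff forall_3 matrix_matrix_mult_def sum_3 transpose_def field_simps)
  then show "\<exists>a b c. A = so21_elem a b c" by blast
qed (auto simp: so_of_def J21_def so21_elem_def vec_eq_iff forall_3 matrix_matrix_mult_def sum_3 transpose_def)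

lemma so21_elem_simps:
  "so21_elem a b c + so21_elem a' b' c' = so21_elem (a + a') (b + b') (c + c')"
  "r *\<^sub>R so21_elem a b c = so21_elem (r * a) (r * b) (r * c)"
  "so21_elem a b c = so21_elem a' b' c' \<longleftrightarrow> a = a' \<and> b = b' \<and> c = c'"
  "commutator (so21_elem a b c) (so21_elem a' b' c')
     = so21_elem (-2 * (b * c' - c * b')) (a * b' - b * a') (c * a' - a * c')"
  by (auto simp: so21_elem_def commutator_def vec_eq_iff forall_3 matrix_matrix_mult_def sum_3 algebra_simps)

text \<open>Likewise, with \<open>[X, Y] = 0\<close>, in \<open>e(1,1)\<close>.\<close>

definition e11_elem :: "real \<Rightarrow> real \<Rightarrow> real \<Rightarrow> (real^2^2) \<times> (real^2)" where
  "e11_elem a b c = (vector [vector [0, a], vector [a, 0]], vector [b + c, b - c])"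

lemma e11_iff: "A \<in> e11 \<longleftrightarrow> (\<exists>a b c. A = e11_elem a b c)"
proof
  assume "A \<in> e11"
  then have "A = e11_elem (fst A $ 1 $ 2) ((snd A $ 1 + snd A $ 2) / 2) ((snd A $ 1 - snd A $ 2) / 2)"
    by (cases A) (auto simp: e11_def so_of_def J11_def e11_elem_def vec_eq_iff forall_2 matrix_matrix_mult_def sum_2 transpose_def field_simps)
  then show "\<exists>a b c. A = e11_elem a b c" by blast
qed (auto simp: e11_def so_of_def J11_def e11_elem_def vec_eq_iff forall_2 matrix_matrix_mult_def sum_2 transpose_def)

lemma e11_elem_simps:
  "e11_elem a b c + e11_elem a' b' c' = e11_elem (a + a') (b + b') (c + c')"
  "r *\<^sub>R e11_elem a b c = e11_elem (r * a) (r * b) (r * c)"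
  "e11_elem a b c = e11_elem a' b' c' \<longleftrightarrow> a = a' \<and> b = b' \<and> c = c'"
  "affine_bracket (e11_elem a b c) (e11_elem a' b' c') = e11_elem 0 (a * b' - b * a') (c * a' - a * c')"
  by (auto simp: e11_elem_def affine_bracket_def commutator_def vec_eq_iff forall_2 matrix_matrix_mult_def
      matrix_vector_mult_def sum_2 algebra_simps)

locale lie_frame_L3 = lie_frame_3 G v \<epsilon> "L3 \<eta> \<alpha> \<beta>"
  for G :: "('g::topological_space, 'e::euclidean_space) lie_struct" and v \<epsilon> \<eta> \<alpha> \<beta> +
  fixes s :: real
  assumes \<epsilon>: "\<epsilon> 1 = s" "\<epsilon> 2 = s" "\<epsilon> 3 = - s" and s: "s = 1 \<or> s = -1"
begin

text \<open>For \<open>\<alpha> \<noteq> 0\<close>, \<open>ad v\<^sub>1\<close> has on the plane of \<open>v\<^sub>2\<close> and \<open>v\<^sub>3\<close> the eigenvectors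
  \<open>x = (\<alpha> + \<eta>/2) v\<^sub>2 + (\<alpha> - \<eta>/2) v\<^sub>3\<close> and \<open>y = v\<^sub>2 - v\<^sub>3\<close> with eigenvalues \<open>- s \<alpha>\<close> and \<open>s \<alpha>\<close>, and
  \<open>[x, y] = - 2 s \<alpha> \<beta> v\<^sub>1\<close>. Hence \<open>v\<^sub>1 \<mapsto> - s \<alpha> K\<close>, \<open>x \<mapsto> p X\<close>, \<open>y \<mapsto> Y\<close>, where \<open>p [X, Y] = 2 \<alpha>\<^sup>2 \<beta> K\<close>,
  defines a homomorphism; it has the following coordinates.\<close>

definition K_coord where "K_coord k = - s * \<alpha> * k (1::nat)"
definition X_coord where "X_coord p k = p * (k (2::nat) + k 3) / (2 * \<alpha>)"
definition Y_coord where "Y_coord k = ((\<alpha> - \<eta> / 2) * k (2::nat) - (\<alpha> + \<eta> / 2) * k 3) / (2 * \<alpha>)"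

lemmas coord_defs = K_coord_def X_coord_def Y_coord_def

lemma coord_bracket:
  assumes "\<alpha> \<noteq> 0" "p * t = 2 * \<alpha>^2 * \<beta>"
  shows "K_coord (bracket_coeff k l) = t * (X_coord p k * Y_coord l - Y_coord k * X_coord p l)"
    "X_coord p (bracket_coeff k l) = K_coord k * X_coord p l - X_coord p k * K_coord l"
    "Y_coord (bracket_coeff k l) = Y_coord k * K_coord l - K_coord k * Y_coord l"
proof -
  have ss: "s * s = 1" "s * (s * x) = x" for x using s by auto
  have XY: "X_coord p k * Y_coord l
      = p * ((k 2 + k 3) * ((\<alpha> - \<eta> / 2) * l 2 - (\<alpha> + \<eta> / 2) * l 3)) / (4 * \<alpha>^2)" for k l
    by (simp add: X_coord_def Y_coord_def power2_eq_square)
  have "t * (X_coord p k * Y_coord l - Y_coord k * X_coord p l)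
    = (p * t) * ((k 2 + k 3) * ((\<alpha> - \<eta> / 2) * l 2 - (\<alpha> + \<eta> / 2) * l 3)
        - (l 2 + l 3) * ((\<alpha> - \<eta> / 2) * k 2 - (\<alpha> + \<eta> / 2) * k 3)) / (4 * \<alpha>^2)"
    unfolding mult.commute[of "Y_coord k"] XY diff_divide_distrib[symmetric] right_diff_distrib[symmetric]
    by (simp add: ac_simps)
  also have "\<dots> = K_coord (bracket_coeff k l)"
    unfolding assms(2) using assms(1)
    by (simp add: coord_defs bracket_coeff_def L3_values \<epsilon> field_simps power2_eq_square ss del: One_nat_def)
  finally show "K_coord (bracket_coeff k l) = t * (X_coord p k * Y_coord l - Y_coord k * X_coord p l)" by simp
  show "X_coord p (bracket_coeff k l) = K_coord k * X_coord p l - X_coord p k * K_coord l"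
    "Y_coord (bracket_coeff k l) = Y_coord k * K_coord l - K_coord k * Y_coord l"
    using assms(1)
    by (simp_all add: coord_defs bracket_coeff_def L3_values \<epsilon> field_simps ss del: One_nat_def)
qed

lemma coord_linear:
  "K_coord (\<lambda>i. k i + l i) = K_coord k + K_coord l" "K_coord (\<lambda>i. c * k i) = c * K_coord k"
  "X_coord p (\<lambda>i. k i + l i) = X_coord p k + X_coord p l" "X_coord p (\<lambda>i. c * k i) = c * X_coord p k"
  "Y_coord (\<lambda>i. k i + l i) = Y_coord k + Y_coord l" "Y_coord (\<lambda>i. c * k i) = c * Y_coord k"
  by (simp_all add: coord_defs add_divide_distrib[symmetric] algebra_simps)

lemma coord_inj:
  assumes "\<alpha> \<noteq> 0" "p \<noteq> 0"
  shows "(K_coord k = K_coord l \<and> X_coord p k = X_coord p l \<and> Y_coord k = Y_coord l) \<longleftrightarrow> (\<forall>i\<in>{1..3}. k i = l i)"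
proof
  assume "\<forall>i\<in>{1..3}. k i = l i"
  then show "K_coord k = K_coord l \<and> X_coord p k = X_coord p l \<and> Y_coord k = Y_coord l"
    by (simp add: coord_defs)
next
  assume a: "K_coord k = K_coord l \<and> X_coord p k = X_coord p l \<and> Y_coord k = Y_coord l"
  have s0: "s \<noteq> 0" using s by auto
  have 1: "k 1 = l 1" using a s0 assms by (simp add: coord_defs)
  have 23: "k 2 + k 3 = l 2 + l 3" using a assms by (simp add: coord_defs)
  have "(\<alpha> - \<eta> / 2) * k 2 - (\<alpha> + \<eta> / 2) * k 3 = (\<alpha> - \<eta> / 2) * l 2 - (\<alpha> + \<eta> / 2) * l 3"
    using a assms by (simp add: coord_defs)
  then have "2 * \<alpha> * k 2 - (\<alpha> + \<eta> / 2) * (k 2 + k 3) = 2 * \<alpha> * l 2 - (\<alpha> + \<eta> / 2) * (l 2 + l 3)"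
    by (simp add: algebra_simps)
  then have "k 2 = l 2" using 23 assms by simp
  moreover from this have "k 3 = l 3" using 23 by simp
  moreover have "{1..3::nat} = {1, 2, 3}" by auto
  ultimately show "\<forall>i\<in>{1..3}. k i = l i" using 1 by simp
qed

lemma coord_surj:
  assumes "\<alpha> \<noteq> 0" "p \<noteq> 0"
  shows "\<exists>k. K_coord k = a \<and> X_coord p k = b \<and> Y_coord k = c"
proof -
  have ss: "s * s = 1" "s * (s * x) = x" for x using s by auto
  show ?thesis
    using assms
    by (intro exI[of _ "\<lambda>i. if i = 1 then - s * a / \<alpha>
        else if i = 2 then c + (\<alpha> + \<eta> / 2) * b / p else (\<alpha> - \<eta> / 2) * b / p - c"])
      (simp add: coord_defs field_simps ss)
qed

lemma so21_iso:
  assumes "\<alpha> \<noteq> 0" "\<beta> \<noteq> 0"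
  shows "is_so21 G"
  unfolding is_so21_def
proof (rule lie_isoI)
  let ?p = "- (\<alpha>^2 * \<beta>)"
  let ?\<phi> = "\<lambda>k. so21_elem (K_coord k) (X_coord ?p k) (Y_coord k)"
  have p: "?p \<noteq> 0" using assms by simp
  show "y \<in> so_of J21 \<longleftrightarrow> (\<exists>k. y = ?\<phi> k)" for y
    unfolding so21_iff using coord_surj[OF assms(1) p] by metis
  show "?\<phi> k = ?\<phi> l \<longleftrightarrow> (\<forall>i\<in>{1..3}. k i = l i)" for k l
    unfolding so21_elem_simps(3) using coord_inj[OF assms(1) p] by blast
  show "?\<phi> (\<lambda>i. k i + l i) = ?\<phi> k + ?\<phi> l" "?\<phi> (\<lambda>i. c * k i) = c *\<^sub>R ?\<phi> k" for k l c
    by (simp_all only: so21_elem_simps coord_linear)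
  show "?\<phi> (bracket_coeff k l) = commutator (?\<phi> k) (?\<phi> l)" for k l
    using coord_bracket[OF assms(1), of ?p "-2" k l] by (simp add: so21_elem_simps)
qed

lemma e11_iso:
  assumes "\<alpha> \<noteq> 0" "\<beta> = 0"
  shows "is_e11 G"
  unfolding is_e11_def
proof (rule lie_isoI)
  let ?\<phi> = "\<lambda>k. e11_elem (K_coord k) (X_coord 1 k) (Y_coord k)"
  show "y \<in> e11 \<longleftrightarrow> (\<exists>k. y = ?\<phi> k)" for y
    unfolding e11_iff using coord_surj[OF assms(1), of 1] by (metis zero_neq_one)
  show "?\<phi> k = ?\<phi> l \<longleftrightarrow> (\<forall>i\<in>{1..3}. k i = l i)" for k l
    unfolding e11_elem_simps(3) using coord_inj[OF assms(1), of 1] by simp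
  show "?\<phi> (\<lambda>i. k i + l i) = ?\<phi> k + ?\<phi> l" "?\<phi> (\<lambda>i. c * k i) = c *\<^sub>R ?\<phi> k" for k l c
    by (simp_all only: e11_elem_simps coord_linear)
  show "?\<phi> (bracket_coeff k l) = affine_bracket (?\<phi> k) (?\<phi> l)" for k l
    using coord_bracket[OF assms(1), of 1 0 k l] assms(2) by (simp add: e11_elem_simps)
qed

text \<open>For \<open>\<alpha> = 0\<close>, the functional \<open>k \<mapsto> k 2 + k 3\<close> vanishes on all brackets, whereas every
  element of \<open>so(2,1)\<close> is a sum of brackets.\<close>

lemma not_so21:
  assumes "\<alpha> = 0"
  shows "\<not> is_so21 G"
proof
  assume "is_so21 G"
  then obtain \<Phi> where bij: "bij_betw \<Phi> (lie_alg G) (so_of J21)"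
    and add: "\<And>x y. x \<in> lie_alg G \<Longrightarrow> y \<in> lie_alg G \<Longrightarrow> \<Phi> (x + y) = \<Phi> x + \<Phi> y"
    and br: "\<And>x y. x \<in> lie_alg G \<Longrightarrow> y \<in> lie_alg G \<Longrightarrow> \<Phi> (lie_bracket x y) = commutator (\<Phi> x) (\<Phi> y)"
    unfolding is_so21_def lie_iso_def by blast
  have pre: "\<exists>k. \<Phi> (comb k) = so21_elem a b c" for a b c
  proof -
    have "so21_elem a b c \<in> \<Phi> ` lie_alg G" using bij so21_iff by (auto simp: bij_betw_def)
    then show ?thesis using lie_alg_comb by (metis imageE)
  qed
  define w where "w i = (if i = 2 then 1 else 0 :: real)" for i :: nat
  have "\<Phi> (comb w) \<in> so_of J21" using bij comb_lie_alg by (auto simp: bij_betw_def)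
  then obtain a b c where w: "\<Phi> (comb w) = so21_elem a b c" unfolding so21_iff by blast
  obtain k1 k2 k3 k4 k5 where k: "\<Phi> (comb k1) = so21_elem 0 (- a / 2) 0" "\<Phi> (comb k2) = so21_elem 0 0 1"
    "\<Phi> (comb k3) = so21_elem 1 0 0" "\<Phi> (comb k4) = so21_elem 0 b (- c)"
    using pre by metis
  let ?z = "\<lambda>i. bracket_coeff k1 k2 i + bracket_coeff k3 k4 i"
  have "\<Phi> (comb (bracket_coeff k l)) = commutator (\<Phi> (comb k)) (\<Phi> (comb l))" for k l
    using br[OF comb_lie_alg comb_lie_alg, of k l] by (simp only: lie_bracket_comb)
  then have "\<Phi> (comb ?z) = commutator (\<Phi> (comb k1)) (\<Phi> (comb k2)) + commutator (\<Phi> (comb k3)) (\<Phi> (comb k4))"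
    using add[OF comb_lie_alg comb_lie_alg, of "bracket_coeff k1 k2" "bracket_coeff k3 k4"]
    by (simp only: comb_add)
  also have "\<dots> = \<Phi> (comb w)" unfolding k w so21_elem_simps by simp
  finally have "comb ?z = comb w"
    using bij comb_lie_alg unfolding bij_betw_def inj_on_def by blast
  then have "?z 2 = 1" "?z 3 = 0"
    using comb_inj[of ?z w 2] comb_inj[of ?z w 3] by (simp_all add: w_def)
  moreover have "bracket_coeff k l 2 + bracket_coeff k l 3 = 0" for k l
    unfolding bracket_coeff_def L3_values \<epsilon> using assms by (simp add: algebra_simps)
  from this[of k1 k2] this[of k3 k4] have "?z 2 + ?z 3 = 0" by simp
  ultimately show False by simp
qed

end

section \<open>The classification\<close>

theorem theorem30:
  fixes G :: "('g::{t2_space, second_countable_topology}, real^3) lie_struct"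
    and g :: "'g form2" and v :: "nat \<Rightarrow> 'g vf" and \<epsilon> :: "nat \<Rightarrow> real"
    and \<alpha> \<beta> \<eta> h :: real
    and H :: "'g form3" and F :: "'g form2" and f :: "nat \<Rightarrow> nat \<Rightarrow> real"
    and \<delta> :: "'g sec \<Rightarrow> 'g \<Rightarrow> real" and d :: "nat \<Rightarrow> real"
  assumes G: "lie_group G"
    and metric: "pseudo_riemannian G g" "left_inv2 G g"
    and basis: "free_basis UNIV cscale (lie_alg G) {1..3} v"
    and orthonormal: "\<And>a b. a \<in> {1..3} \<Longrightarrow> b \<in> {1..3} \<Longrightarrow>
          g (v a) (v b) = (\<lambda>_. if a = b then \<epsilon> a else 0)"
      "\<And>a. a \<in> {1..3} \<Longrightarrow> \<epsilon> a \<in> {1, -1}"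
    and signs: "\<epsilon> 1 = \<epsilon> 2" "\<epsilon> 2 = - \<epsilon> 3"
    and eta: "\<eta> \<in> {1, -1}"
    and brackets:
      "lie_bracket (v 1) (v 2) = cscale (\<epsilon> 3) (apply_mat (L3 \<eta> \<alpha> \<beta>) v 3)"
      "lie_bracket (v 2) (v 3) = cscale (\<epsilon> 1) (apply_mat (L3 \<eta> \<alpha> \<beta>) v 1)"
      "lie_bracket (v 3) (v 1) = cscale (\<epsilon> 2) (apply_mat (L3 \<eta> \<alpha> \<beta>) v 2)"
    and H: "H \<in> three_forms G" "left_inv3 G H" "H (v 1) (v 2) (v 3) = (\<lambda>_. h)"
    and F: "closed_two_form G F" "left_inv2 G F" "F \<noteq> 0"
      "\<And>a b. a \<in> {1..3} \<Longrightarrow> b \<in> {1..3} \<Longrightarrow> F (v a) (v b) = (\<lambda>_. f a b)"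
    and delta: "left_inv_divergence G \<delta>"
      "\<And>A. A \<in> {0..6} \<Longrightarrow> \<delta> (e_basis g v A) = (\<lambda>_. d A)"
  shows
    "(gen_einstein G H F g \<delta> \<longleftrightarrow>
        class1 \<alpha> \<beta> \<epsilon> h f d \<or> class2 \<alpha> \<beta> \<epsilon> h f d \<or> class3 \<eta> \<alpha> \<beta> \<epsilon> h f d \<or> class4 \<eta> \<alpha> \<beta> \<epsilon> h f d)
     \<and> (class1 \<alpha> \<beta> \<epsilon> h f d \<longrightarrow> is_so21 G)
     \<and> (class2 \<alpha> \<beta> \<epsilon> h f d \<longrightarrow> (is_so21 G \<longleftrightarrow> \<alpha> \<noteq> 0))
     \<and> (class3 \<eta> \<alpha> \<beta> \<epsilon> h f d \<longrightarrow> is_e11 G)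
     \<and> (class4 \<eta> \<alpha> \<beta> \<epsilon> h f d \<longrightarrow> is_so21 G)"
proof -
  interpret smooth_manifold G
    using G by unfold_locales (simp add: lie_group_def)
  have s: "\<epsilon> 1 = 1 \<or> \<epsilon> 1 = -1" using orthonormal(2)[of 1] by auto
  have \<epsilon>: "\<epsilon> 2 = \<epsilon> 1" "\<epsilon> 3 = - \<epsilon> 1" using signs by simp_all
  interpret L: lie_frame_L3 G v \<epsilon> \<eta> \<alpha> \<beta> "\<epsilon> 1"
    by unfold_locales (fact basis brackets \<epsilon> s refl)+
  note F_nonzero = F(3)
  have F2: "F \<in> two_forms G" using F(1) by (simp add: closed_two_form_def)
  interpret frame_3_L3 G v H F g \<epsilon> \<eta> \<alpha> \<beta> h f "\<epsilon> 1"
  proof unfold_locales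
    show "v i \<in> vfields G" if "i \<in> {1..3}" for i
      using lie_alg_vfields[OF L.v_lie_alg[OF that]] .
    show "\<exists>c. (\<forall>i\<in>{1..3}. c i \<in> C_inf G) \<and> X = (\<Sum>i\<in>{1..3}. fmul (c i) (v i))" if "X \<in> vfields G" for X
      by (rule left_invariant_frame_spans[OF G basis that])
    show "lie_bracket (v i) (v j) \<in> vfields G" if "i \<in> {1..3}" "j \<in> {1..3}" for i j
      using lie_alg_vfields[OF L.lie_bracket_lie_alg[OF L.v_lie_alg[OF that(1)] L.v_lie_alg[OF that(2)]]] .
    show "g X \<in> one_forms G" if "X \<in> vfields G" for X
      using metric(1) that unfolding pseudo_riemannian_def by blast
    show "g X Y = g Y X" if "X \<in> vfields G" "Y \<in> vfields G" for X Y
      using metric(1) that unfolding pseudo_riemannian_def by blast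
    show "\<epsilon> a * \<epsilon> a = 1" if "a \<in> {1..3}" for a
      using orthonormal(2)[OF that] by auto
    show "\<eta> = 1 \<or> \<eta> = -1" using eta by simp
  qed (fact H F2 orthonormal(1) brackets F(4) \<epsilon> s refl)+
  have K_le: "A \<in> {0..6}" if "A \<in> K" for A using that by (auto simp: K_def)
  have "gen_einstein G H F g \<delta> \<longleftrightarrow> (\<forall>i\<in>{4..6}. \<forall>a\<in>{0..3}. ric {0..3} d i a = 0 \<and> ric {4..6} d a i = 0)"
    using delta(1) delta(2)[OF K_le] by (intro gen_einstein_iff) (simp_all add: left_inv_divergence_def)
  also have "\<dots> \<longleftrightarrow>
      class1 \<alpha> \<beta> \<epsilon> h f d \<or> class2 \<alpha> \<beta> \<epsilon> h f d \<or> class3 \<eta> \<alpha> \<beta> \<epsilon> h f d \<or> class4 \<eta> \<alpha> \<beta> \<epsilon> h f d"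
    using equations_imp_classes[OF F_frame_nonzero[OF F_nonzero], of d] classes_imp_equations[of d] by blast
  finally have "gen_einstein G H F g \<delta> \<longleftrightarrow>
      class1 \<alpha> \<beta> \<epsilon> h f d \<or> class2 \<alpha> \<beta> \<epsilon> h f d \<or> class3 \<eta> \<alpha> \<beta> \<epsilon> h f d \<or> class4 \<eta> \<alpha> \<beta> \<epsilon> h f d" .
  moreover have "class1 \<alpha> \<beta> \<epsilon> h f d \<longrightarrow> \<alpha> \<noteq> 0 \<and> \<beta> \<noteq> 0" "class2 \<alpha> \<beta> \<epsilon> h f d \<longrightarrow> \<beta> \<noteq> 0"
    "class3 \<eta> \<alpha> \<beta> \<epsilon> h f d \<longrightarrow> \<alpha> \<noteq> 0 \<and> \<beta> = 0" "class4 \<eta> \<alpha> \<beta> \<epsilon> h f d \<longrightarrow> \<alpha> \<noteq> 0 \<and> \<beta> \<noteq> 0"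
    by (auto simp: class1_def class2_def class3_def class4_def)
  ultimately show ?thesis
    using L.so21_iso L.e11_iso L.not_so21 by blast
qed

end
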